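(* Let $m$ be a positive integer and let $K\in C^{[m]}(I^2)$ be independent of $\kappa$. Let $(\mathcal{K}u)(s)=\int_IK(s,t)e^{i\kappa|s-t|}u(t)\,dt$. Then for every $n\in\{1,\dots,m\}$, $\mathcal{K}^n$ maps $H^m_\kappa(I)$ into $\tilde H^m_{\kappa,m-n}(I)$.
   Context: $I=[-1,1]$; $\kappa\in(1,\infty)$; functions are complex-valued; a $\kappa$-parameterized function is a family indexed by $\kappa>1$; operators act $\kappa$-wise; "independent of $\kappa$" means a fixed function. $C^{[m]}(I^2)$: functions on $I^2$ with continuous $\partial_s^\alpha\partial_t^\beta$ derivatives, $\alpha,\beta\le m$. $H^m(I)$ is the Sobolev space with $\|u\|_{H^p}=(\sum_{j=0}^p\|u^{(j)}\|_{L^2(I)}^2)^{1/2}$. $H^m_\kappa(I)$: $\kappa$-parameterized $u\in H^m(I)$ with positive constants $c,\kappa_0$ such that $\|u\|_{H^p}\le c\kappa^p$ for all $p\in\{0,\dots,m\}$ and $\kappa\ge\kappa_0$. For $k\ge0$, $H^m_{\kappa,k}(I)$: $\kappa$-parameterized $u\in H^m(I)$ with $\|u\|_{H^m}\le c\kappa^k$ for all $\kappa\ge\kappa_0$; $\tilde H^m_{\kappa,k}(I)=\{u_0+u_1e^{i\kappa t}+u_2e^{-i\kappa t}:u_j\in H^m_{\kappa,k}(I)\}$. *)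

theory Defs
  imports "HOL-Analysis.Analysis"
begin

definition II :: "real set" where "II = {-1..1}"

text \<open>C^[m](I^2): D a b = partial_s^a partial_t^b K, all continuous on I x I.
  The t-derivatives are taken first (a = 0), then s-derivatives.\<close>
definition Cm :: "nat \<Rightarrow> (real \<Rightarrow> real \<Rightarrow> complex) \<Rightarrow> bool" where
  "Cm m K \<longleftrightarrow> (\<exists>D :: nat \<Rightarrow> nat \<Rightarrow> real \<Rightarrow> real \<Rightarrow> complex.
     (\<forall>s\<in>II. \<forall>t\<in>II. D 0 0 s t = K s t) \<and>
     (\<forall>b<m. \<forall>s\<in>II. \<forall>t\<in>II.
        ((\<lambda>t'. D 0 b s t') has_vector_derivative D 0 (Suc b) s t) (at t within II)) \<and>
     (\<forall>a<m. \<forall>b\<le>m. \<forall>s\<in>II. \<forall>t\<in>II.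
        ((\<lambda>s'. D a b s' t) has_vector_derivative D (Suc a) b s t) (at s within II)) \<and>
     (\<forall>a\<le>m. \<forall>b\<le>m. continuous_on (II \<times> II) (\<lambda>(s,t). D a b s t)))"

definition L2 :: "(real \<Rightarrow> complex) \<Rightarrow> bool" where
  "L2 v \<longleftrightarrow> v \<in> borel_measurable (lebesgue_on II) \<and>
            integrable (lebesgue_on II) (\<lambda>x. (cmod (v x))\<^sup>2)"

definition L2norm :: "(real \<Rightarrow> complex) \<Rightarrow> real" where
  "L2norm v = sqrt (integral\<^sup>L (lebesgue_on II) (\<lambda>x. (cmod (v x))\<^sup>2))"

definition test_fun :: "(nat \<Rightarrow> real \<Rightarrow> real) \<Rightarrow> bool" where
  "test_fun \<Phi> \<longleftrightarrow> (\<forall>k x. (\<Phi> k has_real_derivative \<Phi> (Suc k) x) (at x)) \<and>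
     (\<exists>a b. -1 < a \<and> b < 1 \<and> (\<forall>x. x \<notin> {a..b} \<longrightarrow> \<Phi> 0 x = 0))"

definition weak_derivs :: "nat \<Rightarrow> (real \<Rightarrow> complex) \<Rightarrow> (nat \<Rightarrow> real \<Rightarrow> complex) \<Rightarrow> bool" where
  "weak_derivs m u v \<longleftrightarrow> (\<forall>j\<le>m. L2 (v j)) \<and>
     (AE x in lebesgue_on II. v 0 x = u x) \<and>
     (\<forall>j\<le>m. \<forall>\<Phi>. test_fun \<Phi> \<longrightarrow>
        integral\<^sup>L (lebesgue_on II) (\<lambda>x. u x * complex_of_real (\<Phi> j x)) =
        (-1) ^ j * integral\<^sup>L (lebesgue_on II) (\<lambda>x. v j x * complex_of_real (\<Phi> 0 x)))"

definition Hm :: "nat \<Rightarrow> (real \<Rightarrow> complex) \<Rightarrow> bool" where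
  "Hm m u \<longleftrightarrow> (\<exists>v. weak_derivs m u v)"

text \<open>Sobolev norm ||u||_{H^p} (weak derivatives are unique a.e., so the choice is irrelevant).\<close>
definition Hnorm :: "nat \<Rightarrow> (real \<Rightarrow> complex) \<Rightarrow> real" where
  "Hnorm p u = (let v = (SOME v. weak_derivs p u v) in
                 sqrt (\<Sum>j\<le>p. (L2norm (v j))\<^sup>2))"

definition Hk :: "nat \<Rightarrow> (real \<Rightarrow> real \<Rightarrow> complex) \<Rightarrow> bool" where
  "Hk m u \<longleftrightarrow> (\<forall>\<kappa>>1. Hm m (u \<kappa>)) \<and>
     (\<exists>c \<kappa>0. c > 0 \<and> \<kappa>0 > 0 \<and>
        (\<forall>p\<le>m. \<forall>\<kappa>. \<kappa> > 1 \<and> \<kappa> \<ge> \<kappa>0 \<longrightarrow> Hnorm p (u \<kappa>) \<le> c * \<kappa> ^ p))"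

definition Hkk :: "nat \<Rightarrow> real \<Rightarrow> (real \<Rightarrow> real \<Rightarrow> complex) \<Rightarrow> bool" where
  "Hkk m k u \<longleftrightarrow> (\<forall>\<kappa>>1. Hm m (u \<kappa>)) \<and>
     (\<exists>c \<kappa>0. c > 0 \<and> \<kappa>0 > 0 \<and>
        (\<forall>\<kappa>. \<kappa> > 1 \<and> \<kappa> \<ge> \<kappa>0 \<longrightarrow> Hnorm m (u \<kappa>) \<le> c * \<kappa> powr k))"

definition Hkk_tilde :: "nat \<Rightarrow> real \<Rightarrow> (real \<Rightarrow> real \<Rightarrow> complex) \<Rightarrow> bool" where
  "Hkk_tilde m k w \<longleftrightarrow> (\<exists>u0 u1 u2. Hkk m k u0 \<and> Hkk m k u1 \<and> Hkk m k u2 \<and>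
     (\<forall>\<kappa>>1. \<forall>t\<in>II. w \<kappa> t = u0 \<kappa> t + u1 \<kappa> t * exp (\<i> * complex_of_real (\<kappa> * t))
                                          + u2 \<kappa> t * exp (- \<i> * complex_of_real (\<kappa> * t))))"

definition Kop :: "(real \<Rightarrow> real \<Rightarrow> complex) \<Rightarrow> real \<Rightarrow> (real \<Rightarrow> complex) \<Rightarrow> (real \<Rightarrow> complex)" where
  "Kop K \<kappa> u = (\<lambda>s. integral\<^sup>L (lebesgue_on II)
                     (\<lambda>t. K s t * exp (\<i> * complex_of_real (\<kappa> * \<bar>s - t\<bar>)) * u t))"

end

theory Submission
  imports Defs
begin

text \<open>The class \<open>A n\<close> consists of the parameterized functions whose \<open>p\<close>-th derivative is
  \<open>O(\<kappa> ^ (p - n))\<close> in \<open>L\<^sup>2\<close> (and \<open>O(1)\<close> for \<open>p \<le> n\<close>), so \<open>u\<close> lies in \<open>A 0\<close>. The operator maps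
  \<open>A n + A n e\<^sup>i\<^sup>\<kappa>\<^sup>t + A n e\<^sup>-\<^sup>i\<^sup>\<kappa>\<^sup>t\<close> to the same space for \<open>n + 1\<close>. Splitting the integral at \<open>t = s\<close>
  reduces this to Volterra integrals with phase \<open>\<sigma> \<kappa> t\<close>, whose derivative is \<open>e\<^sup>i\<^sup>\<sigma>\<^sup>\<kappa>\<^sup>s g\<close> plus an integral
  of the same kind with \<open>K\<close> replaced by its \<open>s\<close>-derivative; by downward induction on the order of
  that derivative one has to integrate \<open>e\<^sup>i\<^sup>\<sigma>\<^sup>\<kappa>\<^sup>s g\<close> with \<open>g\<close> in \<open>A n\<close>. If \<open>\<sigma> = 0\<close>, integration
  itself raises \<open>n\<close>. Otherwise repeated integration by parts would produce boundary terms with too many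
  derivatives of \<open>g\<close>, so each step integrates by parts only the average of \<open>g\<close> at scale \<open>1 / \<kappa>\<close>,
  which has one more derivative, and puts the remainder back under the integral.\<close>

text \<open>For n \<le> m the H^m norm of an element of \<open>A n\<close> is governed by its top
  derivative, of size O(\<kappa>^(m - n)); this gives the claim, while the bounds on the lower
  orders keep the induction on n running. Phases do not accumulate. An input of phase \<sigma>
  enters the two Volterra integrals with phase \<sigma> - 1 or \<sigma> + 1, and each integral
  returns a non-oscillating part and a part of the phase it received. Multiplying back by the outer
  exponential leaves only the phases 1, -1 and \<sigma>. Both pieces of a split primitive must have
  one derivative more than g, as the primitive itself has. The plain boundary term g / (i \<sigma>
  \<kappa>) has only as many as g. Its averaged version has one more, and the factor \<kappa> which
  that derivative costs is cancelled by the denominator. The price is the averaging error, a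
  difference of g over a window of length 2 / \<kappa>, which is 1 / \<kappa> times the size of
  g'.\<close>

section \<open>Square-integrable functions on the interval\<close>

text \<open>All auxiliary functions are Borel measurable on the whole real line, so that affine
  substitutions and functions of two variables stay measurable; nothing is lost, because a Lebesgue measurable
  function agrees almost everywhere with a Borel function.\<close>

definition sqn :: "(real \<Rightarrow> complex) \<Rightarrow> real" where
  "sqn f = (LBINT x:II. (cmod (f x))\<^sup>2)"

definition sq_int :: "(real \<Rightarrow> complex) \<Rightarrow> bool" where
  "sq_int f \<longleftrightarrow> f \<in> borel_measurable borel \<and> set_integrable lborel II (\<lambda>x. (cmod (f x))\<^sup>2)"

lemma II_meas [measurable, simp]: "II \<in> sets borel" "II \<in> sets lborel"
  by (simp_all add: II_def)

lemma sq_int_meas: "sq_int f \<Longrightarrow> f \<in> borel_measurable borel"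
  by (simp add: sq_int_def)

lemma set_integrable_const_II: "set_integrable lborel II (\<lambda>x. c :: 'a :: {banach, second_countable_topology})"
  unfolding II_def by (rule borel_integrable_atLeastAtMost') (rule continuous_on_const)

lemma integral_const_II: "(LBINT x:II. c :: real) = 2 * c"
  using set_borel_integral_eq_integral(2)[OF set_integrable_const_II[of c]] by (simp add: II_def)

lemma lebesgue_on_II_integral:
  fixes f :: "real \<Rightarrow> 'a::{banach, second_countable_topology}"
  assumes "f \<in> borel_measurable borel"
  shows "integral\<^sup>L (lebesgue_on II) f = (LBINT t:II. f t)"
    and "integrable (lebesgue_on II) f \<longleftrightarrow> set_integrable lborel II f"
proof -
  note [measurable] = assms
  have m: "(\<lambda>t. indicator II t *\<^sub>R f t) \<in> borel_measurable lborel" by measurable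
  show "integral\<^sup>L (lebesgue_on II) f = (LBINT t:II. f t)"
    by (subst integral_restrict_space) (auto simp: set_lebesgue_integral_def integral_completion[OF m])
  show "integrable (lebesgue_on II) f \<longleftrightarrow> set_integrable lborel II f"
    by (subst integrable_restrict_space) (auto simp: set_integrable_def integrable_completion[OF m])
qed

lemma sq_int_dominated:
  assumes "f \<in> borel_measurable borel" "set_integrable lborel II g"
    and "\<And>x. x \<in> II \<Longrightarrow> (cmod (f x))\<^sup>2 \<le> g x"
  shows "sq_int f" "sqn f \<le> (LBINT x:II. g x)"
proof -
  note [measurable] = assms(1)
  show s: "sq_int f"
    unfolding sq_int_def
  proof (intro conjI assms(1))
    show "set_integrable lborel II (\<lambda>x. (cmod (f x))\<^sup>2)"
    proof (rule set_integrable_bound[OF assms(2)])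
      show "set_borel_measurable lborel II (\<lambda>x. (cmod (f x))\<^sup>2)"
        unfolding set_borel_measurable_def by measurable
      show "AE x in lborel. x \<in> II \<longrightarrow> norm ((cmod (f x))\<^sup>2) \<le> norm (g x)"
        by (rule AE_I2) (use assms(3) in fastforce)
    qed
  qed
  show "sqn f \<le> (LBINT x:II. g x)"
    unfolding sqn_def
    by (rule set_integral_mono) (use s assms in \<open>auto simp: sq_int_def\<close>)
qed

lemma sqn_nonneg: "sqn f \<ge> 0"
  unfolding sqn_def set_lebesgue_integral_def by (rule Bochner_Integration.integral_nonneg) auto

lemma sq_int_mult_bound:
  assumes "f \<in> borel_measurable borel" "sq_int g"
    and "\<And>x. x \<in> II \<Longrightarrow> cmod (f x) \<le> C * cmod (g x)"
  shows "sq_int f" "sqn f \<le> C\<^sup>2 * sqn g"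
proof -
  have i: "set_integrable lborel II (\<lambda>x. C\<^sup>2 * (cmod (g x))\<^sup>2)"
    using assms(2) by (auto simp: sq_int_def)
  have b: "(cmod (f x))\<^sup>2 \<le> C\<^sup>2 * (cmod (g x))\<^sup>2" if "x \<in> II" for x
    using power_mono[OF assms(3)[OF that], of 2] by (simp add: power_mult_distrib)
  show "sq_int f" by (rule sq_int_dominated(1)[OF assms(1) i b])
  show "sqn f \<le> C\<^sup>2 * sqn g"
    using sq_int_dominated(2)[OF assms(1) i b] by (simp add: sqn_def)
qed

lemma sq_int_bounded:
  assumes "f \<in> borel_measurable borel" "\<And>x. x \<in> II \<Longrightarrow> cmod (f x) \<le> C"
  shows "sq_int f" "sqn f \<le> 2 * C\<^sup>2"
proof -
  have b: "(cmod (f x))\<^sup>2 \<le> C\<^sup>2" if "x \<in> II" for x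
    using power_mono[OF assms(2)[OF that], of 2] by simp
  show "sq_int f" by (rule sq_int_dominated(1)[OF assms(1) set_integrable_const_II b])
  show "sqn f \<le> 2 * C\<^sup>2"
    using sq_int_dominated(2)[OF assms(1) set_integrable_const_II b] by (simp add: integral_const_II)
qed

lemma sq_int_add:
  assumes "sq_int f" "sq_int g"
  shows "sq_int (\<lambda>x. f x + g x)" "sqn (\<lambda>x. f x + g x) \<le> 2 * sqn f + 2 * sqn g"
proof -
  note [measurable] = assms[THEN sq_int_meas]
  have i: "set_integrable lborel II (\<lambda>x. 2 * (cmod (f x))\<^sup>2 + 2 * (cmod (g x))\<^sup>2)"
    using assms by (auto simp: sq_int_def)
  have b: "(cmod (f x + g x))\<^sup>2 \<le> 2 * (cmod (f x))\<^sup>2 + 2 * (cmod (g x))\<^sup>2" for x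
    using power_mono[OF norm_triangle_ineq[of "f x" "g x"], of 2]
      sum_squares_bound[of "cmod (f x)" "cmod (g x)"] by (simp add: power2_sum)
  have m: "(\<lambda>x. f x + g x) \<in> borel_measurable borel" by measurable
  show "sq_int (\<lambda>x. f x + g x)" by (rule sq_int_dominated(1)[OF m i b])
  show "sqn (\<lambda>x. f x + g x) \<le> 2 * sqn f + 2 * sqn g"
    using sq_int_dominated(2)[OF m i b] assms by (simp add: sqn_def sq_int_def)
qed

lemma sq_int_cmult:
  assumes "sq_int g" shows "sq_int (\<lambda>x. c * g x)"
proof (rule sq_int_mult_bound(1)[OF _ assms, of _ "cmod c"])
  note [measurable] = sq_int_meas[OF assms]
  show "(\<lambda>x. c * g x) \<in> borel_measurable borel" by measurable
qed (simp add: norm_mult)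

lemma sq_int_integrable:
  assumes "sq_int f" shows "set_integrable lborel II f"
proof (rule set_integrable_bound)
  note [measurable] = assms[THEN sq_int_meas]
  show "set_integrable lborel II (\<lambda>x. 1 + (cmod (f x))\<^sup>2)"
    using assms set_integrable_const_II[of "1::real"] by (auto simp: sq_int_def)
  show "set_borel_measurable lborel II f"
    unfolding set_borel_measurable_def by measurable
  have "cmod (f x) \<le> 1 + (cmod (f x))\<^sup>2" for x
  proof -
    have "2 * cmod (f x) \<le> 1 + (cmod (f x))\<^sup>2" using sum_squares_bound[of "cmod (f x)" 1] by simp
    then show ?thesis using norm_ge_zero[of "f x"] by linarith
  qed
  then show "AE x in lborel. x \<in> II \<longrightarrow> norm (f x) \<le> norm (1 + (cmod (f x))\<^sup>2)"
    by auto
qed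

lemma sq_int_integrable_sub:
  assumes "sq_int f" "a \<in> II" "b \<in> II" shows "set_integrable lborel {a..b} f"
  by (rule set_integrable_subset[OF sq_int_integrable[OF assms(1)]]) (use assms in \<open>auto simp: II_def\<close>)

text \<open>Cauchy-Schwarz against the constant function 1, in the form that the variance of
  \<open>h\<close> about its mean \<open>c\<close> is nonnegative.\<close>

lemma integral_sq_le:
  fixes h :: "real \<Rightarrow> real"
  assumes "set_integrable lborel {a..b} h" "set_integrable lborel {a..b} (\<lambda>x. (h x)\<^sup>2)" "a \<le> b"
  shows "(LBINT x:{a..b}. h x)\<^sup>2 \<le> (b - a) * (LBINT x:{a..b}. (h x)\<^sup>2)"
proof (cases "a = b")
  case True
  have "(LBINT x:{b}. h x) = 0"
    using set_borel_integral_eq_integral(2)[OF assms(1)] True by simp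
  then show ?thesis using True by simp
next
  case False
  define I where "I = (LBINT x:{a..b}. h x)"
  define c where "c = I / (b - a)"
  have k: "set_integrable lborel {a..b} (\<lambda>x. c\<^sup>2)"
    by (rule borel_integrable_atLeastAtMost') (rule continuous_on_const)
  have kc: "(LBINT x:{a..b}. c\<^sup>2) = (b - a) * c\<^sup>2"
    using set_borel_integral_eq_integral(2)[OF k] assms(3) by simp
  have "0 \<le> (LBINT x:{a..b}. (h x - c)\<^sup>2)"
    unfolding set_lebesgue_integral_def by (rule Bochner_Integration.integral_nonneg) auto
  also have "\<dots> = (LBINT x:{a..b}. (h x)\<^sup>2 - 2 * c * h x + c\<^sup>2)"
    by (rule set_lebesgue_integral_cong) (auto simp: power2_diff)
  also have "\<dots> = (LBINT x:{a..b}. (h x)\<^sup>2) - 2 * c * I + (b - a) * c\<^sup>2"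
    using assms k kc by (simp add: I_def)
  finally have "0 \<le> (LBINT x:{a..b}. (h x)\<^sup>2) - 2 * c * I + (b - a) * c\<^sup>2" .
  moreover have "c * (b - a) = I" using False by (simp add: c_def)
  moreover have "(b - a) * c\<^sup>2 = c * (c * (b - a))" by (simp add: power2_eq_square)
  ultimately have "0 \<le> (LBINT x:{a..b}. (h x)\<^sup>2) - c * I" by (simp add: mult.commute)
  then have "0 \<le> (b - a) * ((LBINT x:{a..b}. (h x)\<^sup>2) - c * I)"
    using assms(3) by simp
  also have "\<dots> = (b - a) * (LBINT x:{a..b}. (h x)\<^sup>2) - (c * (b - a)) * I"
    by (simp add: algebra_simps)
  also have "\<dots> = (b - a) * (LBINT x:{a..b}. (h x)\<^sup>2) - I\<^sup>2"
    using \<open>c * (b - a) = I\<close> by (simp add: power2_eq_square)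
  finally show ?thesis by (simp add: I_def)
qed

lemma integral_norm_II_le:
  assumes "sq_int f" shows "(LBINT x:II. cmod (f x))\<^sup>2 \<le> 2 * sqn f"
proof -
  have "set_integrable lborel {-1..1} (\<lambda>x. cmod (f x))"
    using set_integrable_norm[OF sq_int_integrable[OF assms]] by (simp add: II_def)
  from integral_sq_le[OF this] show ?thesis
    using assms by (simp add: sqn_def sq_int_def II_def)
qed

text \<open>The change of variables is done on the whole line for \<open>H\<close>, the extension of
  |f|^2 by zero. The image of \<open>II\<close> may be a proper part of \<open>II\<close>, hence
  only an inequality, with the Jacobian 1 / c.\<close>

lemma sq_int_affine:
  assumes "sq_int f" "c > 0" "\<And>x. x \<in> II \<Longrightarrow> d + c * x \<in> II"
  shows "sq_int (\<lambda>x. f (d + c * x))" "sqn (\<lambda>x. f (d + c * x)) \<le> sqn f / c"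
proof -
  note [measurable] = assms(1)[THEN sq_int_meas]
  define H where "H = (\<lambda>x. indicator II x *\<^sub>R (cmod (f x))\<^sup>2)"
  have iH: "integrable lborel H" using assms(1) by (simp add: sq_int_def set_integrable_def H_def)
  have iHc: "integrable lborel (\<lambda>x. H (d + c * x))"
    using lborel_integrable_real_affine[OF iH, of c d] assms(2) by simp
  have vH: "integral\<^sup>L lborel (\<lambda>x. H (d + c * x)) = sqn f / c"
    using lborel_integral_real_affine[of c H d] assms(2)
    by (simp add: sqn_def set_lebesgue_integral_def H_def field_simps)
  have b: "(cmod (f (d + c * x)))\<^sup>2 \<le> H (d + c * x)" if "x \<in> II" for x
    using assms(3)[OF that] by (simp add: H_def)
  have nn: "H x \<ge> 0" for x by (simp add: H_def)
  have m: "(\<lambda>x. f (d + c * x)) \<in> borel_measurable borel" by measurable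
  have iH2: "set_integrable lborel II (\<lambda>x. H (d + c * x))"
    unfolding set_integrable_def by (rule integrable_mult_indicator[OF _ iHc]) simp
  show "sq_int (\<lambda>x. f (d + c * x))" by (rule sq_int_dominated(1)[OF m iH2 b])
  have "sqn (\<lambda>x. f (d + c * x)) \<le> (LBINT x:II. H (d + c * x))"
    by (rule sq_int_dominated(2)[OF m iH2 b])
  also have "\<dots> \<le> integral\<^sup>L lborel (\<lambda>x. H (d + c * x))"
    unfolding set_lebesgue_integral_def
    by (rule integral_mono) (use iHc iH2 nn in \<open>auto simp: set_integrable_def indicator_def\<close>)
  finally show "sqn (\<lambda>x. f (d + c * x)) \<le> sqn f / c" by (simp add: vH)
qed

section \<open>Indefinite integrals\<close>

text \<open>For square-integrable \<open>v\<close> this says that \<open>u\<close> is absolutely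
  continuous on \<open>II\<close> with weak derivative \<open>v\<close>. The integrated form leaves
  \<open>v\<close> free on null sets, as for Sobolev functions, and it combines directly with
  Fubini.\<close>

definition der :: "(real \<Rightarrow> complex) \<Rightarrow> (real \<Rightarrow> complex) \<Rightarrow> bool" where
  "der u v \<longleftrightarrow> (\<forall>x\<in>II. \<forall>y\<in>II. x \<le> y \<longrightarrow> (v has_integral u y - u x) {x..y})"

lemma derD: "der u v \<Longrightarrow> -1 \<le> x \<Longrightarrow> x \<le> y \<Longrightarrow> y \<le> 1 \<Longrightarrow> (v has_integral u y - u x) {x..y}"
  by (simp add: der_def II_def)

lemma derI:
  assumes "\<And>x y. -1 \<le> x \<Longrightarrow> x \<le> y \<Longrightarrow> y \<le> 1 \<Longrightarrow> (v has_integral u y - u x) {x..y}"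
  shows "der u v"
  using assms by (auto simp: der_def II_def)

lemma der_add:
  assumes "der u v" "der u' v'" shows "der (\<lambda>x. u x + u' x) (\<lambda>x. v x + v' x)"
proof (rule derI)
  fix x y :: real assume "-1 \<le> x" "x \<le> y" "y \<le> 1"
  from has_integral_add[OF derD[OF assms(1) this] derD[OF assms(2) this]]
  show "((\<lambda>x. v x + v' x) has_integral u y + u' y - (u x + u' x)) {x..y}"
    by (simp add: add_diff_add)
qed

lemma der_cmult:
  assumes "der u v" shows "der (\<lambda>x. c * u x) (\<lambda>x. c * v x)"
proof (rule derI)
  fix x y :: real assume "-1 \<le> x" "x \<le> y" "y \<le> 1"
  from has_integral_mult_right[OF derD[OF assms this], of c]
  show "((\<lambda>x. c * v x) has_integral c * u y - c * u x) {x..y}"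
    by (simp add: right_diff_distrib)
qed

lemma der_diff:
  assumes "der u v" "der u' v'" shows "der (\<lambda>x. u x - u' x) (\<lambda>x. v x - v' x)"
  using der_add[OF assms(1) der_cmult[OF assms(2), of "-1"]] by simp

lemma der_cong:
  assumes "der u v" "\<And>x. x \<in> II \<Longrightarrow> u x = u' x" "\<And>x. x \<in> II \<Longrightarrow> v x = v' x"
  shows "der u' v'"
  unfolding der_def
proof (intro ballI impI)
  fix x y assume h: "x \<in> II" "y \<in> II" "x \<le> y"
  show "(v' has_integral u' y - u' x) {x..y}"
  proof (rule has_integral_eq[of _ v])
    show "v z = v' z" if "z \<in> {x..y}" for z using that h assms(3) by (auto simp: II_def)
    show "(v has_integral u' y - u' x) {x..y}" using h assms by (auto simp: der_def)
  qed
qed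

lemma der_affine:
  assumes "der u v" "c > 0" "\<And>x. x \<in> II \<Longrightarrow> d + c * x \<in> II"
  shows "der (\<lambda>x. u (d + c * x)) (\<lambda>x. c * v (d + c * x))"
  unfolding der_def
proof (intro ballI impI)
  fix x y assume h: "x \<in> II" "y \<in> II" "x \<le> y"
  define X Y where "X = d + c * x" and "Y = d + c * y"
  have XY: "X \<in> II" "Y \<in> II" "X \<le> Y" using assms h by (auto simp: X_def Y_def)
  have e: "(X - d) / c = x" "(Y - d) / c = y" using assms(2) by (auto simp: X_def Y_def)
  have "(v has_integral u Y - u X) (cbox X Y)" using assms(1) XY by (auto simp: der_def)
  from has_integral_affinity'[OF this assms(2), of d]
  have "((\<lambda>x. v (c * x + d)) has_integral (u Y - u X) /\<^sub>R c) {x..y}"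
    using e by (simp add: divideR_right divide_inverse_commute)
  from has_integral_cmul[OF this, of c] assms(2)
  have "((\<lambda>x. c *\<^sub>R v (c * x + d)) has_integral (u Y - u X)) {x..y}" by simp
  then show "((\<lambda>x. of_real c * v (d + c * x)) has_integral u (d + c * y) - u (d + c * x)) {x..y}"
    by (simp add: X_def Y_def scaleR_conv_of_real add.commute)
qed

lemma der_FTC:
  assumes "\<And>x. x \<in> II \<Longrightarrow> (f has_vector_derivative f' x) (at x within II)"
  shows "der f f'"
  unfolding der_def
proof (intro ballI impI)
  fix x y assume h: "x \<in> II" "y \<in> II" "x \<le> y"
  show "(f' has_integral f y - f x) {x..y}"
  proof (rule fundamental_theorem_of_calculus[OF h(3)])
    fix z assume z: "z \<in> {x..y}"
    show "(f has_vector_derivative f' z) (at z within {x..y})"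
      by (rule has_vector_derivative_within_subset[OF assms]) (use z h in \<open>auto simp: II_def\<close>)
  qed
qed

section \<open>Volterra operators\<close>

abbreviation pair_borel :: "(real \<Rightarrow> real \<Rightarrow> complex) \<Rightarrow> bool" where
  "pair_borel k \<equiv> (\<lambda>(s,t). k s t) \<in> borel_measurable (borel \<Otimes>\<^sub>M borel)"

lemma set_integrable_bounded_mult:
  assumes "f \<in> borel_measurable borel" "\<And>x. cmod (f x) \<le> C" "v \<in> borel_measurable borel"
    and "set_integrable lborel S v" "S \<in> sets borel"
  shows "set_integrable lborel S (\<lambda>x. f x * v x :: complex)"
proof (rule set_integrable_bound)
  note [measurable] = assms(1,3,5)
  show "set_integrable lborel S (\<lambda>x. of_real C * v x)" using assms(4) by auto
  show "set_borel_measurable lborel S (\<lambda>x. f x * v x)"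
    unfolding set_borel_measurable_def by measurable
  show "AE x in lborel. x \<in> S \<longrightarrow> norm (f x * v x) \<le> norm (of_real C * v x)"
  proof (rule AE_I2, rule impI)
    fix x
    have "cmod (f x) \<le> \<bar>C\<bar>" using assms(2)[of x] by linarith
    then show "norm (f x * v x) \<le> norm (of_real C * v x)"
      by (simp add: norm_mult mult_right_mono)
  qed
qed

lemma kernel_integral_norm_le:
  assumes "f \<in> borel_measurable borel" "\<And>x. cmod (f x) \<le> C" "sq_int v"
  shows "set_integrable lborel II (\<lambda>t. f t * v t)"
    and "(LBINT t:II. cmod (f t * v t)) \<le> C * (LBINT t:II. cmod (v t))"
proof -
  have v: "v \<in> borel_measurable borel" "set_integrable lborel II v"
    using assms(3) sq_int_meas sq_int_integrable by auto
  show i: "set_integrable lborel II (\<lambda>t. f t * v t)"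
    by (rule set_integrable_bounded_mult[OF assms(1,2) v]) simp
  have "(LBINT t:II. cmod (f t * v t)) \<le> (LBINT t:II. C * cmod (v t))"
  proof (rule set_integral_mono)
    show "set_integrable lborel II (\<lambda>t. cmod (f t * v t))" by (rule set_integrable_norm[OF i])
    show "set_integrable lborel II (\<lambda>t. C * cmod (v t))" using set_integrable_norm[OF v(2)] by auto
    show "cmod (f t * v t) \<le> C * cmod (v t)" for t by (simp add: norm_mult mult_right_mono assms(2))
  qed
  then show "(LBINT t:II. cmod (f t * v t)) \<le> C * (LBINT t:II. cmod (v t))" by simp
qed

lemma kernel_integral_meas:
  assumes "pair_borel G" "v \<in> borel_measurable borel"
  shows "(\<lambda>s. LBINT t:II. G s t * v t :: complex) \<in> borel_measurable borel"
proof -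
  note [measurable] = assms
  have "(\<lambda>s. \<integral>t. indicator II t *\<^sub>R (G s t * v t) \<partial>lborel) \<in> borel_measurable borel"
    by measurable
  then show ?thesis by (simp add: set_lebesgue_integral_def)
qed

lemma kernel_integral_sq:
  assumes "pair_borel G" "\<And>s t. cmod (G s t) \<le> C" "sq_int v"
  shows "sq_int (\<lambda>s. LBINT t:II. G s t * v t)" "sqn (\<lambda>s. LBINT t:II. G s t * v t) \<le> 4 * C\<^sup>2 * sqn v"
proof -
  note [measurable] = assms(1)
  have m: "(\<lambda>s. LBINT t:II. G s t * v t) \<in> borel_measurable borel"
    by (rule kernel_integral_meas[OF assms(1) sq_int_meas[OF assms(3)]])
  have b: "cmod (LBINT t:II. G s t * v t) \<le> C * (LBINT t:II. cmod (v t))" for s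
  proof -
    have Gm: "G s \<in> borel_measurable borel" by measurable
    note l = kernel_integral_norm_le[OF Gm assms(2,3)]
    show ?thesis by (rule order_trans[OF set_integral_norm_bound[OF l(1)] l(2)])
  qed
  show "sq_int (\<lambda>s. LBINT t:II. G s t * v t)" by (rule sq_int_bounded(1)[OF m b])
  have "sqn (\<lambda>s. LBINT t:II. G s t * v t) \<le> 2 * (C * (LBINT t:II. cmod (v t)))\<^sup>2"
    by (rule sq_int_bounded(2)[OF m b])
  also have "\<dots> = 2 * C\<^sup>2 * (LBINT t:II. cmod (v t))\<^sup>2" by (simp add: power_mult_distrib)
  also have "\<dots> \<le> 2 * C\<^sup>2 * (2 * sqn v)"
    by (intro mult_left_mono integral_norm_II_le assms(3)) auto
  finally show "sqn (\<lambda>s. LBINT t:II. G s t * v t) \<le> 4 * C\<^sup>2 * sqn v" by simp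
qed

lemma der_kernel_integral:
  assumes g: "pair_borel g" "\<And>s t. cmod (g s t) \<le> C"
    and G: "pair_borel G" "\<And>s t. cmod (G s t) \<le> C"
    and d: "\<And>t. t \<in> II \<Longrightarrow> der (\<lambda>s. G s t) (\<lambda>s. g s t)"
    and v: "sq_int v"
  shows "der (\<lambda>s. LBINT t:II. G s t * v t) (\<lambda>s. LBINT t:II. g s t * v t)"
proof (rule derI)
  fix x y :: real assume xy: "-1 \<le> x" "x \<le> y" "y \<le> 1"
  have vm[measurable]: "v \<in> borel_measurable borel" by (rule sq_int_meas[OF v])
  note [measurable] = g(1) G(1)
  define f where "f = (\<lambda>(s,t). indicator {x..y} s *\<^sub>R indicator II t *\<^sub>R (g s t * v t))"
  have fm[measurable]: "f \<in> borel_measurable (lborel \<Otimes>\<^sub>M lborel)"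
    unfolding f_def by measurable
  have gm: "g s \<in> borel_measurable borel" and Gm: "G s \<in> borel_measurable borel" for s
    by measurable
  note gi = kernel_integral_norm_le(1)[OF gm g(2) v] and Gi = kernel_integral_norm_le(1)[OF Gm G(2) v]
  have fi: "integrable (lborel \<Otimes>\<^sub>M lborel) f"
  proof (rule lborel_pair.Fubini_integrable[OF fm])
    have C0: "C \<ge> 0" using g(2)[of 0 0] norm_ge_zero order_trans by blast
    define N where "N = (LBINT t:II. cmod (v t))"
    have N0: "N \<ge> 0" unfolding N_def set_lebesgue_integral_def
      by (rule Bochner_Integration.integral_nonneg) auto
    have eq: "(\<integral>t. norm (f (s, t)) \<partial>lborel) = indicator {x..y} s * (LBINT t:II. cmod (g s t * v t))" for s
      by (simp add: f_def set_lebesgue_integral_def mult.assoc)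
    have le: "(LBINT t:II. cmod (g s t * v t)) \<le> C * N" for s
      unfolding N_def by (rule kernel_integral_norm_le(2)[OF gm g(2) v])
    have nn: "0 \<le> (LBINT t:II. cmod (g s t * v t))" for s
      unfolding set_lebesgue_integral_def by (rule Bochner_Integration.integral_nonneg) auto
    have ci: "integrable lborel (\<lambda>s. indicator {x..y} s *\<^sub>R (C * N))"
      using borel_integrable_atLeastAtMost'[of x y "\<lambda>s. C * N"] by (simp add: set_integrable_def)
    show "integrable lborel (\<lambda>s. \<integral>t. norm (f (s, t)) \<partial>lborel)"
    proof (rule Bochner_Integration.integrable_bound[OF ci])
      show "(\<lambda>s. \<integral>t. norm (f (s, t)) \<partial>lborel) \<in> borel_measurable lborel" by measurable
      show "AE s in lborel. norm (\<integral>t. norm (f (s, t)) \<partial>lborel) \<le> norm (indicator {x..y} s *\<^sub>R (C * N))"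
        using le nn C0 N0 by (intro AE_I2) (auto simp: eq indicator_def)
    qed
    show "AE s in lborel. integrable lborel (\<lambda>t. f (s, t))"
    proof (rule AE_I2)
      fix s
      have "integrable lborel (\<lambda>t. indicat_real {x..y} s *\<^sub>R (indicat_real II t *\<^sub>R (g s t * v t)))"
        using gi[of s] by (intro integrable_scaleR_right) (simp add: set_integrable_def)
      then show "integrable lborel (\<lambda>t. f (s, t))" by (simp add: f_def)
    qed
  qed
  have inner: "(LBINT s:{x..y}. g s t) = G y t - G x t" if "t \<in> II" for t
  proof -
    have "(\<lambda>s. g s t) \<in> borel_measurable borel" by measurable
    then have "set_integrable lborel {x..y} (\<lambda>s. g s t * 1)"
      by (rule set_integrable_bounded_mult[OF _ g(2)]) (auto intro!: borel_integrable_atLeastAtMost')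
    then have "(LBINT s:{x..y}. g s t) = integral {x..y} (\<lambda>s. g s t)"
      using set_borel_integral_eq_integral(2) by fastforce
    also have "\<dots> = G y t - G x t"
      using derD[OF d[OF that] xy] by (simp add: integral_unique)
    finally show ?thesis .
  qed
  have eq1: "(\<integral>t. f (s, t) \<partial>lborel) = indicator {x..y} s *\<^sub>R (LBINT t:II. g s t * v t)" for s
    by (simp add: f_def set_lebesgue_integral_def del: scaleR_scaleR)
  have "integrable lborel (\<lambda>s. \<integral>t. f (s, t) \<partial>lborel)"
    by (rule lborel_pair.integrable_fst'[OF fi, simplified])
  then have si: "set_integrable lborel {x..y} (\<lambda>s. LBINT t:II. g s t * v t)"
    by (simp add: eq1 set_integrable_def)
  have "(LBINT s:{x..y}. LBINT t:II. g s t * v t) = (\<integral>s. \<integral>t. f (s, t) \<partial>lborel \<partial>lborel)"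
    by (simp add: eq1 set_lebesgue_integral_def)
  also have "\<dots> = (\<integral>t. \<integral>s. f (s, t) \<partial>lborel \<partial>lborel)"
    using lborel_pair.Fubini_integral[of "\<lambda>s t. f (s, t)"] fi by simp
  also have "\<dots> = (LBINT t:II. (G y t - G x t) * v t)"
    unfolding set_lebesgue_integral_def
  proof (rule Bochner_Integration.integral_cong[OF refl])
    fix t
    have "(\<integral>s. f (s, t) \<partial>lborel) = (\<integral>s. indicator {x..y} s *\<^sub>R g s t * (indicator II t *\<^sub>R v t) \<partial>lborel)"
      by (rule Bochner_Integration.integral_cong[OF refl]) (simp add: f_def)
    also have "\<dots> = (LBINT s:{x..y}. g s t) * (indicator II t *\<^sub>R v t)"
      unfolding set_lebesgue_integral_def by (rule integral_mult_left_zero)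
    also have "\<dots> = indicat_real II t *\<^sub>R ((G y t - G x t) * v t)"
      by (cases "t \<in> II") (auto simp: inner)
    finally show "(\<integral>s. f (s, t) \<partial>lborel) = indicat_real II t *\<^sub>R ((G y t - G x t) * v t)" .
  qed
  also have "\<dots> = (LBINT t:II. G y t * v t) - (LBINT t:II. G x t * v t)"
    using set_integral_diff(2)[OF Gi Gi] by (simp add: left_diff_distrib)
  finally have "(LBINT s:{x..y}. LBINT t:II. g s t * v t) = (LBINT t:II. G y t * v t) - (LBINT t:II. G x t * v t)" .
  with set_borel_integral_eq_integral[OF si]
  show "((\<lambda>s. LBINT t:II. g s t * v t) has_integral (LBINT t:II. G y t * v t) - (LBINT t:II. G x t * v t)) {x..y}"
    by (simp add: has_integral_iff)
qed

text \<open>The cut-off sits in the kernel, so that the bounds for kernels on the whole square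
  apply. With the kernel constantly 1 this is the primitive of \<open>v\<close> that vanishes at -1,
  and it is used as such throughout.\<close>

definition low :: "(real \<Rightarrow> real \<Rightarrow> complex) \<Rightarrow> (real \<Rightarrow> complex) \<Rightarrow> real \<Rightarrow> complex" where
  "low k v s = (LBINT t:II. (if t \<le> s then k s t else 0) * v t)"

lemma der_primitive:
  assumes "sq_int w" shows "der (low (\<lambda>s t. 1) w) w"
proof (rule derI)
  fix x y :: real assume xy: "-1 \<le> x" "x \<le> y" "y \<le> 1"
  have wi: "set_integrable lborel {a..b} w" if "-1 \<le> a" "b \<le> 1" for a b
    by (rule set_integrable_subset[OF sq_int_integrable[OF assms]]) (use that in \<open>auto simp: II_def\<close>)
  have e: "low (\<lambda>s t. 1) w z = integral {-1..z} w" if "-1 \<le> z" "z \<le> 1" for z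
  proof -
    have "low (\<lambda>s t. 1) w z = (LBINT t:{-1..z}. w t)"
      unfolding low_def set_lebesgue_integral_def using that
      by (intro Bochner_Integration.integral_cong) (auto simp: II_def indicator_def)
    then show ?thesis using set_borel_integral_eq_integral(2)[OF wi] that by simp
  qed
  have "integral {-1..x} w + integral {x..y} w = integral {-1..y} w"
    by (rule Henstock_Kurzweil_Integration.integral_combine[OF xy(1,2)])
      (use set_borel_integral_eq_integral(1)[OF wi] xy in auto)
  then have "integral {x..y} w = low (\<lambda>s t. 1) w y - low (\<lambda>s t. 1) w x"
    using xy by (simp add: e algebra_simps)
  then show "(w has_integral low (\<lambda>s t. 1) w y - low (\<lambda>s t. 1) w x) {x..y}"
    using set_borel_integral_eq_integral(1)[OF wi] xy by (simp add: has_integral_iff)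
qed

lemma continuous_pair_meas:
  assumes "continuous_on UNIV (\<lambda>(s,t). k s t :: complex)"
  shows "pair_borel k"
  using borel_measurable_continuous_onI[OF assms] by (simp add: borel_prod)

lemma low_meas:
  assumes "pair_borel k"
  shows "(\<lambda>(s,t). if t \<le> s then k s t else 0 :: complex) \<in> borel_measurable (borel \<Otimes>\<^sub>M borel)"
proof -
  note [measurable] = assms
  show ?thesis by measurable
qed

lemma diag_meas:
  assumes "pair_borel k"
  shows "(\<lambda>s. k s s) \<in> borel_measurable borel"
proof -
  note [measurable] = assms
  show ?thesis by measurable
qed

lemma low_sq:
  assumes "pair_borel k" "\<And>s t. cmod (k s t) \<le> C" "sq_int v"
  shows "sq_int (low k v)" "sqn (low k v) \<le> 4 * C\<^sup>2 * sqn v"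
proof -
  have C: "C \<ge> 0" using assms(2)[of 0 0] norm_ge_zero order_trans by blast
  have *: "low k v = (\<lambda>s. LBINT t:II. (if t \<le> s then k s t else 0) * v t)"
    by (auto simp: low_def)
  show "sq_int (low k v)" "sqn (low k v) \<le> 4 * C\<^sup>2 * sqn v"
    unfolding * using kernel_integral_sq[OF low_meas[OF assms(1)] _ assms(3), of C] assms(2) C by auto
qed

text \<open>A kernel cut off along the diagonal jumps there by \<open>k t t\<close>. Subtracting
  this value before the cut leaves \<open>G\<close>, which is continuous across the diagonal and
  falls under \<open>der_kernel_integral\<close>; the subtracted part is the primitive of
  \<open>k t t * v t\<close> and produces the boundary term.\<close>

lemma der_low:
  assumes k: "pair_borel k" "\<And>s t. cmod (k s t) \<le> C"
    and k': "pair_borel k'" "\<And>s t. cmod (k' s t) \<le> C"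
    and d: "\<And>t. t \<in> II \<Longrightarrow> der (\<lambda>s. k s t) (\<lambda>s. k' s t)"
    and v: "sq_int v"
  shows "der (low k v) (\<lambda>s. k s s * v s + low k' v s)"
proof -
  have C: "C \<ge> 0" using k(2)[of 0 0] norm_ge_zero order_trans by blast
  have vm[measurable]: "v \<in> borel_measurable borel" by (rule sq_int_meas[OF v])
  note [measurable] = k(1) k'(1) diag_meas[OF k(1)]
  define G where "G = (\<lambda>s t. if t \<le> s then k s t - k t t else 0)"
  define g where "g = (\<lambda>s t. if t \<le> s then k' s t else 0)"
  have Gm[measurable]: "pair_borel G" unfolding G_def by measurable
  have gm[measurable]: "pair_borel g" unfolding g_def by measurable
  have Gb: "cmod (G s t) \<le> 2 * C" for s t
    using norm_triangle_ineq4[of "k s t" "k t t"] k(2)[of s t] k(2)[of t t] C by (auto simp: G_def)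
  have gb: "cmod (g s t) \<le> 2 * C" for s t
    using k'(2)[of s t] C by (auto simp: g_def)
  have dG: "der (\<lambda>s. G s t) (\<lambda>s. g s t)" if t: "t \<in> II" for t
  proof (rule derI)
    fix x y :: real assume xy: "-1 \<le> x" "x \<le> y" "y \<le> 1"
    \<comment> \<open>Before the diagonal \<open>g\<close> vanishes, with the single point s = t as
      possible exception.\<close>
    have zero: "((\<lambda>s. g s t) has_integral 0) {a..b}" if "b \<le> t" for a b
    proof (rule has_integral_spike_finite[of "{t}" _ _ "\<lambda>s. 0"])
      show "g s t = 0" if "s \<in> {a..b} - {t}" for s using that \<open>b \<le> t\<close> by (auto simp: g_def)
    qed auto
    have main: "((\<lambda>s. g s t) has_integral k b t - k a t) {a..b}" if "t \<le> a" "a \<le> b" "b \<le> 1" for a b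
    proof (rule has_integral_eq[of _ "\<lambda>s. k' s t"])
      show "((\<lambda>s. k' s t) has_integral k b t - k a t) {a..b}"
        by (rule derD[OF d[OF t]]) (use that t in \<open>auto simp: II_def\<close>)
    qed (use that in \<open>auto simp: g_def\<close>)
    consider "t \<le> x" | "x < t" "t \<le> y" | "y < t" by linarith
    then show "((\<lambda>s. g s t) has_integral G y t - G x t) {x..y}"
    proof cases
      case 1
      then show ?thesis using main[of x y] xy by (simp add: G_def)
    next
      case 2
      have "((\<lambda>s. g s t) has_integral 0 + (k y t - k t t)) {x..y}"
        by (rule has_integral_combine[of x t y]) (use 2 xy zero main in auto)
      then show ?thesis using 2 by (simp add: G_def)
    next
      case 3
      then show ?thesis using zero[of y x] xy by (simp add: G_def)
    qed
  qed
  define w where "w = (\<lambda>t. k t t * v t)"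
  have wm: "w \<in> borel_measurable borel" unfolding w_def by measurable
  have w: "sq_int w"
    by (rule sq_int_mult_bound(1)[OF wm v, of C]) (auto simp: w_def norm_mult mult_right_mono k(2))
  have "der (\<lambda>s. low (\<lambda>s t. 1) w s + (LBINT t:II. G s t * v t)) (\<lambda>s. w s + (LBINT t:II. g s t * v t))"
    by (rule der_add[OF der_primitive[OF w] der_kernel_integral[OF gm gb Gm Gb dG v]])
  then show ?thesis
  proof (rule der_cong)
    fix s assume "s \<in> II"
    show "w s + (LBINT t:II. g s t * v t) = k s s * v s + low k' v s"
      by (simp add: w_def g_def low_def)
    have i1: "set_integrable lborel II (\<lambda>t. (if t \<le> s then 1 else 0) * w t)"
      by (rule set_integrable_bounded_mult[of _ 1, OF _ _ wm sq_int_integrable[OF w]]) auto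
    have i2: "set_integrable lborel II (\<lambda>t. G s t * v t)"
      by (rule set_integrable_bounded_mult[OF _ Gb vm sq_int_integrable[OF v]]) (auto, measurable)
    show "low (\<lambda>s t. 1) w s + (LBINT t:II. G s t * v t) = low k v s"
      unfolding low_def set_integral_add(2)[OF i1 i2, symmetric]
      by (rule set_lebesgue_integral_cong) (auto simp: w_def G_def left_diff_distrib)
  qed
qed

text \<open>The projection onto \<open>II\<close>. Composition with it turns a function that is
  continuous on \<open>II\<close> into a bounded continuous one on the line, which supplies the
  global measurability and bounds asked of kernels.\<close>

definition cl :: "real \<Rightarrow> real" where "cl x = max (-1) (min 1 x)"

lemma cl_in [simp]: "cl x \<in> II" and cl_id [simp]: "x \<in> II \<Longrightarrow> cl x = x"
  by (auto simp: cl_def II_def)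

lemma continuous_on_cl [continuous_intros]: "continuous_on A f \<Longrightarrow> continuous_on A (\<lambda>x. cl (f x))"
  unfolding cl_def by (intro continuous_intros)

lemma continuous_cl_comp:
  assumes "continuous_on II a" shows "continuous_on UNIV (\<lambda>x. a (cl x))"
  by (rule continuous_on_compose2[OF assms]) (auto intro!: continuous_intros)

lemma bounded_II:
  assumes "continuous_on II (a :: real \<Rightarrow> complex)"
  obtains C where "C > 0" "\<And>x. x \<in> II \<Longrightarrow> cmod (a x) \<le> C"
proof -
  have "compact (a ` II)" by (rule compact_continuous_image[OF assms]) (simp add: II_def)
  then have "bounded (a ` II)" by (rule compact_imp_bounded)
  then show ?thesis using that by (auto simp: bounded_pos)
qed

text \<open>The product rule is the case of \<open>der_low\<close> in which the kernel depends on s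
  alone: such a kernel leaves the integral, which becomes a s * (u s - u (-1)). Adding u (-1) * a s
  restores the product.\<close>

lemma der_mult:
  assumes d: "der u v" and v: "sq_int v"
    and a: "\<And>x. x \<in> II \<Longrightarrow> (a has_vector_derivative a' x) (at x within II)" and a': "continuous_on II a'"
  shows "der (\<lambda>x. a x * u x) (\<lambda>x. a' x * u x + a x * v x)"
proof -
  have ac: "continuous_on II a"
    using a has_vector_derivative_continuous continuous_on_eq_continuous_within by blast
  obtain C1 where C1: "\<And>x. x \<in> II \<Longrightarrow> cmod (a x) \<le> C1" using bounded_II[OF ac] by metis
  obtain C2 where C2: "\<And>x. x \<in> II \<Longrightarrow> cmod (a' x) \<le> C2" using bounded_II[OF a'] by metis
  define C where "C = max C1 C2"
  have m: "(\<lambda>(s::real,t::real). b (cl s)) \<in> borel_measurable (borel \<Otimes>\<^sub>M borel)" if "continuous_on II b" for b :: "real \<Rightarrow> complex"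
  proof -
    have [measurable]: "(\<lambda>x. b (cl x)) \<in> borel_measurable borel"
      by (rule borel_measurable_continuous_onI[OF continuous_cl_comp[OF that]])
    show ?thesis by measurable
  qed
  have daa: "der a a'" by (rule der_FTC[OF a])
  have "der (low (\<lambda>s t. a (cl s)) v) (\<lambda>s. a (cl s) * v s + low (\<lambda>s t. a' (cl s)) v s)"
  proof (rule der_low[OF m[OF ac] _ m[OF a'] _ _ v, where C = C])
    show "cmod (a (cl s)) \<le> C" "cmod (a' (cl s)) \<le> C" for s
      using C1[OF cl_in[of s]] C2[OF cl_in[of s]] by (auto simp: C_def)
    show "der (\<lambda>s. a (cl s)) (\<lambda>s. a' (cl s))" by (rule der_cong[OF daa]) auto
  qed
  then have "der (\<lambda>s. low (\<lambda>s t. a (cl s)) v s + u (-1) * a s) (\<lambda>s. a (cl s) * v s + low (\<lambda>s t. a' (cl s)) v s + u (-1) * a' s)"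
    by (rule der_add[OF _ der_cmult[OF daa]])
  then show ?thesis
  proof (rule der_cong)
    fix s assume s: "s \<in> II"
    have l: "low (\<lambda>s t. b (cl s)) v s = b s * (u s - u (-1))" for b
    proof -
      have "low (\<lambda>s t. b (cl s)) v s = b s * low (\<lambda>s t. 1) v s"
        unfolding low_def set_lebesgue_integral_def integral_mult_right_zero[symmetric]
        by (intro Bochner_Integration.integral_cong) (use s in auto)
      moreover have "low (\<lambda>s t. 1) v s - low (\<lambda>s t. 1) v (-1) = u s - u (-1)"
        using derD[OF der_primitive[OF v], of "-1" s] derD[OF d, of "-1" s] s
        by (auto simp: II_def dest: has_integral_unique)
      moreover have "low (\<lambda>s t. 1) v (-1) = 0"
      proof -
        have "low (\<lambda>s t. 1) v (-1) = (LBINT t:{-1}. v t)"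
          unfolding low_def set_lebesgue_integral_def
          by (intro Bochner_Integration.integral_cong) (auto simp: II_def indicator_def)
        also have "\<dots> = integral {-1} v"
          by (rule set_borel_integral_eq_integral(2))
            (rule set_integrable_subset[OF sq_int_integrable[OF v]], auto simp: II_def)
        finally show ?thesis by simp
      qed
      ultimately show ?thesis by simp
    qed
    show "low (\<lambda>s t. a (cl s)) v s + u (-1) * a s = a s * u s" by (simp add: l algebra_simps)
    show "a (cl s) * v s + low (\<lambda>s t. a' (cl s)) v s + u (-1) * a' s = a' s * u s + a s * v s"
      using s by (simp add: l algebra_simps)
  qed
qed

section \<open>An inward averaging operator\<close>

text \<open>The homothety of ratio 1 - 1 / \<kappa> with centre \<theta>. For \<theta> = 1 and
  \<theta> = -1 it maps \<open>II\<close> into itself, and the two images of a point s enclose s at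
  the constant distance 2 / \<kappa>.\<close>

definition contract :: "real \<Rightarrow> real \<Rightarrow> real \<Rightarrow> real" where
  "contract \<theta> \<kappa> s = \<theta> / \<kappa> + (1 - 1 / \<kappa>) * s"

abbreviation "hi \<equiv> contract 1"
abbreviation "lo \<equiv> contract (-1)"

text \<open>The mean of \<^term>\<open>h\<close> over an interval of length \<^term>\<open>2 / \<kappa>\<close> that contains \<^term>\<open>s\<close>. Because the
  interval is contracted towards the origin it never leaves \<^term>\<open>II\<close>, and no extension of \<^term>\<open>h\<close>
  across the end points is needed.\<close>

definition average :: "real \<Rightarrow> (real \<Rightarrow> complex) \<Rightarrow> real \<Rightarrow> complex" where
  "average \<kappa> h s = complex_of_real (\<kappa> / 2) * (low (\<lambda>s t. 1) h (hi \<kappa> s) - low (\<lambda>s t. 1) h (lo \<kappa> s))"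

lemma hi_lo_bounds:
  assumes "\<kappa> > 1" "s \<in> II"
  shows "-1 \<le> lo \<kappa> s" "lo \<kappa> s \<le> s" "s \<le> hi \<kappa> s" "hi \<kappa> s \<le> 1" "hi \<kappa> s - lo \<kappa> s = 2 / \<kappa>"
proof -
  define e where "e = 1 / \<kappa>"
  have e: "0 < e" "e < 1" using assms by (auto simp: e_def)
  have s: "-1 \<le> s" "s \<le> 1" using assms by (auto simp: II_def)
  have "(1 - e) * s \<ge> (1 - e) * (-1)" "(1 - e) * s \<le> (1 - e) * 1"
    using e s by (intro mult_left_mono; simp)+
  moreover have "e * s \<le> e * 1" "e * (-1) \<le> e * s" using e s by (intro mult_left_mono; simp)+
  ultimately show "-1 \<le> lo \<kappa> s" "lo \<kappa> s \<le> s" "s \<le> hi \<kappa> s" "hi \<kappa> s \<le> 1"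
    by (auto simp: contract_def e_def[symmetric] left_diff_distrib)
  show "hi \<kappa> s - lo \<kappa> s = 2 / \<kappa>" by (simp add: contract_def diff_divide_distrib[symmetric])
qed

lemma contract_in: "\<theta> \<in> {1, -1} \<Longrightarrow> \<kappa> > 1 \<Longrightarrow> s \<in> II \<Longrightarrow> contract \<theta> \<kappa> s \<in> II"
  using hi_lo_bounds[of \<kappa> s] by (auto simp: II_def)

lemmas hi_lo_in = contract_in[OF insertI1] contract_in[OF insertI2[OF singletonI]]

lemma one_measurable: "(\<lambda>(s::real,t::real). 1::complex) \<in> borel_measurable (borel \<Otimes>\<^sub>M borel)"
  by measurable

lemma sq_int_prim: "sq_int h \<Longrightarrow> sq_int (low (\<lambda>s t. 1) h)"
  by (rule low_sq(1)[OF one_measurable, of 1]) auto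

lemma average_diff:
  assumes "\<kappa> > 1" "der u v" "sq_int v" "s \<in> II"
  shows "u (hi \<kappa> s) - u (lo \<kappa> s) = complex_of_real (2 / \<kappa>) * average \<kappa> v s"
proof -
  note b = hi_lo_bounds[OF assms(1,4)]
  have le: "lo \<kappa> s \<le> hi \<kappa> s" using b by linarith
  have "u (hi \<kappa> s) - u (lo \<kappa> s) = low (\<lambda>s t. 1) v (hi \<kappa> s) - low (\<lambda>s t. 1) v (lo \<kappa> s)"
    using has_integral_unique[OF derD[OF assms(2) b(1) le b(4)] derD[OF der_primitive[OF assms(3)] b(1) le b(4)]] .
  then show ?thesis using assms(1) by (simp add: average_def)
qed

lemma average_integral:
  assumes "\<kappa> > 1" "sq_int h" "s \<in> II"
  shows "(h has_integral complex_of_real (2 / \<kappa>) * average \<kappa> h s) {lo \<kappa> s..hi \<kappa> s}"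
proof -
  note b = hi_lo_bounds[OF assms(1,3)]
  have le: "lo \<kappa> s \<le> hi \<kappa> s" using b by linarith
  have "complex_of_real (2 / \<kappa>) * complex_of_real (\<kappa> / 2) = 1" using assms(1) by simp
  then have "complex_of_real (2 / \<kappa>) * average \<kappa> h s = low (\<lambda>s t. 1) h (hi \<kappa> s) - low (\<lambda>s t. 1) h (lo \<kappa> s)"
    unfolding average_def mult.assoc[symmetric] by simp
  then show ?thesis
    using derD[OF der_primitive[OF assms(2)] b(1) le b(4)] by simp
qed

lemma der_contract:
  assumes "\<theta> \<in> {1, -1}" "\<kappa> > 1" "der u v"
  shows "der (\<lambda>s. u (contract \<theta> \<kappa> s)) (\<lambda>s. complex_of_real (1 - 1 / \<kappa>) * v (contract \<theta> \<kappa> s))"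
  unfolding contract_def
  by (rule der_affine[OF assms(3)]) (use assms(2) contract_in[OF assms(1,2)] in \<open>auto simp: contract_def\<close>)

lemmas der_hi = der_contract[OF insertI1] and der_lo = der_contract[OF insertI2[OF singletonI]]

text \<open>Only values of \<open>h\<close> occur on the right, so averaging gains one derivative,
  at the cost of a factor of order \<kappa>. The constant is \<kappa> / 2 times the slope 1 - 1 /
  \<kappa> of the window ends.\<close>

lemma der_average:
  assumes "\<kappa> > 1" "sq_int h"
  shows "der (average \<kappa> h) (\<lambda>s. complex_of_real ((\<kappa> - 1) / 2) * (h (hi \<kappa> s) - h (lo \<kappa> s)))"
proof -
  note d = der_primitive[OF assms(2)]
  have "der (\<lambda>s. complex_of_real (\<kappa> / 2) * (low (\<lambda>s t. 1) h (hi \<kappa> s) - low (\<lambda>s t. 1) h (lo \<kappa> s)))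
     (\<lambda>s. complex_of_real (\<kappa> / 2) * (complex_of_real (1 - 1 / \<kappa>) * h (hi \<kappa> s) - complex_of_real (1 - 1 / \<kappa>) * h (lo \<kappa> s)))"
    by (intro der_cmult der_diff der_hi der_lo assms d)
  moreover have "complex_of_real (\<kappa> / 2) * (complex_of_real (1 - 1 / \<kappa>) * x - complex_of_real (1 - 1 / \<kappa>) * y)
     = complex_of_real ((\<kappa> - 1) / 2) * (x - y)" for x y
    using assms(1) by (simp add: field_simps)
  ultimately show ?thesis by (simp add: average_def[abs_def])
qed

text \<open>When \<open>u\<close> is itself differentiable, the derivative can be passed to it
  without any power of \<kappa>.\<close>

lemma der_mol':
  assumes "\<kappa> > 1" "sq_int u" "der u v" "sq_int v"
  shows "der (average \<kappa> u) (\<lambda>s. complex_of_real (1 - 1 / \<kappa>) * average \<kappa> v s)"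
proof (rule der_cong[OF der_average[OF assms(1,2)] refl])
  fix s assume "s \<in> II"
  then show "complex_of_real ((\<kappa> - 1) / 2) * (u (hi \<kappa> s) - u (lo \<kappa> s)) = complex_of_real (1 - 1 / \<kappa>) * average \<kappa> v s"
    using assms(1) by (simp add: average_diff[OF assms(1,3,4)] field_simps)
qed

lemma sq_int_contract:
  assumes "\<theta> \<in> {1, -1}" "\<kappa> > 1" "sq_int h"
  shows "sq_int (\<lambda>s. h (contract \<theta> \<kappa> s))" "sqn (\<lambda>s. h (contract \<theta> \<kappa> s)) \<le> sqn h / (1 - 1 / \<kappa>)"
proof -
  have c: "1 - 1 / \<kappa> > 0" using assms by simp
  have i: "\<theta> / \<kappa> + (1 - 1 / \<kappa>) * x \<in> II" if "x \<in> II" for x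
    using contract_in[OF assms(1,2) that] by (simp add: contract_def)
  show "sq_int (\<lambda>s. h (contract \<theta> \<kappa> s))" "sqn (\<lambda>s. h (contract \<theta> \<kappa> s)) \<le> sqn h / (1 - 1 / \<kappa>)"
    unfolding contract_def using sq_int_affine[OF assms(3) c i] by auto
qed

lemma average_meas: "sq_int h \<Longrightarrow> average \<kappa> h \<in> borel_measurable borel"
proof -
  assume "sq_int h"
  then have [measurable]: "low (\<lambda>s t. 1) h \<in> borel_measurable borel" by (intro sq_int_meas sq_int_prim)
  show ?thesis unfolding average_def contract_def by measurable
qed

text \<open>Cauchy-Schwarz on the window bounds the square of the average by \<kappa> / 2 times an
  increment of \<open>Q\<close>, the integral of |h|^2 from -1. Integrating over s, the two
  substituted integrals of \<open>Q\<close> differ by at most an integral over a strip of length 2 /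
  \<kappa>, where \<open>Q\<close> is at most \<open>Q 1\<close>. The denominator is the slope of
  the substitutions.\<close>

lemma sq_int_average:
  assumes k: "\<kappa> > 1" and h: "sq_int h"
  shows "sq_int (average \<kappa> h)" "sqn (average \<kappa> h) \<le> sqn h / (1 - 1 / \<kappa>)"
proof -
  define c where "c = 1 - 1 / \<kappa>"
  have c: "0 < c" using k by (simp add: c_def)
  define q where "q = (\<lambda>x. (cmod (h x))\<^sup>2)"
  define Q where "Q = (\<lambda>x. integral {-1..x} q)"
  have qi: "set_integrable lborel {-1..1} q" using h by (simp add: sq_int_def q_def II_def)
  have qs: "set_integrable lborel {a..b} q" if "-1 \<le> a" "b \<le> 1" for a b
    by (rule set_integrable_subset[OF qi]) (use that in auto)
  have qI: "q integrable_on {a..b}" if "-1 \<le> a" "b \<le> 1" for a b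
    by (rule set_borel_integral_eq_integral(1)[OF qs[OF that]])
  have Qc: "continuous_on {-1..1} Q"
    unfolding Q_def by (rule indefinite_integral_continuous_1) (rule qI; simp)
  have Q1: "Q 1 = sqn h"
    using set_borel_integral_eq_integral(2)[OF qi] by (simp add: Q_def sqn_def II_def q_def)
  have Qdiff: "integral {a..b} q = Q b - Q a" if "-1 \<le> a" "a \<le> b" "b \<le> 1" for a b
    unfolding Q_def using Henstock_Kurzweil_Integration.integral_combine[OF that(1,2), of q] qI[of "-1" b] that by simp
  have q0: "integral {a..b} q \<ge> 0" if "-1 \<le> a" "b \<le> 1" for a b
    by (rule Henstock_Kurzweil_Integration.integral_nonneg[OF qI[OF that]]) (simp add: q_def)
  have Qle: "Q x \<le> Q 1" "0 \<le> Q x" if "-1 \<le> x" "x \<le> 1" for x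
    using Qdiff[of x 1] q0[of x 1] q0[of "-1" x] that by (auto simp: Q_def)
  have QI: "Q integrable_on {a..b}" if "-1 \<le> a" "b \<le> 1" for a b
    by (rule integrable_continuous_real) (rule continuous_on_subset[OF Qc], use that in auto)
  define g where "g = (\<lambda>s. (\<kappa> / 2) * (Q (hi \<kappa> s) - Q (lo \<kappa> s)))"
  have gc: "continuous_on II g"
    unfolding g_def
    by (intro continuous_intros continuous_on_compose2[OF Qc])
      (use hi_lo_in[OF k] in \<open>auto simp: II_def contract_def[abs_def] intro!: continuous_intros\<close>)
  have gi: "set_integrable lborel II g"
    using gc unfolding II_def by (rule borel_integrable_atLeastAtMost')
  have bnd: "(cmod (average \<kappa> h s))\<^sup>2 \<le> g s" if s: "s \<in> II" for s
  proof -
    note b = hi_lo_bounds[OF k s]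
    have le: "lo \<kappa> s \<le> hi \<kappa> s" using b by linarith
    have hs: "set_integrable lborel {lo \<kappa> s..hi \<kappa> s} h"
      by (rule sq_int_integrable_sub[OF h]) (use hi_lo_in[OF k s] in auto)
    have i: "h integrable_on {lo \<kappa> s..hi \<kappa> s}" and e: "(LBINT x:{lo \<kappa> s..hi \<kappa> s}. h x) = complex_of_real (2 / \<kappa>) * average \<kappa> h s"
      using set_borel_integral_eq_integral[OF hs] average_integral[OF k h s] by (auto simp: integral_unique)
    have "cmod (LBINT x:{lo \<kappa> s..hi \<kappa> s}. h x) \<le> (LBINT x:{lo \<kappa> s..hi \<kappa> s}. cmod (h x))"
      by (rule set_integral_norm_bound[OF hs])
    then have "(cmod (LBINT x:{lo \<kappa> s..hi \<kappa> s}. h x))\<^sup>2 \<le> (LBINT x:{lo \<kappa> s..hi \<kappa> s}. cmod (h x))\<^sup>2"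
      by (rule power_mono) simp
    also have "\<dots> \<le> (hi \<kappa> s - lo \<kappa> s) * (LBINT x:{lo \<kappa> s..hi \<kappa> s}. (cmod (h x))\<^sup>2)"
      by (rule integral_sq_le[OF set_integrable_norm[OF hs] _ le]) (use qs[OF b(1,4)] in \<open>simp add: q_def\<close>)
    also have "(LBINT x:{lo \<kappa> s..hi \<kappa> s}. (cmod (h x))\<^sup>2) = Q (hi \<kappa> s) - Q (lo \<kappa> s)"
      using set_borel_integral_eq_integral(2)[OF qs[OF b(1,4)]] Qdiff[OF b(1) le b(4)] by (simp add: q_def)
    finally have "(cmod (complex_of_real (2 / \<kappa>) * average \<kappa> h s))\<^sup>2 \<le> 2 / \<kappa> * (Q (hi \<kappa> s) - Q (lo \<kappa> s))"
      by (simp add: e b(5))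
    then have "(2 / \<kappa>)\<^sup>2 * (cmod (average \<kappa> h s))\<^sup>2 \<le> 2 / \<kappa> * (Q (hi \<kappa> s) - Q (lo \<kappa> s))"
      using k by (simp add: norm_mult norm_divide power_mult_distrib power_divide)
    then have "(\<kappa> / 2)\<^sup>2 * ((2 / \<kappa>)\<^sup>2 * (cmod (average \<kappa> h s))\<^sup>2) \<le> (\<kappa> / 2)\<^sup>2 * (2 / \<kappa> * (Q (hi \<kappa> s) - Q (lo \<kappa> s)))"
      by (rule mult_left_mono) simp
    moreover have "(\<kappa> / 2)\<^sup>2 * ((2 / \<kappa>)\<^sup>2 * X) = X" for X
      using k by (simp add: mult.assoc[symmetric] power_mult_distrib[symmetric])
    moreover have "(\<kappa> / 2)\<^sup>2 * (2 / \<kappa> * Y) = \<kappa> / 2 * Y" for Y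
      using k by (simp add: power2_eq_square)
    ultimately show ?thesis unfolding g_def by metis
  qed
  show "sq_int (average \<kappa> h)" by (rule sq_int_dominated(1)[OF average_meas[OF h] gi bnd])
  have "sqn (average \<kappa> h) \<le> (LBINT s:II. g s)" by (rule sq_int_dominated(2)[OF average_meas[OF h] gi bnd])
  also have "\<dots> = integral {-1..1} g"
    using set_borel_integral_eq_integral(2)[OF gi] by (simp add: II_def)
  also have "\<dots> = (\<kappa> / 2) * ((integral {1 - 2 / \<kappa>..1} Q - integral {-1..-1 + 2 / \<kappa>} Q) / c)"
  proof (rule integral_unique)
    have ek: "2 / \<kappa> < 2" "0 < 2 / \<kappa>" using k by (auto simp: field_simps)
    have 1: "((\<lambda>s. Q (c * s + 1 / \<kappa>)) has_integral integral {-1 + 2 / \<kappa>..1} Q / c) {-1..1}"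
    proof -
      have "(-1 + 2 / \<kappa> - 1 / \<kappa>) / c = -1" "(1 - 1 / \<kappa>) / c = 1"
        using k c by (auto simp: c_def field_simps)
      with has_integral_affinity'[OF _ c, of Q "integral {-1 + 2 / \<kappa>..1} Q" "-1 + 2 / \<kappa>" 1 "1 / \<kappa>"]
      show ?thesis using integrable_integral[OF QI[of "-1 + 2 / \<kappa>" 1]] ek by (simp add: divide_inverse_commute)
    qed
    have 2: "((\<lambda>s. Q (c * s + - (1 / \<kappa>))) has_integral integral {-1..1 - 2 / \<kappa>} Q / c) {-1..1}"
    proof -
      have "(-1 - - (1 / \<kappa>)) / c = -1" "(1 - 2 / \<kappa> - - (1 / \<kappa>)) / c = 1"
        using k c by (auto simp: c_def field_simps)
      with has_integral_affinity'[OF _ c, of Q "integral {-1..1 - 2 / \<kappa>} Q" "-1" "1 - 2 / \<kappa>" "- (1 / \<kappa>)"]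
      show ?thesis using integrable_integral[OF QI[of "-1" "1 - 2 / \<kappa>"]] ek by (simp add: divide_inverse_commute)
    qed
    have g: "g = (\<lambda>s. (\<kappa> / 2) * (Q (c * s + 1 / \<kappa>) - Q (c * s + - (1 / \<kappa>))))"
      by (auto simp: g_def contract_def c_def add.commute)
    \<comment> \<open>Both ranges are completed to {-1..1} instead of being intersected; for
      \<kappa> < 2 they are disjoint.\<close>
    have e1: "integral {-1..-1 + 2 / \<kappa>} Q + integral {-1 + 2 / \<kappa>..1} Q = integral {-1..1} Q"
      by (rule Henstock_Kurzweil_Integration.integral_combine) (use ek QI in auto)
    have e2: "integral {-1..1 - 2 / \<kappa>} Q + integral {1 - 2 / \<kappa>..1} Q = integral {-1..1} Q"
      by (rule Henstock_Kurzweil_Integration.integral_combine) (use ek QI in auto)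
    have "(g has_integral (\<kappa> / 2) * (integral {-1 + 2 / \<kappa>..1} Q / c - integral {-1..1 - 2 / \<kappa>} Q / c)) {-1..1}"
      unfolding g by (intro has_integral_mult_right has_integral_diff 1 2)
    moreover have "integral {-1 + 2 / \<kappa>..1} Q - integral {-1..1 - 2 / \<kappa>} Q = integral {1 - 2 / \<kappa>..1} Q - integral {-1..-1 + 2 / \<kappa>} Q"
      using e1 e2 by linarith
    ultimately show "(g has_integral (\<kappa> / 2) * ((integral {1 - 2 / \<kappa>..1} Q - integral {-1..-1 + 2 / \<kappa>} Q) / c)) {-1..1}"
      by (simp add: diff_divide_distrib[symmetric])
  qed
  also have "\<dots> \<le> (\<kappa> / 2) * ((2 / \<kappa>) * Q 1 / c)"
  proof -
    have ek: "2 / \<kappa> < 2" "0 < 2 / \<kappa>" using k by (auto simp: field_simps)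
    have "integral {1 - 2 / \<kappa>..1} Q \<le> integral {1 - 2 / \<kappa>..1} (\<lambda>x. Q 1)"
      by (rule integral_le) (use ek Qle QI in auto)
    moreover have "0 \<le> integral {-1..-1 + 2 / \<kappa>} Q"
      by (rule Henstock_Kurzweil_Integration.integral_nonneg) (use ek Qle QI in auto)
    ultimately have "integral {1 - 2 / \<kappa>..1} Q - integral {-1..-1 + 2 / \<kappa>} Q \<le> (2 / \<kappa>) * Q 1"
      using ek by simp
    then show ?thesis using c k by (intro mult_left_mono divide_right_mono) auto
  qed
  also have "\<dots> = sqn h / (1 - 1 / \<kappa>)" using k by (simp add: Q1 c_def)
  finally show "sqn (average \<kappa> h) \<le> sqn h / (1 - 1 / \<kappa>)" .
qed

text \<open>The point s lies in its window, so every averaged value differs from u s by at most the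
  integral of |v| over the window. That integral is again 2 / \<kappa> times an average, which makes
  \<open>sq_int_average\<close> applicable to the error.\<close>

lemma average_approx:
  assumes k: "\<kappa> > 1" and u: "sq_int u" and d: "der u v" and v: "sq_int v" and s: "s \<in> II"
  shows "cmod (u s - average \<kappa> u s) \<le> 2 / \<kappa> * cmod (average \<kappa> (\<lambda>x. complex_of_real (cmod (v x))) s)"
proof -
  note b = hi_lo_bounds[OF k s]
  have le: "lo \<kappa> s \<le> hi \<kappa> s" using b by linarith
  define w where "w = (\<lambda>x. complex_of_real (cmod (v x)))"
  have [measurable]: "v \<in> borel_measurable borel" by (rule sq_int_meas[OF v])
  have wm: "w \<in> borel_measurable borel" unfolding w_def by measurable
  have w: "sq_int w" by (rule sq_int_mult_bound(1)[OF wm v, of 1]) (auto simp: w_def)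
  define J where "J = integral {lo \<kappa> s..hi \<kappa> s} (\<lambda>x. cmod (v x))"
  have vs: "set_integrable lborel {x..y} v" if "-1 \<le> x" "y \<le> 1" for x y
    by (rule set_integrable_subset[OF sq_int_integrable[OF v]]) (use that in \<open>auto simp: II_def\<close>)
  have nI: "(\<lambda>x. cmod (v x)) integrable_on {x..y}" if "-1 \<le> x" "y \<le> 1" for x y
    by (rule set_borel_integral_eq_integral(1)[OF set_integrable_norm[OF vs[OF that]]])
  have J: "complex_of_real J = complex_of_real (2 / \<kappa>) * average \<kappa> w s"
  proof -
    have "(w has_integral complex_of_real J) {lo \<kappa> s..hi \<kappa> s}"
      unfolding w_def J_def using integrable_integral[OF nI[OF b(1,4)]] by (rule has_integral_of_real)
    then show ?thesis using average_integral[OF k w s] has_integral_unique by blast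
  qed
  have J0: "J \<ge> 0" unfolding J_def by (rule Henstock_Kurzweil_Integration.integral_nonneg[OF nI[OF b(1,4)]]) simp
  have diff: "cmod (u y - u x) \<le> J" if "lo \<kappa> s \<le> x" "x \<le> y" "y \<le> hi \<kappa> s" for x y
  proof -
    have xy: "-1 \<le> x" "y \<le> 1" using that b by linarith+
    have "u y - u x = integral {x..y} v" using derD[OF d xy(1) that(2) xy(2)] by (simp add: integral_unique)
    also have "cmod \<dots> \<le> integral {x..y} (\<lambda>x. cmod (v x))"
      by (rule integral_norm_bound_integral) (use set_borel_integral_eq_integral(1)[OF vs[OF xy]] nI[OF xy] in auto)
    also have "\<dots> \<le> J"
      unfolding J_def by (rule integral_subset_le) (use that nI xy b in auto)
    finally show ?thesis .
  qed
  have diff': "cmod (u s - u z) \<le> J" if "z \<in> {lo \<kappa> s..hi \<kappa> s}" for z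
  proof (cases "z \<le> s")
    case True then show ?thesis using diff[of z s] that b by auto
  next
    case False then show ?thesis using diff[of s z] that b by (auto simp: norm_minus_commute)
  qed
  have c: "((\<lambda>z. u s) has_integral complex_of_real (2 / \<kappa>) * u s) {lo \<kappa> s..hi \<kappa> s}"
    using has_integral_const_real[of "u s" "lo \<kappa> s" "hi \<kappa> s"] le by (simp add: b(5) scaleR_conv_of_real)
  have "((\<lambda>z. u s - u z) has_integral complex_of_real (2 / \<kappa>) * u s - complex_of_real (2 / \<kappa>) * average \<kappa> u s) {lo \<kappa> s..hi \<kappa> s}"
    by (rule has_integral_diff[OF c average_integral[OF k u s]])
  then have i: "((\<lambda>z. u s - u z) has_integral complex_of_real (2 / \<kappa>) * (u s - average \<kappa> u s)) (cbox (lo \<kappa> s) (hi \<kappa> s))"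
    by (simp add: right_diff_distrib)
  have "cmod (complex_of_real (2 / \<kappa>) * (u s - average \<kappa> u s)) \<le> J * measure lborel (cbox (lo \<kappa> s) (hi \<kappa> s))"
    by (rule has_integral_bound[OF J0 i]) (use diff' in auto)
  then have "(2 / \<kappa>) * cmod (u s - average \<kappa> u s) \<le> J * (2 / \<kappa>)"
    using le b(5) k unfolding norm_mult norm_of_real by simp
  then have "(2 / \<kappa>) * cmod (u s - average \<kappa> u s) \<le> (2 / \<kappa>) * J" by (simp add: mult.commute)
  then have "cmod (u s - average \<kappa> u s) \<le> J" using k by (simp add: divide_right_mono field_simps)
  also have "J = cmod (complex_of_real J)" using J0 by simp
  also have "\<dots> = 2 / \<kappa> * cmod (average \<kappa> w s)" using k by (simp add: J norm_mult norm_divide)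
  finally show ?thesis by (simp add: w_def)
qed

lemma average_approx_sqn:
  assumes k: "\<kappa> > 1" and u: "sq_int u" and d: "der u v" and v: "sq_int v"
  shows "sqn (\<lambda>s. u s - average \<kappa> u s) \<le> (2 / \<kappa>)\<^sup>2 * (sqn v / (1 - 1 / \<kappa>))"
proof -
  define w where "w = (\<lambda>x. complex_of_real (cmod (v x)))"
  have [measurable]: "v \<in> borel_measurable borel" "u \<in> borel_measurable borel" "average \<kappa> u \<in> borel_measurable borel"
    using u v by (auto intro: sq_int_meas average_meas)
  have wm: "w \<in> borel_measurable borel" unfolding w_def by measurable
  have w: "sq_int w" by (rule sq_int_mult_bound(1)[OF wm v, of 1]) (auto simp: w_def)
  have wn: "sqn w = sqn v" by (simp add: sqn_def w_def)
  have m: "(\<lambda>s. u s - average \<kappa> u s) \<in> borel_measurable borel" by measurable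
  have "sqn (\<lambda>s. u s - average \<kappa> u s) \<le> (2 / \<kappa>)\<^sup>2 * sqn (average \<kappa> w)"
    by (rule sq_int_mult_bound(2)[OF m sq_int_average(1)[OF k w]]) (use average_approx[OF k u d v] in \<open>simp add: w_def\<close>)
  also have "\<dots> \<le> (2 / \<kappa>)\<^sup>2 * (sqn v / (1 - 1 / \<kappa>))"
    using sq_int_average(2)[OF k w] wn by (intro mult_left_mono) auto
  finally show ?thesis .
qed

section \<open>Weighted Sobolev classes of parameterized functions\<close>

text \<open>The exponent is an integer because iterated residuals reach negative orders; it is
  doubled because \<open>sqn\<close> is the square of the norm. Asking for the bound eventually lets
  the thresholds of finitely many estimates merge.\<close>

definition L2_ord :: "int \<Rightarrow> (real \<Rightarrow> real \<Rightarrow> complex) \<Rightarrow> bool" where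
  "L2_ord e f \<longleftrightarrow> (\<forall>\<kappa>>1. sq_int (f \<kappa>)) \<and> (\<exists>C. \<forall>\<^sub>F \<kappa> in at_top. sqn (f \<kappa>) \<le> C * \<kappa> powi (2 * e))"

lemma L2_ord_sq: "L2_ord e f \<Longrightarrow> \<kappa> > 1 \<Longrightarrow> sq_int (f \<kappa>)"
  by (simp add: L2_ord_def)

lemma L2_ord_meas: "L2_ord e f \<Longrightarrow> \<kappa> > 1 \<Longrightarrow> f \<kappa> \<in> borel_measurable borel"
  by (simp add: L2_ord_def sq_int_meas)

lemma eventually_gt1: "\<forall>\<^sub>F \<kappa> in at_top. \<kappa> > (1::real)"
  by (rule eventually_gt_at_top)

lemma L2_ord_transfer:
  assumes g: "L2_ord e g" and f: "\<And>\<kappa>. \<kappa> > 1 \<Longrightarrow> sq_int (f \<kappa>)"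
    and le: "\<forall>\<^sub>F \<kappa> in at_top. sqn (f \<kappa>) \<le> D * \<kappa> powi (2 * k) * sqn (g \<kappa>)" and e: "e + k \<le> e'"
  shows "L2_ord e' f"
proof -
  from g obtain C where C: "\<forall>\<^sub>F \<kappa> in at_top. sqn (g \<kappa>) \<le> C * \<kappa> powi (2 * e)" by (auto simp: L2_ord_def)
  have "\<forall>\<^sub>F \<kappa> in at_top. sqn (f \<kappa>) \<le> \<bar>D\<bar> * \<bar>C\<bar> * \<kappa> powi (2 * e')"
    using le C eventually_gt1
  proof eventually_elim
    case (elim \<kappa>)
    have "sqn (f \<kappa>) \<le> D * \<kappa> powi (2 * k) * sqn (g \<kappa>)" by (rule elim)
    also have "\<dots> \<le> \<bar>D\<bar> * \<kappa> powi (2 * k) * sqn (g \<kappa>)"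
      using elim(3) sqn_nonneg[of "g \<kappa>"] by (intro mult_right_mono) auto
    also have "\<dots> \<le> \<bar>D\<bar> * \<kappa> powi (2 * k) * (\<bar>C\<bar> * \<kappa> powi (2 * e))"
    proof (rule mult_left_mono)
      have "C * \<kappa> powi (2 * e) \<le> \<bar>C\<bar> * \<kappa> powi (2 * e)"
        using elim(3) by (intro mult_right_mono) auto
      then show "sqn (g \<kappa>) \<le> \<bar>C\<bar> * \<kappa> powi (2 * e)" using elim(2) by linarith
    qed (use elim(3) in auto)
    also have "\<dots> = \<bar>D\<bar> * \<bar>C\<bar> * \<kappa> powi (2 * k + 2 * e)"
      using elim(3) by (subst power_int_add) auto
    also have "\<dots> \<le> \<bar>D\<bar> * \<bar>C\<bar> * \<kappa> powi (2 * e')"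
      using elim(3) e by (intro mult_left_mono power_int_increasing) auto
    finally show ?case .
  qed
  with f show ?thesis by (auto simp: L2_ord_def)
qed

lemma L2_ord_mono: "L2_ord e f \<Longrightarrow> e \<le> e' \<Longrightarrow> L2_ord e' f"
  by (rule L2_ord_transfer[of e f _ 1 0]) (auto intro: L2_ord_sq)

lemma L2_ord_dom:
  assumes "L2_ord e g" "\<And>\<kappa>. \<kappa> > 1 \<Longrightarrow> f \<kappa> \<in> borel_measurable borel"
    and "\<And>\<kappa> s. \<kappa> > 1 \<Longrightarrow> s \<in> II \<Longrightarrow> cmod (f \<kappa> s) \<le> D * \<kappa> powi k * cmod (g \<kappa> s)" "e + k \<le> e'"
  shows "L2_ord e' f"
proof (rule L2_ord_transfer[OF assms(1) _ _ assms(4)])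
  show "sq_int (f \<kappa>)" if "\<kappa> > 1" for \<kappa>
    by (rule sq_int_mult_bound(1)[OF assms(2)[OF that] L2_ord_sq[OF assms(1) that] assms(3)[OF that]])
  show "\<forall>\<^sub>F \<kappa> in at_top. sqn (f \<kappa>) \<le> D\<^sup>2 * \<kappa> powi (2 * k) * sqn (g \<kappa>)"
    using eventually_gt1
  proof eventually_elim
    case (elim \<kappa>)
    have "sqn (f \<kappa>) \<le> (D * \<kappa> powi k)\<^sup>2 * sqn (g \<kappa>)"
      by (rule sq_int_mult_bound(2)[OF assms(2)[OF elim] L2_ord_sq[OF assms(1) elim] assms(3)[OF elim]])
    also have "(D * \<kappa> powi k)\<^sup>2 = D\<^sup>2 * \<kappa> powi (2 * k)"
      using elim by (simp add: power_mult_distrib power2_eq_square power_int_add[symmetric])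
    finally show ?case .
  qed
qed

lemma L2_ord_add:
  assumes "L2_ord e f" "L2_ord e g" shows "L2_ord e (\<lambda>\<kappa> s. f \<kappa> s + g \<kappa> s)"
proof -
  obtain C C' where C: "\<forall>\<^sub>F \<kappa> in at_top. sqn (f \<kappa>) \<le> C * \<kappa> powi (2 * e)" "\<forall>\<^sub>F \<kappa> in at_top. sqn (g \<kappa>) \<le> C' * \<kappa> powi (2 * e)"
    using assms by (auto simp: L2_ord_def)
  have "\<forall>\<^sub>F \<kappa> in at_top. sqn (\<lambda>s. f \<kappa> s + g \<kappa> s) \<le> (2 * C + 2 * C') * \<kappa> powi (2 * e)"
    using C eventually_gt1
  proof eventually_elim
    case (elim \<kappa>)
    show ?case
      using sq_int_add(2)[OF L2_ord_sq[OF assms(1) elim(3)] L2_ord_sq[OF assms(2) elim(3)]] elim(1,2)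
      by (simp add: algebra_simps)
  qed
  then show ?thesis using sq_int_add(1) assms by (auto simp: L2_ord_def)
qed

lemma L2_ord_cmult:
  assumes "L2_ord e f" "\<And>\<kappa>. \<kappa> > 1 \<Longrightarrow> cmod (c \<kappa>) \<le> D * \<kappa> powi k" "e + k \<le> e'"
  shows "L2_ord e' (\<lambda>\<kappa> s. c \<kappa> * f \<kappa> s)"
proof (rule L2_ord_dom[OF assms(1) _ _ assms(3)])
  fix \<kappa> :: real assume k: "\<kappa> > 1"
  note [measurable] = L2_ord_meas[OF assms(1) k]
  show "(\<lambda>s. c \<kappa> * f \<kappa> s) \<in> borel_measurable borel" by measurable
  show "cmod (c \<kappa> * f \<kappa> s) \<le> D * \<kappa> powi k * cmod (f \<kappa> s)" for s
    using assms(2)[OF k] by (simp add: norm_mult mult_right_mono)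
qed

text \<open>The slope 1 - 1 / \<kappa> of the contractions degenerates as \<kappa> tends to 1. From
  \<kappa> = 2 on its reciprocal costs only a constant.\<close>

lemma eventually_factor: "\<forall>\<^sub>F \<kappa> in at_top. \<kappa> > 1 \<and> 1 / (1 - 1 / \<kappa>) \<le> (2::real)"
  using eventually_ge_at_top[of "2::real"] by eventually_elim (auto simp: field_simps)

lemma L2_ord_scaled:
  assumes "L2_ord e g" "\<And>\<kappa>. \<kappa> > 1 \<Longrightarrow> sq_int (f \<kappa>)"
    and "\<And>\<kappa>. \<kappa> > 1 \<Longrightarrow> sqn (f \<kappa>) \<le> D * \<kappa> powi (2 * k) * (sqn (g \<kappa>) / (1 - 1 / \<kappa>))" "D \<ge> 0" "e + k \<le> e'"
  shows "L2_ord e' f"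
proof (rule L2_ord_transfer[OF assms(1,2) _ assms(5)])
  show "\<forall>\<^sub>F \<kappa> in at_top. sqn (f \<kappa>) \<le> (D * 2) * \<kappa> powi (2 * k) * sqn (g \<kappa>)"
    using eventually_factor
  proof eventually_elim
    case (elim \<kappa>)
    have "sqn (f \<kappa>) \<le> D * \<kappa> powi (2 * k) * (sqn (g \<kappa>) / (1 - 1 / \<kappa>))" using assms(3) elim by simp
    also have "\<dots> = D * \<kappa> powi (2 * k) * (sqn (g \<kappa>) * (1 / (1 - 1 / \<kappa>)))" by simp
    also have "\<dots> \<le> D * \<kappa> powi (2 * k) * (sqn (g \<kappa>) * 2)"
      using elim assms(4) sqn_nonneg by (intro mult_left_mono) auto
    finally show ?case by simp
  qed
qed

lemma L2_ord_contract: "\<theta> \<in> {1, -1} \<Longrightarrow> L2_ord e g \<Longrightarrow> L2_ord e (\<lambda>\<kappa> s. g \<kappa> (contract \<theta> \<kappa> s))"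
  by (rule L2_ord_scaled[of e g _ 1 0]) (auto intro: sq_int_contract L2_ord_sq)

lemmas L2_ord_hi = L2_ord_contract[OF insertI1] and L2_ord_lo = L2_ord_contract[OF insertI2[OF singletonI]]

lemma L2_ord_average: "L2_ord e g \<Longrightarrow> L2_ord e (\<lambda>\<kappa>. average \<kappa> (g \<kappa>))"
  by (rule L2_ord_scaled[of e g _ 1 0]) (auto intro: sq_int_average L2_ord_sq)

text \<open>\<open>e p\<close> is the power of \<kappa> allowed to the p-th derivative. The sequence
  is arbitrary because the residuals pass through exponents that are not those of any class
  \<open>A n\<close>.\<close>

fun Sob_ord :: "(nat \<Rightarrow> int) \<Rightarrow> nat \<Rightarrow> (real \<Rightarrow> real \<Rightarrow> complex) \<Rightarrow> bool" where
  "Sob_ord e 0 f \<longleftrightarrow> L2_ord (e 0) f"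
| "Sob_ord e (Suc N) f \<longleftrightarrow> L2_ord (e 0) f \<and> (\<exists>g. (\<forall>\<kappa>>1. der (f \<kappa>) (g \<kappa>)) \<and> Sob_ord (\<lambda>p. e (Suc p)) N g)"

lemma Sob_ord_L2_ord: "Sob_ord e N f \<Longrightarrow> L2_ord (e 0) f"
  by (cases N) auto

lemma Sob_ord_SucI:
  "L2_ord (e 0) f \<Longrightarrow> (\<And>\<kappa>. \<kappa> > 1 \<Longrightarrow> der (f \<kappa>) (g \<kappa>)) \<Longrightarrow> Sob_ord (\<lambda>p. e (Suc p)) N g \<Longrightarrow> Sob_ord e (Suc N) f"
  by auto

lemma Sob_ord_mono: "Sob_ord e N f \<Longrightarrow> M \<le> N \<Longrightarrow> (\<And>p. p \<le> M \<Longrightarrow> e p \<le> e' p) \<Longrightarrow> Sob_ord e' M f"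
proof (induction M arbitrary: N e e' f)
  case 0
  then show ?case using Sob_ord_L2_ord L2_ord_mono by fastforce
next
  case (Suc M)
  then obtain N' where N: "N = Suc N'" by (cases N) auto
  with Suc.prems obtain g where g: "L2_ord (e 0) f" "\<forall>\<kappa>>1. der (f \<kappa>) (g \<kappa>)" "Sob_ord (\<lambda>p. e (Suc p)) N' g" by auto
  have "Sob_ord (\<lambda>p. e' (Suc p)) M g"
    by (rule Suc.IH[OF g(3)]) (use Suc.prems N in auto)
  moreover have "L2_ord (e' 0) f" using g(1) Suc.prems(3) L2_ord_mono by blast
  ultimately show ?case using g(2) by auto
qed

lemma Sob_ord_add: "Sob_ord e N f \<Longrightarrow> Sob_ord e N g \<Longrightarrow> Sob_ord e N (\<lambda>\<kappa> s. f \<kappa> s + g \<kappa> s)"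
proof (induction N arbitrary: e f g)
  case 0
  then show ?case by (simp add: L2_ord_add)
next
  case (Suc N)
  then obtain f' g' where "\<forall>\<kappa>>1. der (f \<kappa>) (f' \<kappa>)" "Sob_ord (\<lambda>p. e (Suc p)) N f'"
    "\<forall>\<kappa>>1. der (g \<kappa>) (g' \<kappa>)" "Sob_ord (\<lambda>p. e (Suc p)) N g'" "L2_ord (e 0) f" "L2_ord (e 0) g" by auto
  then show ?case
    using Suc.IH[of "\<lambda>p. e (Suc p)" f' g'] L2_ord_add[of "e 0" f g] der_add
    by (auto intro!: exI[of _ "\<lambda>\<kappa> s. f' \<kappa> s + g' \<kappa> s"])
qed

lemma Sob_ord_cmult:
  assumes "\<And>\<kappa>. \<kappa> > 1 \<Longrightarrow> cmod (c \<kappa>) \<le> D * \<kappa> powi k"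
  shows "Sob_ord e N f \<Longrightarrow> (\<And>p. p \<le> N \<Longrightarrow> e p + k \<le> e' p) \<Longrightarrow> Sob_ord e' N (\<lambda>\<kappa> s. c \<kappa> * f \<kappa> s)"
proof (induction N arbitrary: e e' f)
  case 0
  then show ?case using L2_ord_cmult[OF _ assms] by auto
next
  case (Suc N)
  then obtain f' where f': "\<forall>\<kappa>>1. der (f \<kappa>) (f' \<kappa>)" "Sob_ord (\<lambda>p. e (Suc p)) N f'" "L2_ord (e 0) f" by auto
  have "Sob_ord (\<lambda>p. e' (Suc p)) N (\<lambda>\<kappa> s. c \<kappa> * f' \<kappa> s)"
    by (rule Suc.IH[OF f'(2)]) (use Suc.prems in auto)
  moreover have "L2_ord (e' 0) (\<lambda>\<kappa> s. c \<kappa> * f \<kappa> s)" using L2_ord_cmult[OF f'(3) assms] Suc.prems(2)[of 0] by auto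
  ultimately show ?case
    using f'(1) der_cmult by (auto intro!: exI[of _ "\<lambda>\<kappa> s. c \<kappa> * f' \<kappa> s"])
qed

lemma Sob_ord_const_mult: "Sob_ord e N f \<Longrightarrow> Sob_ord e N (\<lambda>\<kappa> s. c * f \<kappa> s)"
  by (rule Sob_ord_cmult[of _ "cmod c" 0]) auto

lemma Sob_ord_diff: "Sob_ord e N f \<Longrightarrow> Sob_ord e N g \<Longrightarrow> Sob_ord e N (\<lambda>\<kappa> s. f \<kappa> s - g \<kappa> s)"
  using Sob_ord_add[OF _ Sob_ord_const_mult[of e N g "-1"]] by simp

lemma der_zero: "der (\<lambda>s. 0) (\<lambda>s. 0)"
  by (rule derI) simp

lemma Sob_ord_zero: "Sob_ord e N (\<lambda>\<kappa> s. 0)"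
proof (induction N arbitrary: e)
  case 0
  have "sq_int (\<lambda>s. 0)" by (rule sq_int_bounded(1)[of _ 0]) auto
  moreover have "sqn (\<lambda>s. 0) = 0" by (simp add: sqn_def)
  ultimately have B: "L2_ord (e 0) (\<lambda>\<kappa> s. 0)" by (auto simp: L2_ord_def intro!: exI[of _ 0])
  then show ?case by simp
next
  case (Suc N)
  have "sq_int (\<lambda>s. 0)" by (rule sq_int_bounded(1)[of _ 0]) auto
  moreover have "sqn (\<lambda>s. 0) = 0" by (simp add: sqn_def)
  ultimately have B: "L2_ord (e 0) (\<lambda>\<kappa> s. 0)" by (auto simp: L2_ord_def intro!: exI[of _ 0])
  then show ?case using Suc der_zero by auto
qed

lemma norm_shrink: "\<kappa> > 1 \<Longrightarrow> cmod (of_real (1 - 1 / \<kappa>)) \<le> 1 * \<kappa> powi 0"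
  unfolding norm_of_real by (simp add: abs_if)

lemma Sob_ord_contract:
  assumes "\<theta> \<in> {1, -1}"
  shows "Sob_ord e N g \<Longrightarrow> Sob_ord e N (\<lambda>\<kappa> s. g \<kappa> (contract \<theta> \<kappa> s))"
proof (induction N arbitrary: e g)
  case 0
  then show ?case by (simp add: L2_ord_contract[OF assms])
next
  case (Suc N)
  then obtain g' where g': "\<forall>\<kappa>>1. der (g \<kappa>) (g' \<kappa>)" "Sob_ord (\<lambda>p. e (Suc p)) N g'" "L2_ord (e 0) g" by auto
  have "Sob_ord (\<lambda>p. e (Suc p)) N (\<lambda>\<kappa> s. of_real (1 - 1 / \<kappa>) * g' \<kappa> (contract \<theta> \<kappa> s))"
    by (rule Sob_ord_cmult[OF norm_shrink Suc.IH[OF g'(2)]]) auto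
  then show ?case using L2_ord_contract[OF assms g'(3)] g'(1) der_contract[OF assms] by fastforce
qed

lemmas Sob_ord_hi = Sob_ord_contract[OF insertI1] and Sob_ord_lo = Sob_ord_contract[OF insertI2[OF singletonI]]

section \<open>Multiplication by oscillating and by smooth factors\<close>

definition osc :: "real \<Rightarrow> real \<Rightarrow> real \<Rightarrow> complex" where "osc \<sigma> \<kappa> s = cis (\<sigma> * \<kappa> * s)"

lemma norm_osc [simp]: "cmod (osc \<sigma> \<kappa> s) = 1" by (simp add: osc_def)

lemma osc_meas [measurable]: "osc \<sigma> \<kappa> \<in> borel_measurable borel"
  unfolding osc_def by (intro borel_measurable_continuous_onI continuous_intros)

lemma osc_deriv: "(osc \<sigma> \<kappa> has_vector_derivative \<i> * \<sigma> * \<kappa> * osc \<sigma> \<kappa> s) (at s within S)"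
  unfolding osc_def[abs_def] has_vector_derivative_def
  by (auto intro!: derivative_eq_intros simp: scaleR_conv_of_real fun_eq_iff)

lemma der_osc_mult:
  assumes "der u v" "sq_int v"
  shows "der (\<lambda>s. osc \<sigma> \<kappa> s * u s) (\<lambda>s. \<i> * \<sigma> * \<kappa> * osc \<sigma> \<kappa> s * u s + osc \<sigma> \<kappa> s * v s)"
proof (rule der_mult[OF assms])
  show "continuous_on II (\<lambda>s. \<i> * \<sigma> * \<kappa> * osc \<sigma> \<kappa> s)"
    unfolding osc_def by (intro continuous_intros)
qed (rule osc_deriv)

lemma L2_ord_osc:
  assumes "L2_ord e f" shows "L2_ord e (\<lambda>\<kappa> s. osc \<sigma> \<kappa> s * f \<kappa> s)"
proof (rule L2_ord_dom[OF assms, of _ 1 0])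
  fix \<kappa> :: real assume k: "\<kappa> > 1"
  note [measurable] = L2_ord_meas[OF assms k]
  show "(\<lambda>s. osc \<sigma> \<kappa> s * f \<kappa> s) \<in> borel_measurable borel" by measurable
qed (auto simp: norm_mult)

text \<open>Differentiating the phase brings out a factor \<kappa> while the order of the derivative
  of f stays. This is absorbed exactly when the allowed power grows by at least one from each order
  to the next.\<close>

lemma Sob_ord_osc: "Sob_ord e N f \<Longrightarrow> (\<And>p. p < N \<Longrightarrow> e p + 1 \<le> e (Suc p)) \<Longrightarrow> Sob_ord e N (\<lambda>\<kappa> s. osc \<sigma> \<kappa> s * f \<kappa> s)"
proof (induction N arbitrary: e f)
  case 0
  then show ?case by (simp add: L2_ord_osc)
next
  case (Suc N)
  then obtain f' where f': "\<forall>\<kappa>>1. der (f \<kappa>) (f' \<kappa>)" "Sob_ord (\<lambda>p. e (Suc p)) N f'" "L2_ord (e 0) f" by auto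
  \<comment> \<open>For the term with the differentiated phase the induction hypothesis is applied
    to \<open>f\<close> itself, its last derivative dropped; the factor \<kappa> then turns
    \<open>e p\<close> into at most \<open>e (Suc p)\<close>.\<close>
  have 1: "Sob_ord e N (\<lambda>\<kappa> s. osc \<sigma> \<kappa> s * f \<kappa> s)"
    by (rule Suc.IH[OF Sob_ord_mono[OF Suc.prems(1)]]) (use Suc.prems in auto)
  have 2: "Sob_ord (\<lambda>p. e (Suc p)) N (\<lambda>\<kappa> s. (\<i> * \<sigma> * \<kappa>) * (osc \<sigma> \<kappa> s * f \<kappa> s))"
    by (rule Sob_ord_cmult[OF _ 1, of _ "\<bar>\<sigma>\<bar>" 1]) (use Suc.prems(2) in \<open>auto simp: norm_mult\<close>)
  have 3: "Sob_ord (\<lambda>p. e (Suc p)) N (\<lambda>\<kappa> s. osc \<sigma> \<kappa> s * f' \<kappa> s)"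
    by (rule Suc.IH[OF f'(2)]) (use Suc.prems in auto)
  have "\<forall>\<kappa>>1. der (\<lambda>s. osc \<sigma> \<kappa> s * f \<kappa> s) (\<lambda>s. (\<i> * \<sigma> * \<kappa>) * (osc \<sigma> \<kappa> s * f \<kappa> s) + osc \<sigma> \<kappa> s * f' \<kappa> s)"
  proof (intro allI impI)
    fix \<kappa> :: real assume k: "\<kappa> > 1"
    show "der (\<lambda>s. osc \<sigma> \<kappa> s * f \<kappa> s) (\<lambda>s. (\<i> * \<sigma> * \<kappa>) * (osc \<sigma> \<kappa> s * f \<kappa> s) + osc \<sigma> \<kappa> s * f' \<kappa> s)"
      by (rule der_cong[OF der_osc_mult[of "f \<kappa>" "f' \<kappa>"]]) (use f' k L2_ord_sq[OF Sob_ord_L2_ord] in \<open>auto simp: mult.assoc\<close>)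
  qed
  then show ?case by (intro Sob_ord_SucI[OF L2_ord_osc[OF f'(3)] _ Sob_ord_add[OF 2 3]]) auto
qed

fun Cdiff :: "nat \<Rightarrow> (real \<Rightarrow> complex) \<Rightarrow> bool" where
  "Cdiff 0 a \<longleftrightarrow> continuous_on II a"
| "Cdiff (Suc N) a \<longleftrightarrow> (\<exists>a'. (\<forall>x\<in>II. (a has_vector_derivative a' x) (at x within II)) \<and> Cdiff N a')"

lemma Cdiff_continuous: "Cdiff N a \<Longrightarrow> continuous_on II a"
  by (cases N) (auto simp: continuous_on_eq_continuous_within intro: has_vector_derivative_continuous)

lemma L2_ord_smooth_mult:
  assumes "continuous_on II a" "L2_ord e f" shows "L2_ord e (\<lambda>\<kappa> s. a (cl s) * f \<kappa> s)"
proof -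
  obtain C where C: "\<And>x. x \<in> II \<Longrightarrow> cmod (a x) \<le> C" using bounded_II[OF assms(1)] by metis
  have [measurable]: "(\<lambda>s. a (cl s)) \<in> borel_measurable borel"
    by (rule borel_measurable_continuous_onI[OF continuous_cl_comp[OF assms(1)]])
  show ?thesis
  proof (rule L2_ord_dom[OF assms(2), of _ C 0])
    fix \<kappa> :: real assume k: "\<kappa> > 1"
    note [measurable] = L2_ord_meas[OF assms(2) k]
    show "(\<lambda>s. a (cl s) * f \<kappa> s) \<in> borel_measurable borel" by measurable
    show "cmod (a (cl s) * f \<kappa> s) \<le> C * \<kappa> powi 0 * cmod (f \<kappa> s)" for s
      using C[OF cl_in] by (simp add: norm_mult mult_right_mono)
  qed simp
qed

text \<open>In the term a' * f the function f appears with one derivative less than its place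
  allows; monotonicity of \<open>e\<close> accommodates it.\<close>

lemma Sob_ord_smooth_mult:
  "Cdiff N a \<Longrightarrow> Sob_ord e N f \<Longrightarrow> (\<And>p. e p \<le> e (Suc p)) \<Longrightarrow> Sob_ord e N (\<lambda>\<kappa> s. a (cl s) * f \<kappa> s)"
proof (induction N arbitrary: e f a)
  case 0
  then show ?case by (simp add: L2_ord_smooth_mult)
next
  case (Suc N)
  then obtain f' where f': "\<forall>\<kappa>>1. der (f \<kappa>) (f' \<kappa>)" "Sob_ord (\<lambda>p. e (Suc p)) N f'" "L2_ord (e 0) f" by auto
  obtain a' where a': "\<And>x. x \<in> II \<Longrightarrow> (a has_vector_derivative a' x) (at x within II)" "Cdiff N a'" using Suc.prems(1) by auto
  have aN: "Cdiff N a" using Suc.prems(1)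
  proof (induction N arbitrary: a)
    case 0
    then show ?case using Cdiff_continuous[of "Suc 0" a] by simp
  next
    case (Suc N)
    then show ?case by auto
  qed
  have 2: "Sob_ord (\<lambda>p. e (Suc p)) N (\<lambda>\<kappa> s. a' (cl s) * f \<kappa> s)"
  proof (rule Suc.IH[OF a'(2)])
    show "Sob_ord (\<lambda>p. e (Suc p)) N f" by (rule Sob_ord_mono[OF Suc.prems(2)]) (use Suc.prems(3) in auto)
  qed (rule Suc.prems(3))
  have 3: "Sob_ord (\<lambda>p. e (Suc p)) N (\<lambda>\<kappa> s. a (cl s) * f' \<kappa> s)"
    by (rule Suc.IH[OF aN f'(2)]) (use Suc.prems in auto)
  have "\<forall>\<kappa>>1. der (\<lambda>s. a (cl s) * f \<kappa> s) (\<lambda>s. a' (cl s) * f \<kappa> s + a (cl s) * f' \<kappa> s)"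
  proof (intro allI impI)
    fix \<kappa> :: real assume k: "\<kappa> > 1"
    show "der (\<lambda>s. a (cl s) * f \<kappa> s) (\<lambda>s. a' (cl s) * f \<kappa> s + a (cl s) * f' \<kappa> s)"
      by (rule der_cong[OF der_mult[OF _ _ a'(1) Cdiff_continuous[OF a'(2)], of "f \<kappa>" "f' \<kappa>"]])
        (use f' k L2_ord_sq[OF Sob_ord_L2_ord] in auto)
  qed
  moreover have "L2_ord (e 0) (\<lambda>\<kappa> s. a (cl s) * f \<kappa> s)"
    by (rule L2_ord_smooth_mult[OF Cdiff_continuous[OF aN] f'(3)])
  ultimately show ?case by (intro Sob_ord_SucI[OF _ _ Sob_ord_add[OF 2 3]]) auto
qed

section \<open>Splitting oscillatory primitives\<close>

text \<open>With \<open>A = average \<kappa> g / (\<i> \<sigma> \<kappa>)\<close> the residual is \<open>g - A' - \<i> \<sigma> \<kappa> A\<close>, so that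
  \<open>osc \<sigma> \<kappa> s * residual \<sigma> \<kappa> g s\<close> is what one smoothed integration by parts leaves over.
  It trades one derivative of \<open>g\<close> for one factor \<open>1 / \<kappa>\<close>.\<close>

definition residual_coeff :: "real \<Rightarrow> real \<Rightarrow> complex" where
  "residual_coeff \<sigma> \<kappa> = of_real ((\<kappa> - 1) / 2) * (1 / (\<i> * \<sigma> * \<kappa>))"

definition residual :: "real \<Rightarrow> real \<Rightarrow> (real \<Rightarrow> complex) \<Rightarrow> real \<Rightarrow> complex" where
  "residual \<sigma> \<kappa> g s = (g s - average \<kappa> g s) - residual_coeff \<sigma> \<kappa> * (g (hi \<kappa> s) - g (lo \<kappa> s))"

lemma norm_residual_coeff: "\<sigma> \<noteq> 0 \<Longrightarrow> \<kappa> > 1 \<Longrightarrow> cmod (residual_coeff \<sigma> \<kappa>) \<le> 1 / (2 * \<bar>\<sigma>\<bar>)"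
  unfolding residual_coeff_def norm_mult norm_divide norm_of_real by (simp add: field_simps)

text \<open>The estimate without gain serves at the top order, where g has no further derivative to
  trade.\<close>

lemma L2_ord_residual:
  assumes "L2_ord e g" "\<sigma> \<noteq> 0" shows "L2_ord e (\<lambda>\<kappa>. residual \<sigma> \<kappa> (g \<kappa>))"
proof -
  note h = L2_ord_add[OF assms(1) L2_ord_cmult[OF L2_ord_average[OF assms(1)], of "\<lambda>_. -1" 1 0]]
    L2_ord_add[OF L2_ord_hi[OF assms(1)] L2_ord_cmult[OF L2_ord_lo[OF assms(1)], of "\<lambda>_. -1" 1 0]]
  have 1: "L2_ord e (\<lambda>\<kappa> s. g \<kappa> s - average \<kappa> (g \<kappa>) s)" using h(1) by simp
  have 2: "L2_ord e (\<lambda>\<kappa> s. g \<kappa> (hi \<kappa> s) - g \<kappa> (lo \<kappa> s))" using h(2) by simp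
  have "L2_ord e (\<lambda>\<kappa> s. (- residual_coeff \<sigma> \<kappa>) * (g \<kappa> (hi \<kappa> s) - g \<kappa> (lo \<kappa> s)))"
    by (rule L2_ord_cmult[OF 2, of _ "1 / (2 * \<bar>\<sigma>\<bar>)" 0]) (use norm_residual_coeff[OF assms(2)] in auto)
  from L2_ord_add[OF 1 this] show ?thesis by (simp add: residual_def[abs_def])
qed

text \<open>Both parts of the residual are differences of g inside a window of length 2 / \<kappa>,
  hence controlled by 2 / \<kappa> times averages of g' or |g'|. The coefficient of the second part
  stays bounded by \<open>norm_residual_coeff\<close>.\<close>

lemma L2_ord_residual_gain:
  assumes g: "L2_ord e0 g" and d: "\<And>\<kappa>. \<kappa> > 1 \<Longrightarrow> der (g \<kappa>) (g' \<kappa>)" and g': "L2_ord e g'" and s: "\<sigma> \<noteq> 0"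
  shows "L2_ord (e - 1) (\<lambda>\<kappa>. residual \<sigma> \<kappa> (g \<kappa>))"
proof -
  have "L2_ord e0 (\<lambda>\<kappa> s. g \<kappa> s + (-1) * average \<kappa> (g \<kappa>) s)"
    by (rule L2_ord_add[OF g L2_ord_cmult[OF L2_ord_average[OF g], of "\<lambda>_. -1" 1 0]]) auto
  then have 0: "L2_ord e0 (\<lambda>\<kappa> s. g \<kappa> s - average \<kappa> (g \<kappa>) s)" by simp
  have 1: "L2_ord (e - 1) (\<lambda>\<kappa> s. g \<kappa> s - average \<kappa> (g \<kappa>) s)"
  proof (rule L2_ord_scaled[OF g'])
    fix \<kappa> :: real assume k: "\<kappa> > 1"
    show "sq_int (\<lambda>s. g \<kappa> s - average \<kappa> (g \<kappa>) s)" by (rule L2_ord_sq[OF 0 k])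
    have "(2 / \<kappa>)\<^sup>2 = 4 * \<kappa> powi (2 * (-1))"
      by (simp add: power_int_minus power_divide field_simps)
    then show "sqn (\<lambda>s. g \<kappa> s - average \<kappa> (g \<kappa>) s) \<le> 4 * \<kappa> powi (2 * (-1)) * (sqn (g' \<kappa>) / (1 - 1 / \<kappa>))"
      using average_approx_sqn[OF k L2_ord_sq[OF g k] d[OF k] L2_ord_sq[OF g' k]] by simp
  qed auto
  have "L2_ord e0 (\<lambda>\<kappa> s. g \<kappa> (hi \<kappa> s) + (-1) * g \<kappa> (lo \<kappa> s))"
    by (rule L2_ord_add[OF L2_ord_hi[OF g] L2_ord_cmult[OF L2_ord_lo[OF g], of "\<lambda>_. -1" 1 0]]) auto
  then have 2: "L2_ord e0 (\<lambda>\<kappa> s. g \<kappa> (hi \<kappa> s) - g \<kappa> (lo \<kappa> s))" by simp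
  have 3: "L2_ord (e - 1) (\<lambda>\<kappa> s. (- residual_coeff \<sigma> \<kappa>) * (g \<kappa> (hi \<kappa> s) - g \<kappa> (lo \<kappa> s)))"
  proof (rule L2_ord_dom[OF L2_ord_average[OF g'], of _ "1 / \<bar>\<sigma>\<bar>" "-1"])
    fix \<kappa> :: real assume k: "\<kappa> > 1"
    note [measurable] = L2_ord_meas[OF 2 k]
    show "(\<lambda>s. (- residual_coeff \<sigma> \<kappa>) * (g \<kappa> (hi \<kappa> s) - g \<kappa> (lo \<kappa> s))) \<in> borel_measurable borel" by measurable
    fix s assume "s \<in> II"
    then have "cmod ((- residual_coeff \<sigma> \<kappa>) * (g \<kappa> (hi \<kappa> s) - g \<kappa> (lo \<kappa> s))) = cmod (residual_coeff \<sigma> \<kappa>) * ((2 / \<kappa>) * cmod (average \<kappa> (g' \<kappa>) s))"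
      using k by (subst average_diff[OF k d[OF k] L2_ord_sq[OF g' k]]) (auto simp: norm_mult norm_divide)
    also have "\<dots> \<le> 1 / (2 * \<bar>\<sigma>\<bar>) * ((2 / \<kappa>) * cmod (average \<kappa> (g' \<kappa>) s))"
      by (rule mult_right_mono[OF norm_residual_coeff[OF s k]]) (use k in auto)
    also have "\<dots> = 1 / \<bar>\<sigma>\<bar> * \<kappa> powi -1 * cmod (average \<kappa> (g' \<kappa>) s)"
      using k by (simp add: power_int_minus field_simps)
    finally show "cmod ((- residual_coeff \<sigma> \<kappa>) * (g \<kappa> (hi \<kappa> s) - g \<kappa> (lo \<kappa> s))) \<le> 1 / \<bar>\<sigma>\<bar> * \<kappa> powi -1 * cmod (average \<kappa> (g' \<kappa>) s)" .
  qed simp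
  from L2_ord_add[OF 1 3] show ?thesis by (simp add: residual_def[abs_def])
qed

text \<open>The residual would commute with differentiation if the window were translated rigidly.
  Its contraction contributes the ratio 1 - 1 / \<kappa> and, from the term g alone, the remainder
  g' / \<kappa>.\<close>

lemma der_residual:
  assumes k: "\<kappa> > 1" and g: "sq_int g" "der g g'" "sq_int g'"
  shows "der (residual \<sigma> \<kappa> g) (\<lambda>s. of_real (1 - 1 / \<kappa>) * residual \<sigma> \<kappa> g' s + of_real (1 / \<kappa>) * g' s)"
proof -
  have "der (\<lambda>s. (g s - average \<kappa> g s) - residual_coeff \<sigma> \<kappa> * (g (hi \<kappa> s) - g (lo \<kappa> s)))
    (\<lambda>s. (g' s - of_real (1 - 1 / \<kappa>) * average \<kappa> g' s)
      - residual_coeff \<sigma> \<kappa> * (of_real (1 - 1 / \<kappa>) * g' (hi \<kappa> s) - of_real (1 - 1 / \<kappa>) * g' (lo \<kappa> s)))"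
    by (intro der_diff der_cmult g der_mol'[OF k g] der_hi[OF k g(2)] der_lo[OF k g(2)])
  moreover have "(a - c * b) - l * (c * x - c * y) = c * ((a - b) - l * (x - y)) + of_real (1 / \<kappa>) * a"
    if "c = of_real (1 - 1 / \<kappa>)" for a b c l x y :: complex
  proof -
    have *: "of_real (1 / \<kappa>) = 1 - c" using that by simp
    show ?thesis unfolding * by (simp add: algebra_simps)
  qed
  ultimately show ?thesis by (simp only: residual_def[abs_def])
qed

lemma norm_inv_kappa: "\<kappa> > 1 \<Longrightarrow> cmod (of_real (1 / \<kappa>)) \<le> 1 * \<kappa> powi -1"
  by (simp add: norm_divide power_int_minus field_simps)

text \<open>The hypotheses reflect three sources: the exchange of a derivative for a factor 1 /
  \<kappa> below the top order, the absence of a gain at the top order N, and the remainder g' /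
  \<kappa> left by the contraction of the window.\<close>

lemma Sob_ord_residual:
  assumes "\<sigma> \<noteq> 0"
  shows "Sob_ord e N g \<Longrightarrow> (\<And>p. p < N \<Longrightarrow> e (Suc p) \<le> e' p + 1) \<Longrightarrow> e N \<le> e' N \<Longrightarrow>
    (\<And>p. p \<le> N \<Longrightarrow> e p \<le> e' p + 1) \<Longrightarrow> Sob_ord e' N (\<lambda>\<kappa>. residual \<sigma> \<kappa> (g \<kappa>))"
proof (induction N arbitrary: e e' g)
  case 0
  then show ?case using L2_ord_mono[OF L2_ord_residual[OF _ assms]] by auto
next
  case (Suc N)
  then obtain g' where g': "\<forall>\<kappa>>1. der (g \<kappa>) (g' \<kappa>)" "Sob_ord (\<lambda>p. e (Suc p)) N g'" "L2_ord (e 0) g" by auto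
  have Bg': "L2_ord (e (Suc 0)) g'" using Sob_ord_L2_ord[OF g'(2)] by simp
  show ?case
  proof (rule Sob_ord_SucI)
    have "L2_ord (e (Suc 0) - 1) (\<lambda>\<kappa>. residual \<sigma> \<kappa> (g \<kappa>))"
      by (rule L2_ord_residual_gain[OF g'(3) _ Bg' assms]) (use g'(1) in auto)
    then show "L2_ord (e' 0) (\<lambda>\<kappa>. residual \<sigma> \<kappa> (g \<kappa>))"
      by (rule L2_ord_mono) (use Suc.prems(2)[of 0] in auto)
    show "der (residual \<sigma> \<kappa> (g \<kappa>)) (\<lambda>s. of_real (1 - 1 / \<kappa>) * residual \<sigma> \<kappa> (g' \<kappa>) s + of_real (1 / \<kappa>) * g' \<kappa> s)"
      if "\<kappa> > 1" for \<kappa>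
      by (rule der_residual) (use that g' Bg' L2_ord_sq in auto)
    have IH: "Sob_ord (\<lambda>p. e' (Suc p)) N (\<lambda>\<kappa>. residual \<sigma> \<kappa> (g' \<kappa>))"
      by (rule Suc.IH[OF g'(2)]) (use Suc.prems in auto)
    show "Sob_ord (\<lambda>p. e' (Suc p)) N (\<lambda>\<kappa> s. of_real (1 - 1 / \<kappa>) * residual \<sigma> \<kappa> (g' \<kappa>) s + of_real (1 / \<kappa>) * g' \<kappa> s)"
    proof (rule Sob_ord_add)
      show "Sob_ord (\<lambda>p. e' (Suc p)) N (\<lambda>\<kappa> s. of_real (1 - 1 / \<kappa>) * residual \<sigma> \<kappa> (g' \<kappa>) s)"
        by (rule Sob_ord_cmult[OF norm_shrink IH]) auto
      show "Sob_ord (\<lambda>p. e' (Suc p)) N (\<lambda>\<kappa> s. of_real (1 / \<kappa>) * g' \<kappa> s)"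
        by (rule Sob_ord_cmult[OF norm_inv_kappa g'(2)]) (use Suc.prems(4) in force)+
    qed
  qed
qed

text \<open>The boundary term of an integration by parts against the phase, with g replaced by its
  average.\<close>

definition amp :: "real \<Rightarrow> real \<Rightarrow> (real \<Rightarrow> complex) \<Rightarrow> real \<Rightarrow> complex" where
  "amp \<sigma> \<kappa> g s = (1 / (\<i> * \<sigma> * \<kappa>)) * average \<kappa> g s"

lemma der_amp:
  assumes "\<kappa> > 1" "sq_int g"
  shows "der (amp \<sigma> \<kappa> g) (\<lambda>s. residual_coeff \<sigma> \<kappa> * (g (hi \<kappa> s) - g (lo \<kappa> s)))"
  by (rule der_cong[OF der_cmult[OF der_average[OF assms], of "1 / (\<i> * \<sigma> * \<kappa>)"]])
    (simp_all add: amp_def residual_coeff_def)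

lemma der_osc_amp:
  assumes k: "\<kappa> > 1" and g: "sq_int g" and s: "\<sigma> \<noteq> 0"
  shows "der (\<lambda>s. osc \<sigma> \<kappa> s * amp \<sigma> \<kappa> g s) (\<lambda>s. osc \<sigma> \<kappa> s * (g s - residual \<sigma> \<kappa> g s))"
proof (rule der_cong[OF der_osc_mult[OF der_amp[OF k g]]])
  have hl: "sq_int (\<lambda>s. g (hi \<kappa> s))" "sq_int (\<lambda>s. g (lo \<kappa> s))"
    by (rule sq_int_contract(1)[OF _ k g]; simp)+
  have "sq_int (\<lambda>s. g (hi \<kappa> s) + (-1) * g (lo \<kappa> s))"
    by (rule sq_int_add(1)[OF hl(1) sq_int_cmult[OF hl(2)]])
  from sq_int_cmult[OF this] show "sq_int (\<lambda>s. residual_coeff \<sigma> \<kappa> * (g (hi \<kappa> s) - g (lo \<kappa> s)))" by simp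
  fix s
  have "\<i> * \<sigma> * \<kappa> * amp \<sigma> \<kappa> g s = average \<kappa> g s" using k s by (simp add: amp_def)
  then have "\<i> * \<sigma> * \<kappa> * osc \<sigma> \<kappa> s * amp \<sigma> \<kappa> g s = osc \<sigma> \<kappa> s * average \<kappa> g s"
    by (metis mult.assoc mult.commute)
  then show "\<i> * \<sigma> * \<kappa> * osc \<sigma> \<kappa> s * amp \<sigma> \<kappa> g s + osc \<sigma> \<kappa> s * (residual_coeff \<sigma> \<kappa> * (g (hi \<kappa> s) - g (lo \<kappa> s))) =
        osc \<sigma> \<kappa> s * (g s - residual \<sigma> \<kappa> g s)"
    by (simp add: residual_def algebra_simps)
qed auto

text \<open>The derivative of the average costs a factor of order \<kappa>, which cancels against
  the denominator. So the derivative of order p + 1 is as large as the p-th derivative of g, and the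
  function itself is smaller by 1 / \<kappa>.\<close>

lemma Sob_ord_amp:
  assumes g: "Sob_ord e N g" and s: "\<sigma> \<noteq> 0" and e: "e 0 - 1 \<le> e' 0" "\<And>p. p \<le> N \<Longrightarrow> e p \<le> e' (Suc p)"
  shows "Sob_ord e' (Suc N) (\<lambda>\<kappa>. amp \<sigma> \<kappa> (g \<kappa>))"
proof (rule Sob_ord_SucI)
  have B: "L2_ord (e 0) g" by (rule Sob_ord_L2_ord[OF g])
  have "cmod (1 / (\<i> * \<sigma> * \<kappa>)) \<le> 1 / \<bar>\<sigma>\<bar> * \<kappa> powi -1" if "\<kappa> > 1" for \<kappa> :: real
    using that by (simp add: norm_divide norm_mult power_int_minus field_simps)
  then have "L2_ord (e' 0) (\<lambda>\<kappa> s. (1 / (\<i> * \<sigma> * \<kappa>)) * average \<kappa> (g \<kappa>) s)"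
    by (rule L2_ord_cmult[OF L2_ord_average[OF B]]) (use e(1) in auto)
  then show "L2_ord (e' 0) (\<lambda>\<kappa>. amp \<sigma> \<kappa> (g \<kappa>))" by (simp add: amp_def[abs_def])
  show "der (amp \<sigma> \<kappa> (g \<kappa>)) (\<lambda>s. residual_coeff \<sigma> \<kappa> * (g \<kappa> (hi \<kappa> s) - g \<kappa> (lo \<kappa> s)))" if "\<kappa> > 1" for \<kappa>
    by (rule der_amp[OF that L2_ord_sq[OF B that]])
  show "Sob_ord (\<lambda>p. e' (Suc p)) N (\<lambda>\<kappa> s. residual_coeff \<sigma> \<kappa> * (g \<kappa> (hi \<kappa> s) - g \<kappa> (lo \<kappa> s)))"
    by (rule Sob_ord_cmult[OF _ Sob_ord_diff[OF Sob_ord_hi[OF g] Sob_ord_lo[OF g]], of _ "1 / (2 * \<bar>\<sigma>\<bar>)" 0])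
      (use norm_residual_coeff[OF s] e in auto)
qed

text \<open>The truncated subtraction is intended: the derivatives up to order \<^term>\<open>n\<close> are bounded, and each
  further one costs a factor \<^term>\<open>\<kappa>\<close>.\<close>

definition amplitude :: "nat \<Rightarrow> nat \<Rightarrow> (real \<Rightarrow> real \<Rightarrow> complex) \<Rightarrow> bool" where
  "amplitude n N f \<longleftrightarrow> Sob_ord (\<lambda>p. int (p - n)) N f"

text \<open>The number of steps is limited by \<^term>\<open>N\<close> because each one uses up a derivative of \<^term>\<open>g\<close>;
  after \<^term>\<open>min n N\<close> steps the residual is so small that multiplication by the oscillating factor
  does not leave the class.\<close>

lemma osc_parts_iterate:
  assumes g: "amplitude n N g" and s: "\<sigma> \<noteq> 0"
  shows "i \<le> min n N \<Longrightarrow> \<exists>A G. amplitude (Suc n) (Suc N) A \<and>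
    Sob_ord (\<lambda>p. max (- int i) (int p - int (min n N))) N G \<and>
    (\<forall>\<kappa>>1. der (\<lambda>s. osc \<sigma> \<kappa> s * A \<kappa> s) (\<lambda>s. osc \<sigma> \<kappa> s * (g \<kappa> s - G \<kappa> s)))"
proof (induction i)
  case 0
  \<comment> \<open>At i = 0 the floor is 0, and the maximum of 0 and p - min n N dominates the
    truncated p - n.\<close>
  have "Sob_ord (\<lambda>p. max (- int 0) (int p - int (min n N))) N g"
    by (rule Sob_ord_mono[OF g[unfolded amplitude_def]]) auto
  then show ?case using der_zero Sob_ord_zero
    by (intro exI[of _ "\<lambda>\<kappa> s. 0"] exI[of _ g]) (auto simp: amplitude_def)
next
  case (Suc i)
  then obtain A G where A: "amplitude (Suc n) (Suc N) A"
    and G: "Sob_ord (\<lambda>p. max (- int i) (int p - int (min n N))) N G"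
    and d: "\<And>\<kappa>. \<kappa> > 1 \<Longrightarrow> der (\<lambda>s. osc \<sigma> \<kappa> s * A \<kappa> s) (\<lambda>s. osc \<sigma> \<kappa> s * (g \<kappa> s - G \<kappa> s))"
    by auto
  define A' where "A' = (\<lambda>\<kappa> s. A \<kappa> s + amp \<sigma> \<kappa> (G \<kappa>) s)"
  define G' where "G' = (\<lambda>\<kappa>. residual \<sigma> \<kappa> (G \<kappa>))"
  have "Sob_ord (\<lambda>p. int (p - Suc n)) (Suc N) (\<lambda>\<kappa>. amp \<sigma> \<kappa> (G \<kappa>))"
    by (rule Sob_ord_amp[OF G s]) auto
  then have 1: "amplitude (Suc n) (Suc N) A'"
    using Sob_ord_add[OF A[unfolded amplitude_def]] by (simp add: amplitude_def A'_def)
  \<comment> \<open>Shifting p by one and subtracting one lowers the floor and reproduces the linear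
    part. At p = N the exponent is N - min n N, nonnegative and independent of i, so no gain is
    asked for there.\<close>
  have 2: "Sob_ord (\<lambda>p. max (- int (Suc i)) (int p - int (min n N))) N G'"
    unfolding G'_def by (rule Sob_ord_residual[OF s G]) (use Suc.prems in auto)
  have 3: "der (\<lambda>s. osc \<sigma> \<kappa> s * A' \<kappa> s) (\<lambda>s. osc \<sigma> \<kappa> s * (g \<kappa> s - G' \<kappa> s))" if k: "\<kappa> > 1" for \<kappa>
    by (rule der_cong[OF der_add[OF d[OF k] der_osc_amp[OF k L2_ord_sq[OF Sob_ord_L2_ord[OF G] k] s]]])
      (auto simp: A'_def G'_def algebra_simps)
  from 1 2 3 show ?case by blast
qed

text \<open>\<open>B\<close> is what remains of the primitive after the oscillating boundary terms,
  and its derivative osc * G + b has only terms in class n. For a bounded function it suffices that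
  the derivative lies in class n to be in class n + 1. This settles also the case \<sigma> = 0,
  where the phase is constant.\<close>

lemma osc_primitive_split:
  assumes F: "L2_ord 0 F" and g: "amplitude n N g" and b: "amplitude n N b"
    and d: "\<And>\<kappa>. \<kappa> > 1 \<Longrightarrow> der (F \<kappa>) (\<lambda>s. osc \<sigma> \<kappa> s * g \<kappa> s + b \<kappa> s)"
  shows "\<exists>A B. amplitude (Suc n) (Suc N) A \<and> amplitude (Suc n) (Suc N) B \<and>
    (\<forall>\<kappa>>1. \<forall>s. F \<kappa> s = B \<kappa> s + osc \<sigma> \<kappa> s * A \<kappa> s)"
proof (cases "\<sigma> = 0")
  case True
  have "Sob_ord (\<lambda>p. int (p - n)) N (\<lambda>\<kappa> s. g \<kappa> s + b \<kappa> s)"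
    using Sob_ord_add g b by (simp add: amplitude_def)
  then have "amplitude (Suc n) (Suc N) F"
    unfolding amplitude_def by (intro Sob_ord_SucI[of _ _ "\<lambda>\<kappa> s. g \<kappa> s + b \<kappa> s"]) (use F d True in \<open>auto simp: osc_def\<close>)
  then show ?thesis
    using Sob_ord_zero by (intro exI[of _ "\<lambda>\<kappa> s. 0"] exI[of _ F]) (auto simp: amplitude_def)
next
  case False
  define q where "q = min n N"
  from osc_parts_iterate[OF g False order_refl]
  obtain A G where A: "amplitude (Suc n) (Suc N) A"
    and G0: "Sob_ord (\<lambda>p. max (- int q) (int p - int q)) N G"
    and dA: "\<And>\<kappa>. \<kappa> > 1 \<Longrightarrow> der (\<lambda>s. osc \<sigma> \<kappa> s * A \<kappa> s) (\<lambda>s. osc \<sigma> \<kappa> s * (g \<kappa> s - G \<kappa> s))"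
    unfolding q_def by auto
  \<comment> \<open>After all q steps the floor -q has met the line p - q, so the exponents grow by
    exactly one per derivative, which is what \<open>Sob_ord_osc\<close> requires.\<close>
  have G: "Sob_ord (\<lambda>p. int p - int q) N G" by (rule Sob_ord_mono[OF G0]) auto
  have "Sob_ord (\<lambda>p. int p - int q) N (\<lambda>\<kappa> s. osc \<sigma> \<kappa> s * G \<kappa> s)"
    by (rule Sob_ord_osc[OF G]) auto
  then have oG: "Sob_ord (\<lambda>p. int (p - n)) N (\<lambda>\<kappa> s. osc \<sigma> \<kappa> s * G \<kappa> s)"
    by (rule Sob_ord_mono) (auto simp: q_def)
  define B where "B = (\<lambda>\<kappa> s. F \<kappa> s - osc \<sigma> \<kappa> s * A \<kappa> s)"
  have A0: "L2_ord 0 A" using Sob_ord_L2_ord[OF A[unfolded amplitude_def]] by simp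
  have "L2_ord 0 (\<lambda>\<kappa> s. F \<kappa> s + (-1) * (osc \<sigma> \<kappa> s * A \<kappa> s))"
    by (rule L2_ord_add[OF F L2_ord_cmult[OF L2_ord_osc[OF A0], of "\<lambda>_. -1" 1 0]]) auto
  then have B0: "L2_ord 0 B" by (simp add: B_def)
  have dB: "der (B \<kappa>) (\<lambda>s. osc \<sigma> \<kappa> s * G \<kappa> s + b \<kappa> s)" if k: "\<kappa> > 1" for \<kappa>
    unfolding B_def by (rule der_cong[OF der_diff[OF d[OF k] dA[OF k]]]) (auto simp: algebra_simps)
  have "amplitude (Suc n) (Suc N) B"
    unfolding amplitude_def
    by (rule Sob_ord_SucI[OF _ dB]) (use B0 Sob_ord_add[OF oG b[unfolded amplitude_def]] in auto)
  moreover have "F \<kappa> s = B \<kappa> s + osc \<sigma> \<kappa> s * A \<kappa> s" for \<kappa> s by (simp add: B_def)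
  ultimately show ?thesis using A by blast
qed

lemma amplitude_mono: "amplitude n N f \<Longrightarrow> M \<le> N \<Longrightarrow> n' \<le> n \<Longrightarrow> amplitude n' M f"
  unfolding amplitude_def by (erule Sob_ord_mono) auto

lemma amplitude_add: "amplitude n N f \<Longrightarrow> amplitude n N g \<Longrightarrow> amplitude n N (\<lambda>\<kappa> s. f \<kappa> s + g \<kappa> s)"
  unfolding amplitude_def by (rule Sob_ord_add)

lemma amplitude_smooth_mult: "Cdiff N a \<Longrightarrow> amplitude n N f \<Longrightarrow> amplitude n N (\<lambda>\<kappa> s. a (cl s) * f \<kappa> s)"
  unfolding amplitude_def by (rule Sob_ord_smooth_mult) auto

text \<open>\<open>F a\<close> stands for the Volterra integral whose kernel is the a-th
  s-derivative. Going down from a = m, every integration recovers one derivative, so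
  \<open>F (m - j)\<close> is split with j derivatives; at j = m this is the original integral with
  all m.\<close>

lemma osc_hierarchy_split:
  assumes F: "\<And>a. a \<le> m \<Longrightarrow> L2_ord 0 (F a)" and u: "amplitude n m u"
    and D: "\<And>a. a < m \<Longrightarrow> Cdiff (m - Suc a) (d a)"
    and der: "\<And>a \<kappa>. a < m \<Longrightarrow> \<kappa> > 1 \<Longrightarrow>
      der (F a \<kappa>) (\<lambda>s. osc \<sigma> \<kappa> s * (d a (cl s) * u \<kappa> s) + F (Suc a) \<kappa> s)"
  shows "j \<le> m \<Longrightarrow> \<exists>A B. amplitude (Suc n) j A \<and> amplitude (Suc n) j B \<and>
    (\<forall>\<kappa>>1. \<forall>s. F (m - j) \<kappa> s = B \<kappa> s + osc \<sigma> \<kappa> s * A \<kappa> s)"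
proof (induction j)
  case 0
  \<comment> \<open>At order m the kernel has no derivative left; boundedness in L2 is all that a
    class with zero derivatives asks.\<close>
  have "amplitude (Suc n) 0 (F m)" using F[of m] by (simp add: amplitude_def)
  then show ?case using Sob_ord_zero
    by (intro exI[of _ "\<lambda>\<kappa> s. 0"] exI[of _ "F m"]) (auto simp: amplitude_def)
next
  case (Suc j)
  then obtain A B where AB: "amplitude (Suc n) j A" "amplitude (Suc n) j B"
    "\<And>\<kappa> s. \<kappa> > 1 \<Longrightarrow> F (m - j) \<kappa> s = B \<kappa> s + osc \<sigma> \<kappa> s * A \<kappa> s" by auto
  define a where "a = m - Suc j"
  have a: "a < m" "Suc a = m - j" "m - Suc a = j" using Suc.prems by (auto simp: a_def)
  \<comment> \<open>The pieces found one level above are weakened to class n to be added to the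
    diagonal term; the integration then raises the sum to class n + 1.\<close>
  have g: "amplitude n j (\<lambda>\<kappa> s. d a (cl s) * u \<kappa> s + A \<kappa> s)"
  proof (rule amplitude_add)
    show "amplitude n j (\<lambda>\<kappa> s. d a (cl s) * u \<kappa> s)"
      by (rule amplitude_smooth_mult) (use D[OF a(1)] a(3) amplitude_mono[OF u] Suc.prems in auto)
    show "amplitude n j A" by (rule amplitude_mono[OF AB(1)]) auto
  qed
  have b: "amplitude n j B" by (rule amplitude_mono[OF AB(2)]) auto
  show ?case
    unfolding a_def[symmetric]
  proof (rule osc_primitive_split[OF F g b])
    show "der (F a \<kappa>) (\<lambda>s. osc \<sigma> \<kappa> s * (d a (cl s) * u \<kappa> s + A \<kappa> s) + B \<kappa> s)" if k: "\<kappa> > 1" for \<kappa>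
      by (rule der_cong[OF der[OF a(1) k]]) (auto simp: a(2) AB(3)[OF k] algebra_simps)
  qed (use a in auto)
qed

section \<open>The kernel\<close>

lemma II_nontrivial: "s \<in> II \<Longrightarrow> at s within II \<noteq> bot"
  unfolding II_def by (auto simp: trivial_limit_within intro!: islimpt_closure_open[where s="{-1 <..< 1}"])

lemma convex_II: "convex II" by (simp add: II_def)

text \<open>\<^const>\<open>Cm\<close> provides derivatives in \<open>t\<close> only for \<open>a = 0\<close>; the others follow by differentiating
  \<open>D a b s t = D a b s (-1) + \<integral> D a (b + 1) s\<close> in \<open>s\<close> under the integral.\<close>

lemma Cm_mixed:
  fixes D :: "nat \<Rightarrow> nat \<Rightarrow> real \<Rightarrow> real \<Rightarrow> complex"
  assumes t: "\<And>b s t. b < m \<Longrightarrow> s \<in> II \<Longrightarrow> t \<in> II \<Longrightarrow>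
        ((\<lambda>t'. D 0 b s t') has_vector_derivative D 0 (Suc b) s t) (at t within II)"
    and s: "\<And>a b s t. a < m \<Longrightarrow> b \<le> m \<Longrightarrow> s \<in> II \<Longrightarrow> t \<in> II \<Longrightarrow>
        ((\<lambda>s'. D a b s' t) has_vector_derivative D (Suc a) b s t) (at s within II)"
    and c: "\<And>a b. a \<le> m \<Longrightarrow> b \<le> m \<Longrightarrow> continuous_on (II \<times> II) (\<lambda>(s,t). D a b s t)"
  shows "a \<le> m \<Longrightarrow> b < m \<Longrightarrow> s \<in> II \<Longrightarrow> t \<in> II \<Longrightarrow>
        ((\<lambda>t'. D a b s t') has_vector_derivative D a (Suc b) s t) (at t within II)"
proof (induction a arbitrary: s t)
  case 0
  then show ?case using t by simp
next
  case (Suc a)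
  have ct: "continuous_on II (\<lambda>t. D a' b' x t)" if "a' \<le> m" "b' \<le> m" "x \<in> II" for a' b' x
  proof -
    have "continuous_on II (\<lambda>t. (x, t))" by (intro continuous_on_Pair continuous_on_const continuous_on_id)
    from continuous_on_compose2[OF c[OF that(1,2)] this] that(3) show ?thesis by auto
  qed
  have ct': "continuous_on {-1..t} (\<lambda>t. D a' b' x t)" if "a' \<le> m" "b' \<le> m" "x \<in> II" "t \<in> II" for a' b' x t
    by (rule continuous_on_subset[OF ct[OF that(1-3)]]) (use that(4) in \<open>auto simp: II_def\<close>)
  have eq: "D a b x t = D a b x (-1) + integral {-1..t} (\<lambda>\<tau>. D a (Suc b) x \<tau>)" if "x \<in> II" "t \<in> II" for x t
  proof -
    have "der (\<lambda>t'. D a b x t') (\<lambda>t'. D a (Suc b) x t')"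
      by (rule der_FTC) (use Suc that in auto)
    from derD[OF this, of "-1" t] that show ?thesis by (auto simp: II_def integral_unique)
  qed
  have eqS: "D (Suc a) b s t = D (Suc a) b s (-1) + integral {-1..t} (\<lambda>\<tau>. D (Suc a) (Suc b) s \<tau>)"
    if st: "s \<in> II" "t \<in> II" for s t
  proof -
    have "((\<lambda>x. integral (cbox (-1) t) (\<lambda>\<tau>. D a (Suc b) x \<tau>)) has_vector_derivative
        integral (cbox (-1) t) (\<lambda>\<tau>. D (Suc a) (Suc b) s \<tau>)) (at s within II)"
    proof (rule leibniz_rule_vector_derivative)
      show "((\<lambda>x. D a (Suc b) x \<tau>) has_vector_derivative D (Suc a) (Suc b) x \<tau>) (at x within II)"
        if "x \<in> II" "\<tau> \<in> cbox (-1) t" for x \<tau>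
        by (rule s) (use that st Suc.prems in \<open>auto simp: II_def\<close>)
      show "(\<lambda>\<tau>. D a (Suc b) x \<tau>) integrable_on cbox (-1) t" if "x \<in> II" for x
        using integrable_continuous_real[OF ct'[of a "Suc b" x t]] Suc.prems that st by simp
      show "continuous_on (II \<times> cbox (-1) t) (\<lambda>(x, \<tau>). D (Suc a) (Suc b) x \<tau>)"
        by (rule continuous_on_subset[OF c]) (use Suc.prems st in \<open>auto simp: II_def\<close>)
    qed (use st convex_II in auto)
    then have "((\<lambda>x. D a b x (-1) + integral {-1..t} (\<lambda>\<tau>. D a (Suc b) x \<tau>)) has_vector_derivative
        D (Suc a) b s (-1) + integral {-1..t} (\<lambda>\<tau>. D (Suc a) (Suc b) s \<tau>)) (at s within II)"
      by (intro has_vector_derivative_add s) (use st Suc.prems in \<open>auto simp: II_def\<close>)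
    then have "((\<lambda>x. D a b x t) has_vector_derivative
        D (Suc a) b s (-1) + integral {-1..t} (\<lambda>\<tau>. D (Suc a) (Suc b) s \<tau>)) (at s within II)"
      by (rule has_vector_derivative_transform[rotated 2]) (use st eq in auto)
    moreover have "((\<lambda>x. D a b x t) has_vector_derivative D (Suc a) b s t) (at s within II)"
      by (rule s) (use st Suc.prems in auto)
    ultimately show ?thesis
      using vector_derivative_unique_within[OF II_nontrivial[OF st(1)]] by blast
  qed
  have "((\<lambda>t. integral {-1..t} (\<lambda>\<tau>. D (Suc a) (Suc b) s \<tau>)) has_vector_derivative D (Suc a) (Suc b) s t) (at t within II)"
    using integral_has_vector_derivative[of "-1" 1 "\<lambda>\<tau>. D (Suc a) (Suc b) s \<tau>" t] ct[of "Suc a" "Suc b" s] Suc.prems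
    by (auto simp: II_def)
  then have "((\<lambda>t. D (Suc a) b s (-1) + integral {-1..t} (\<lambda>\<tau>. D (Suc a) (Suc b) s \<tau>)) has_vector_derivative 0 + D (Suc a) (Suc b) s t) (at t within II)"
    by (intro has_vector_derivative_add has_vector_derivative_const)
  then have "((\<lambda>t. D (Suc a) b s (-1) + integral {-1..t} (\<lambda>\<tau>. D (Suc a) (Suc b) s \<tau>)) has_vector_derivative D (Suc a) (Suc b) s t) (at t within II)"
    by simp
  then show ?case
    by (rule has_vector_derivative_transform[rotated 2]) (use eqS Suc.prems in auto)
qed

lemma Cdiff_add: "Cdiff N a \<Longrightarrow> Cdiff N b \<Longrightarrow> Cdiff N (\<lambda>x. a x + b x)"
proof (induction N arbitrary: a b)
  case 0
  then show ?case by (auto intro: continuous_intros)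
next
  case (Suc N)
  then obtain a' b' where "\<forall>x\<in>II. (a has_vector_derivative a' x) (at x within II)" "Cdiff N a'"
    "\<forall>x\<in>II. (b has_vector_derivative b' x) (at x within II)" "Cdiff N b'" by auto
  then show ?case using Suc.IH[of a' b']
    by (auto intro!: exI[of _ "\<lambda>x. a' x + b' x"] has_vector_derivative_add)
qed

lemma Cdiff_cmult: "Cdiff N a \<Longrightarrow> Cdiff N (\<lambda>x. c * a x)"
proof (induction N arbitrary: a)
  case 0
  then show ?case by (auto intro: continuous_intros)
next
  case (Suc N)
  then obtain a' where "\<forall>x\<in>II. (a has_vector_derivative a' x) (at x within II)" "Cdiff N a'" by auto
  then show ?case using Suc.IH[of a']
    by (auto intro!: exI[of _ "\<lambda>x. c * a' x"] has_vector_derivative_mult_right)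
qed

text \<open>The partial derivatives, with \<open>ft\<close> continuous, combine to a total
  derivative relative to the closed square, corners included; the chain rule along s \<mapsto> (s,
  s) then adds the two.\<close>

lemma diagonal_derivative:
  fixes f :: "real \<Rightarrow> real \<Rightarrow> complex"
  assumes "\<And>s t. s \<in> II \<Longrightarrow> t \<in> II \<Longrightarrow> ((\<lambda>s. f s t) has_vector_derivative fs s t) (at s within II)"
    and "\<And>s t. s \<in> II \<Longrightarrow> t \<in> II \<Longrightarrow> ((\<lambda>t. f s t) has_vector_derivative ft s t) (at t within II)"
    and c: "continuous_on (II \<times> II) (\<lambda>(s,t). ft s t)" and s: "s \<in> II"
  shows "((\<lambda>s. f s s) has_vector_derivative fs s s + ft s s) (at s within II)"
proof -
  have c': "continuous_on (II \<times> II) (\<lambda>z. blinfun_scaleR_left (ft (fst z) (snd z)))"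
    using c by (auto simp: split_beta intro!: continuous_intros bounded_linear.continuous_on[OF bounded_linear_blinfun_scaleR_left])
  have 1: "((\<lambda>(x, y). f x y) has_derivative (\<lambda>(tx, ty). tx *\<^sub>R fs s s + blinfun_apply (blinfun_scaleR_left (ft s s)) ty)) (at (s, s) within II \<times> II)"
  proof (rule has_derivative_partialsI[where fy = "\<lambda>x y. blinfun_scaleR_left (ft x y)"])
    show "((\<lambda>x. f x s) has_derivative (\<lambda>h. h *\<^sub>R fs s s)) (at s within II)"
      using assms(1)[OF s s] by (simp add: has_vector_derivative_def)
    show "(f x has_derivative blinfun_apply (blinfun_scaleR_left (ft x y))) (at y within II)" if "x \<in> II" "y \<in> II" for x y
      using assms(2)[OF that] by (simp add: has_vector_derivative_def)
    show "continuous (at (s, s) within II \<times> II) (\<lambda>(x, y). blinfun_scaleR_left (ft x y))"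
      using c' s unfolding continuous_on_eq_continuous_within case_prod_unfold by blast
  qed (use s convex_II in auto)
  have 2: "((\<lambda>x. (x, x)) has_derivative (\<lambda>h. (h, h))) (at s within II)"
    by (intro derivative_intros)
  have "((\<lambda>x. (\<lambda>(x, y). f x y) (x, x)) has_derivative (\<lambda>h. (\<lambda>(tx, ty). tx *\<^sub>R fs s s + blinfun_apply (blinfun_scaleR_left (ft s s)) ty) (h, h))) (at s within II)"
    by (rule has_derivative_in_compose[OF 2 has_derivative_subset[OF 1]]) auto
  then show ?thesis by (simp add: has_vector_derivative_def scaleR_add_right)
qed

text \<open>Fixes one family of derivatives witnessing \<open>Cm\<close>, so that individual
  derivatives of the kernel can be named.\<close>

locale smooth_kernel =
  fixes m :: nat and D :: "nat \<Rightarrow> nat \<Rightarrow> real \<Rightarrow> real \<Rightarrow> complex"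
  assumes dt: "\<And>b s t. b < m \<Longrightarrow> s \<in> II \<Longrightarrow> t \<in> II \<Longrightarrow>
        ((\<lambda>t'. D 0 b s t') has_vector_derivative D 0 (Suc b) s t) (at t within II)"
    and ds: "\<And>a b s t. a < m \<Longrightarrow> b \<le> m \<Longrightarrow> s \<in> II \<Longrightarrow> t \<in> II \<Longrightarrow>
        ((\<lambda>s'. D a b s' t) has_vector_derivative D (Suc a) b s t) (at s within II)"
    and cont: "\<And>a b. a \<le> m \<Longrightarrow> b \<le> m \<Longrightarrow> continuous_on (II \<times> II) (\<lambda>(s,t). D a b s t)"
begin

lemma dt_mixed: "a \<le> m \<Longrightarrow> b < m \<Longrightarrow> s \<in> II \<Longrightarrow> t \<in> II \<Longrightarrow>
        ((\<lambda>t'. D a b s t') has_vector_derivative D a (Suc b) s t) (at t within II)"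
  by (rule Cm_mixed[where D = D and m = m]) (use dt ds cont in auto)

text \<open>Each differentiation along the diagonal raises one of the two indices by one, so it can
  be repeated N times as long as both indices stay at most m.\<close>

lemma diagonal_smooth: "a + N \<le> m \<Longrightarrow> b + N \<le> m \<Longrightarrow> Cdiff N (\<lambda>s. D a b s s)"
proof (induction N arbitrary: a b)
  case 0
  have "continuous_on II (\<lambda>s. (\<lambda>(s,t). D a b s t) (s, s))"
    by (rule continuous_on_compose2[OF cont]) (use 0 in \<open>auto intro!: continuous_intros\<close>)
  then show ?case by simp
next
  case (Suc N)
  have "Cdiff N (\<lambda>s. D (Suc a) b s s + D a (Suc b) s s)"
    by (intro Cdiff_add Suc.IH) (use Suc.prems in auto)
  moreover have "((\<lambda>s. D a b s s) has_vector_derivative D (Suc a) b s s + D a (Suc b) s s) (at s within II)"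
    if "s \<in> II" for s
    by (rule diagonal_derivative[where fs = "D (Suc a) b" and ft = "D a (Suc b)"])
      (use Suc.prems that ds dt_mixed cont in auto)
  ultimately show ?case unfolding Cdiff.simps by (intro exI conjI ballI)
qed

definition k :: "nat \<Rightarrow> real \<Rightarrow> real \<Rightarrow> complex" where "k a s t = D a 0 (cl s) (cl t)"

lemma k_meas: "a \<le> m \<Longrightarrow> pair_borel (k a)"
proof (rule continuous_pair_meas)
  assume "a \<le> m"
  then have "continuous_on UNIV (\<lambda>z. (\<lambda>(s,t). D a 0 s t) (cl (fst z), cl (snd z)))"
    by (intro continuous_on_compose2[OF cont]) (auto intro!: continuous_intros)
  then show "continuous_on UNIV (\<lambda>(s, t). k a s t)" by (simp add: k_def split_beta)
qed

lemma k_bounded: "\<exists>C. \<forall>a\<le>m. \<forall>s t. cmod (k a s t) \<le> C"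
proof -
  have "\<exists>C. \<forall>s t. cmod (k a s t) \<le> C" if "a \<le> m" for a
  proof -
    have "compact ((\<lambda>(s,t). D a 0 s t) ` (II \<times> II))"
      by (rule compact_continuous_image[OF cont]) (use that in \<open>auto simp: II_def intro!: compact_Times\<close>)
    then have "bounded ((\<lambda>(s,t). D a 0 s t) ` (II \<times> II))" by (rule compact_imp_bounded)
    then obtain C where C: "\<forall>x \<in> (\<lambda>(s,t). D a 0 s t) ` (II \<times> II). cmod x \<le> C" unfolding bounded_iff ..
    have "cmod (k a s t) \<le> C" for s t
    proof -
      have "k a s t \<in> (\<lambda>(s,t). D a 0 s t) ` (II \<times> II)"
        by (rule image_eqI[of _ _ "(cl s, cl t)"]) (auto simp: k_def)
      with C show ?thesis by blast
    qed
    then show ?thesis by blast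
  qed
  then obtain C where C: "\<And>a s t. a \<le> m \<Longrightarrow> cmod (k a s t) \<le> C a" by metis
  have "cmod (k a s t) \<le> Max (C ` {..m})" if "a \<le> m" for a s t
  proof -
    have "C a \<le> Max (C ` {..m})" by (rule Max_ge) (use that in auto)
    with C[OF that, of s t] show ?thesis by (rule order_trans)
  qed
  then show ?thesis by (intro exI allI impI)
qed

lemma k_der: "a < m \<Longrightarrow> t \<in> II \<Longrightarrow> der (\<lambda>s. k a s t) (\<lambda>s. k (Suc a) s t)"
  by (rule der_cong[OF der_FTC[of "\<lambda>s. D a 0 s t" "\<lambda>s. D (Suc a) 0 s t"]]) (auto simp: k_def ds)

definition full :: "nat \<Rightarrow> (real \<Rightarrow> complex) \<Rightarrow> real \<Rightarrow> complex" where
  "full a v s = (LBINT t:II. k a s t * v t)"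

text \<open>This is the integral over t > s. Written as a difference it inherits everything from the
  other triangle, and the boundary term appears with the opposite sign.\<close>

definition up :: "nat \<Rightarrow> (real \<Rightarrow> complex) \<Rightarrow> real \<Rightarrow> complex" where
  "up a v s = full a v s - low (k a) v s"

lemma L2_ord_low: assumes "a \<le> m" "L2_ord 0 v" shows "L2_ord 0 (\<lambda>\<kappa>. low (k a) (v \<kappa>))"
proof -
  obtain C where C: "\<And>s t. cmod (k a s t) \<le> C" using k_bounded assms(1) by blast
  note s = low_sq[OF k_meas[OF assms(1)] C L2_ord_sq[OF assms(2)]]
  show ?thesis
    by (rule L2_ord_transfer[OF assms(2), of _ "4 * C\<^sup>2" 0])
      (use s in \<open>auto intro: eventually_mono[OF eventually_gt1]\<close>)
qed

lemma L2_ord_up: assumes "a \<le> m" "L2_ord 0 v" shows "L2_ord 0 (\<lambda>\<kappa>. up a (v \<kappa>))"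
proof -
  obtain C where C: "\<And>s t. cmod (k a s t) \<le> C" using k_bounded assms(1) by blast
  note s = kernel_integral_sq[OF k_meas[OF assms(1)] C L2_ord_sq[OF assms(2)]]
  have "L2_ord 0 (\<lambda>\<kappa>. full a (v \<kappa>))"
    unfolding full_def[abs_def]
    by (rule L2_ord_transfer[OF assms(2), of _ "4 * C\<^sup>2" 0])
      (use s in \<open>auto intro: eventually_mono[OF eventually_gt1]\<close>)
  from L2_ord_add[OF this L2_ord_cmult[OF L2_ord_low[OF assms], of "\<lambda>_. -1" 1 0]]
  show ?thesis by (simp add: up_def[abs_def])
qed

text \<open>The factor 1 gives the shape that \<open>volterra_split\<close> expects;
  \<open>der_up\<close> has -1 in its place.\<close>

lemma der_low_k: "a < m \<Longrightarrow> sq_int v \<Longrightarrow> der (low (k a) v) (\<lambda>s. 1 * D a 0 (cl s) (cl s) * v s + low (k (Suc a)) v s)"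
proof -
  assume a: "a < m" and v: "sq_int v"
  obtain C where C: "\<And>a s t. a \<le> m \<Longrightarrow> cmod (k a s t) \<le> C" using k_bounded by blast
  have "der (low (k a) v) (\<lambda>s. k a s s * v s + low (k (Suc a)) v s)"
    by (rule der_low[OF k_meas C k_meas C k_der v]) (use a in auto)
  moreover have "k a s s = D a 0 (cl s) (cl s)" for s by (simp add: k_def)
  ultimately show ?thesis by simp
qed

lemma der_up: "a < m \<Longrightarrow> sq_int v \<Longrightarrow> der (up a v) (\<lambda>s. (-1) * D a 0 (cl s) (cl s) * v s + up (Suc a) v s)"
proof -
  assume a: "a < m" and v: "sq_int v"
  obtain C where C: "\<And>a s t. a \<le> m \<Longrightarrow> cmod (k a s t) \<le> C" using k_bounded by blast
  have "der (full a v) (full (Suc a) v)"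
    unfolding full_def[abs_def]
    by (rule der_kernel_integral[OF k_meas C k_meas C k_der v]) (use a in auto)
  from der_cong[OF der_diff[OF this der_low_k[OF a v]]] show ?thesis
    by (simp add: up_def)
qed

text \<open>An abstract \<open>T\<close> lets one argument serve both triangles; they differ only in
  the sign \<open>c\<close> of the diagonal term.\<close>

lemma volterra_split:
  assumes u: "amplitude n m u" and TB: "\<And>a v. a \<le> m \<Longrightarrow> L2_ord 0 v \<Longrightarrow> L2_ord 0 (\<lambda>\<kappa>. T a (v \<kappa>))"
    and Td: "\<And>a v. a < m \<Longrightarrow> sq_int v \<Longrightarrow>
      der (T a v) (\<lambda>s. c * D a 0 (cl s) (cl s) * v s + T (Suc a) v s)"
  shows "\<exists>A B. amplitude (Suc n) m A \<and> amplitude (Suc n) m B \<and>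
    (\<forall>\<kappa>>1. \<forall>s. T 0 (\<lambda>t. osc \<sigma> \<kappa> t * u \<kappa> t) s = B \<kappa> s + osc \<sigma> \<kappa> s * A \<kappa> s)"
proof -
  define F where "F = (\<lambda>a \<kappa>. T a (\<lambda>t. osc \<sigma> \<kappa> t * u \<kappa> t))"
  have B: "L2_ord 0 (\<lambda>\<kappa> t. osc \<sigma> \<kappa> t * u \<kappa> t)"
    using L2_ord_osc Sob_ord_L2_ord[OF u[unfolded amplitude_def]] by simp
  have "\<exists>A B. amplitude (Suc n) m A \<and> amplitude (Suc n) m B \<and>
    (\<forall>\<kappa>>1. \<forall>s. F (m - m) \<kappa> s = B \<kappa> s + osc \<sigma> \<kappa> s * A \<kappa> s)"
  proof (rule osc_hierarchy_split[OF _ u, where d = "\<lambda>a s. c * D a 0 s s"])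
    show "L2_ord 0 (F a)" if "a \<le> m" for a unfolding F_def by (rule TB[OF that B])
    show "Cdiff (m - Suc a) (\<lambda>s. c * D a 0 s s)" if "a < m" for a
      by (intro Cdiff_cmult diagonal_smooth) (use that in auto)
    show "der (F a \<kappa>) (\<lambda>s. osc \<sigma> \<kappa> s * (c * D a 0 (cl s) (cl s) * u \<kappa> s) + F (Suc a) \<kappa> s)"
      if "a < m" "\<kappa> > 1" for a \<kappa>
      unfolding F_def by (rule der_cong[OF Td[OF that(1) L2_ord_sq[OF B that(2)]]]) auto
  qed simp
  then show ?thesis by (simp add: F_def)
qed

end

section \<open>Sums of three phases and the action of the operator on them\<close>

lemma osc_mult: "osc \<sigma> \<kappa> s * osc \<tau> \<kappa> s = osc (\<sigma> + \<tau>) \<kappa> s"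
  by (simp add: osc_def cis_mult algebra_simps)

lemma osc_0 [simp]: "osc 0 \<kappa> s = 1" by (simp add: osc_def)

definition oscillatory :: "nat \<Rightarrow> nat \<Rightarrow> (real \<Rightarrow> real \<Rightarrow> complex) \<Rightarrow> bool" where
  "oscillatory n m w \<longleftrightarrow> (\<exists>u0 u1 u2. amplitude n m u0 \<and> amplitude n m u1 \<and> amplitude n m u2 \<and>
     (\<forall>\<kappa>>1. \<forall>t\<in>II. w \<kappa> t = u0 \<kappa> t + osc 1 \<kappa> t * u1 \<kappa> t + osc (-1) \<kappa> t * u2 \<kappa> t))"

lemma oscillatory_add:
  assumes "oscillatory n m w" "oscillatory n m w'" shows "oscillatory n m (\<lambda>\<kappa> s. w \<kappa> s + w' \<kappa> s)"
proof -
  obtain u0 u1 u2 where u: "amplitude n m u0" "amplitude n m u1" "amplitude n m u2"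
     "\<And>\<kappa> t. \<kappa> > 1 \<Longrightarrow> t \<in> II \<Longrightarrow> w \<kappa> t = u0 \<kappa> t + osc 1 \<kappa> t * u1 \<kappa> t + osc (-1) \<kappa> t * u2 \<kappa> t"
    using assms(1) unfolding oscillatory_def by blast
  obtain v0 v1 v2 where v: "amplitude n m v0" "amplitude n m v1" "amplitude n m v2"
     "\<And>\<kappa> t. \<kappa> > 1 \<Longrightarrow> t \<in> II \<Longrightarrow> w' \<kappa> t = v0 \<kappa> t + osc 1 \<kappa> t * v1 \<kappa> t + osc (-1) \<kappa> t * v2 \<kappa> t"
    using assms(2) unfolding oscillatory_def by blast
  show ?thesis
    unfolding oscillatory_def
    by (rule exI[of _ "\<lambda>\<kappa> s. u0 \<kappa> s + v0 \<kappa> s"], rule exI[of _ "\<lambda>\<kappa> s. u1 \<kappa> s + v1 \<kappa> s"], rule exI[of _ "\<lambda>\<kappa> s. u2 \<kappa> s + v2 \<kappa> s"])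
      (use u v amplitude_add in \<open>auto simp: algebra_simps\<close>)
qed

lemma oscillatory_osc:
  assumes "amplitude n m u" "\<sigma> \<in> {0, 1, -1}" shows "oscillatory n m (\<lambda>\<kappa> s. osc \<sigma> \<kappa> s * u \<kappa> s)"
proof -
  have z: "amplitude n m (\<lambda>\<kappa> s. 0)" unfolding amplitude_def by (rule Sob_ord_zero)
  consider "\<sigma> = 0" | "\<sigma> = 1" | "\<sigma> = -1" using assms(2) by blast
  then show ?thesis
  proof cases
    case 1 then show ?thesis unfolding oscillatory_def using assms(1) z
      by (intro exI[of _ u] exI[of _ "\<lambda>\<kappa> s. 0"]) auto
  next
    case 2 then show ?thesis unfolding oscillatory_def using assms(1) z
      by (intro exI[of _ "\<lambda>\<kappa> s. 0"] exI[of _ u] exI[of _ "\<lambda>\<kappa> s. 0"]) auto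
  next
    case 3
    show ?thesis unfolding oscillatory_def using assms(1) z 3
      by (intro exI[of _ "\<lambda>\<kappa> s. 0"] exI[of _ "\<lambda>\<kappa> s. 0"] exI[of _ u]) auto
  qed
qed

lemma oscillatory_cong: "oscillatory n m w \<Longrightarrow> (\<And>\<kappa> s. \<kappa> > 1 \<Longrightarrow> s \<in> II \<Longrightarrow> w' \<kappa> s = w \<kappa> s) \<Longrightarrow> oscillatory n m w'"
  unfolding oscillatory_def by simp

context smooth_kernel
begin

text \<open>\<open>w\<close> and \<open>v\<close> are compared on \<open>II\<close> only, because
  decompositions into phases hold only there.\<close>

lemma Kop_kernel_integral:
  assumes K: "\<forall>s\<in>II. \<forall>t\<in>II. K s t = D 0 0 s t" and v: "sq_int v" and s: "s \<in> II"
    and w: "\<And>t. t \<in> II \<Longrightarrow> w t = v t"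
  shows "Kop K \<kappa> w s = (LBINT t:II. k 0 s t * cis (\<kappa> * \<bar>s - t\<bar>) * v t)"
    and "set_integrable lborel II (\<lambda>t. k 0 s t * cis (\<kappa> * \<bar>s - t\<bar>) * v t)"
proof -
  obtain C where C: "\<And>s t. cmod (k 0 s t) \<le> C" using k_bounded by blast
  have [measurable]: "(\<lambda>t. cis (\<kappa> * \<bar>s - t\<bar>)) \<in> borel_measurable borel"
    by (intro borel_measurable_continuous_onI continuous_intros)
  have e: "exp (\<i> * of_real (\<kappa> * \<bar>s - t\<bar>)) = cis (\<kappa> * \<bar>s - t\<bar>)" for t by (simp add: cis_conv_exp)
  note [measurable] = sq_int_meas[OF v] k_meas[of 0, simplified]
  have "Kop K \<kappa> w s = integral\<^sup>L (lebesgue_on II) (\<lambda>t. k 0 s t * cis (\<kappa> * \<bar>s - t\<bar>) * v t)"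
    unfolding Kop_def e by (rule Bochner_Integration.integral_cong) (use s K w in \<open>auto simp: k_def\<close>)
  also have "\<dots> = (LBINT t:II. k 0 s t * cis (\<kappa> * \<bar>s - t\<bar>) * v t)"
    by (rule lebesgue_on_II_integral(1)) measurable
  finally show "Kop K \<kappa> w s = (LBINT t:II. k 0 s t * cis (\<kappa> * \<bar>s - t\<bar>) * v t)" .
  have m: "(\<lambda>t. k 0 s t * cis (\<kappa> * \<bar>s - t\<bar>)) \<in> borel_measurable borel" by measurable
  show "set_integrable lborel II (\<lambda>t. k 0 s t * cis (\<kappa> * \<bar>s - t\<bar>) * v t)"
    by (rule set_integrable_bounded_mult[OF m _ sq_int_meas[OF v] sq_int_integrable[OF v], of C])
      (use C in \<open>auto simp: norm_mult\<close>)
qed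

text \<open>For t \<le> s the exponential of i \<kappa> |s - t| factors as phase 1 in s times phase
  -1 in t; for t > s the signs are exchanged. This decouples s from t in the oscillation and leaves
  two Volterra integrals.\<close>

lemma Kop_eq:
  assumes K: "\<forall>s\<in>II. \<forall>t\<in>II. K s t = D 0 0 s t" and v: "sq_int v" and s: "s \<in> II"
    and w: "\<And>t. t \<in> II \<Longrightarrow> w t = v t"
  shows "Kop K \<kappa> w s = osc 1 \<kappa> s * low (k 0) (\<lambda>t. osc (-1) \<kappa> t * v t) s + osc (-1) \<kappa> s * up 0 (\<lambda>t. osc 1 \<kappa> t * v t) s"
proof -
  obtain C where C: "\<And>s t. cmod (k 0 s t) \<le> C" using k_bounded by blast
  have C0: "C \<ge> 0" using C[of 0 0] norm_ge_zero order_trans by blast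
  note [measurable] = sq_int_meas[OF v] k_meas[of 0, simplified]
  have ks[measurable]: "(\<lambda>t. k 0 s t) \<in> borel_measurable borel" by measurable
  have vo: "sq_int (\<lambda>t. osc \<sigma> \<kappa> t * v t)" for \<sigma>
  proof (rule sq_int_mult_bound(1)[OF _ v, of _ 1])
    show "(\<lambda>t. osc \<sigma> \<kappa> t * v t) \<in> borel_measurable borel" by measurable
  qed (simp add: norm_mult)
  have il: "set_integrable lborel II (\<lambda>t. (if t \<le> s then k 0 s t else 0) * (osc \<sigma> \<kappa> t * v t))" for \<sigma>
    by (rule set_integrable_bounded_mult[of _ C, OF _ _ sq_int_meas[OF vo] sq_int_integrable[OF vo]]) (use C C0 in \<open>auto, measurable\<close>)
  have if': "set_integrable lborel II (\<lambda>t. k 0 s t * (osc \<sigma> \<kappa> t * v t))" for \<sigma>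
    by (rule set_integrable_bounded_mult[of _ C, OF _ _ sq_int_meas[OF vo] sq_int_integrable[OF vo]]) (use C in auto)
  have "Kop K \<kappa> w s = (LBINT t:II. k 0 s t * cis (\<kappa> * \<bar>s - t\<bar>) * v t)"
    by (rule Kop_kernel_integral(1)[OF K v s w])
  also have "\<dots> = (LBINT t:II. osc 1 \<kappa> s * ((if t \<le> s then k 0 s t else 0) * (osc (-1) \<kappa> t * v t))
      + osc (-1) \<kappa> s * (k 0 s t * (osc 1 \<kappa> t * v t) - (if t \<le> s then k 0 s t else 0) * (osc 1 \<kappa> t * v t)))"
  proof (rule set_lebesgue_integral_cong)
    have 1: "cis (\<kappa> * \<bar>s - t\<bar>) = osc 1 \<kappa> s * osc (-1) \<kappa> t" if "t \<le> s" for t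
      using that by (simp add: osc_def cis_mult algebra_simps)
    have 2: "cis (\<kappa> * \<bar>s - t\<bar>) = osc (-1) \<kappa> s * osc 1 \<kappa> t" if "\<not> t \<le> s" for t
      using that by (simp add: osc_def cis_mult algebra_simps)
    show "\<forall>t. t \<in> II \<longrightarrow> k 0 s t * cis (\<kappa> * \<bar>s - t\<bar>) * v t = osc 1 \<kappa> s * ((if t \<le> s then k 0 s t else 0) * (osc (-1) \<kappa> t * v t))
      + osc (-1) \<kappa> s * (k 0 s t * (osc 1 \<kappa> t * v t) - (if t \<le> s then k 0 s t else 0) * (osc 1 \<kappa> t * v t))"
      using 1 2 by (auto simp: algebra_simps)
  qed simp
  also have "\<dots> = osc 1 \<kappa> s * low (k 0) (\<lambda>t. osc (-1) \<kappa> t * v t) s + osc (-1) \<kappa> s * up 0 (\<lambda>t. osc 1 \<kappa> t * v t) s"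
    unfolding up_def full_def low_def
    using il if' by (subst set_integral_add(2)) (auto intro!: set_integrable_mult_right set_integral_diff)
  finally show ?thesis .
qed

text \<open>The inner phases are \<sigma> - 1 and \<sigma> + 1. The outer factors bring the
  oscillating parts back to \<sigma> and give the other parts the phases 1 and -1, so the set {0, 1,
  -1} is stable.\<close>

lemma Kop_oscillatory_component:
  assumes K: "\<forall>s\<in>II. \<forall>t\<in>II. K s t = D 0 0 s t" and u: "amplitude n m u" and \<sigma>: "\<sigma> \<in> {0, 1, -1}"
  shows "oscillatory (Suc n) m (\<lambda>\<kappa>. Kop K \<kappa> (\<lambda>t. osc \<sigma> \<kappa> t * u \<kappa> t))"
proof -
  obtain A B where AB: "amplitude (Suc n) m A" "amplitude (Suc n) m B"
    "\<And>\<kappa> s. \<kappa> > 1 \<Longrightarrow> low (k 0) (\<lambda>t. osc (\<sigma> - 1) \<kappa> t * u \<kappa> t) s = B \<kappa> s + osc (\<sigma> - 1) \<kappa> s * A \<kappa> s"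
    using volterra_split[where T = "\<lambda>a. low (k a)", OF u L2_ord_low der_low_k, of "\<sigma> - 1"] by blast
  obtain A' B' where AB': "amplitude (Suc n) m A'" "amplitude (Suc n) m B'"
    "\<And>\<kappa> s. \<kappa> > 1 \<Longrightarrow> up 0 (\<lambda>t. osc (\<sigma> + 1) \<kappa> t * u \<kappa> t) s = B' \<kappa> s + osc (\<sigma> + 1) \<kappa> s * A' \<kappa> s"
    using volterra_split[OF u L2_ord_up der_up, of "\<sigma> + 1"] by blast
  have B: "L2_ord 0 (\<lambda>\<kappa> t. osc \<sigma> \<kappa> t * u \<kappa> t)"
    using L2_ord_osc Sob_ord_L2_ord[OF u[unfolded amplitude_def]] by simp
  have "oscillatory (Suc n) m (\<lambda>\<kappa> s. (osc 1 \<kappa> s * B \<kappa> s + osc \<sigma> \<kappa> s * A \<kappa> s) + (osc (-1) \<kappa> s * B' \<kappa> s + osc \<sigma> \<kappa> s * A' \<kappa> s))"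
    by (intro oscillatory_add oscillatory_osc AB AB' \<sigma>) auto
  then show ?thesis
  proof (rule oscillatory_cong)
    fix \<kappa> s :: real assume k: "\<kappa> > 1" and s: "s \<in> II"
    have 1: "osc (-1) \<kappa> t * (osc \<sigma> \<kappa> t * x) = osc (\<sigma> - 1) \<kappa> t * x" "osc 1 \<kappa> t * (osc \<sigma> \<kappa> t * x) = osc (\<sigma> + 1) \<kappa> t * x" for t x
      by (simp_all add: mult.assoc[symmetric] osc_mult add.commute)
    have 2: "osc 1 \<kappa> s * (osc (\<sigma> - 1) \<kappa> s * x) = osc \<sigma> \<kappa> s * x" "osc (-1) \<kappa> s * (osc (\<sigma> + 1) \<kappa> s * x) = osc \<sigma> \<kappa> s * x" for x
      by (simp_all add: mult.assoc[symmetric] osc_mult)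
    show "Kop K \<kappa> (\<lambda>t. osc \<sigma> \<kappa> t * u \<kappa> t) s = (osc 1 \<kappa> s * B \<kappa> s + osc \<sigma> \<kappa> s * A \<kappa> s) + (osc (-1) \<kappa> s * B' \<kappa> s + osc \<sigma> \<kappa> s * A' \<kappa> s)"
    proof -
      have "Kop K \<kappa> (\<lambda>t. osc \<sigma> \<kappa> t * u \<kappa> t) s
        = osc 1 \<kappa> s * low (k 0) (\<lambda>t. osc (-1) \<kappa> t * (osc \<sigma> \<kappa> t * u \<kappa> t)) s
        + osc (-1) \<kappa> s * up 0 (\<lambda>t. osc 1 \<kappa> t * (osc \<sigma> \<kappa> t * u \<kappa> t)) s"
        by (rule Kop_eq[OF K L2_ord_sq[OF B k] s]) auto
      then show ?thesis unfolding 1 AB(3)[OF k] AB'(3)[OF k] distrib_left 2 .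
    qed
  qed
qed

lemma Kop_oscillatory:
  assumes K: "\<forall>s\<in>II. \<forall>t\<in>II. K s t = D 0 0 s t" and w: "oscillatory n m w"
  shows "oscillatory (Suc n) m (\<lambda>\<kappa>. Kop K \<kappa> (w \<kappa>))"
proof -
  obtain u0 u1 u2 where u: "amplitude n m u0" "amplitude n m u1" "amplitude n m u2"
     "\<And>\<kappa> t. \<kappa> > 1 \<Longrightarrow> t \<in> II \<Longrightarrow> w \<kappa> t = u0 \<kappa> t + osc 1 \<kappa> t * u1 \<kappa> t + osc (-1) \<kappa> t * u2 \<kappa> t"
    using w unfolding oscillatory_def by blast
  define os where "os = (\<lambda>\<sigma> u \<kappa> t. osc \<sigma> \<kappa> t * u \<kappa> t)"
  have B: "L2_ord 0 (os \<sigma> u)" if "amplitude n m u" for \<sigma> u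
    using L2_ord_osc Sob_ord_L2_ord[OF that[unfolded amplitude_def]] by (simp add: os_def)
  have "oscillatory (Suc n) m (\<lambda>\<kappa> s. Kop K \<kappa> (os 0 u0 \<kappa>) s + Kop K \<kappa> (os 1 u1 \<kappa>) s + Kop K \<kappa> (os (-1) u2 \<kappa>) s)"
    unfolding os_def by (intro oscillatory_add Kop_oscillatory_component[OF K] u) auto
  then show ?thesis
  proof (rule oscillatory_cong)
    fix \<kappa> s :: real assume k: "\<kappa> > 1" and s: "s \<in> II"
    note sq = B[OF u(1), of 0, THEN L2_ord_sq, OF k] B[OF u(2), of 1, THEN L2_ord_sq, OF k] B[OF u(3), of "-1", THEN L2_ord_sq, OF k]
    note Kv = Kop_kernel_integral(1)[OF K _ s] and Ki = Kop_kernel_integral(2)[OF K _ s]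
    have w': "w \<kappa> t = os 0 u0 \<kappa> t + os 1 u1 \<kappa> t + os (-1) u2 \<kappa> t" if "t \<in> II" for t
      using u(4)[OF k that] by (simp add: os_def)
    have sw: "sq_int (\<lambda>t. os 0 u0 \<kappa> t + os 1 u1 \<kappa> t + os (-1) u2 \<kappa> t)"
      by (intro sq_int_add(1) sq)
    show "Kop K \<kappa> (w \<kappa>) s = Kop K \<kappa> (os 0 u0 \<kappa>) s + Kop K \<kappa> (os 1 u1 \<kappa>) s + Kop K \<kappa> (os (-1) u2 \<kappa>) s"
    proof -
      have "Kop K \<kappa> (w \<kappa>) s = (LBINT t:II. k 0 s t * cis (\<kappa> * \<bar>s - t\<bar>) * (os 0 u0 \<kappa> t + os 1 u1 \<kappa> t + os (-1) u2 \<kappa> t))"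
        by (rule Kv[OF sw]) (rule w')
      then show ?thesis
        unfolding Kv[OF sq(1) refl] Kv[OF sq(2) refl] Kv[OF sq(3) refl] distrib_left
        using Ki[OF sq(1) refl] Ki[OF sq(2) refl] Ki[OF sq(3) refl] by simp
    qed
  qed
qed

end

section \<open>Test functions\<close>

text \<open>Smoothness is handled through every finite order, since closure under products and
  affine maps is an induction there; \<open>diffn_all_sequence\<close> turns it into the single
  sequence of derivatives that \<open>test_fun\<close> demands.\<close>

fun diffn :: "nat \<Rightarrow> (real \<Rightarrow> real) \<Rightarrow> bool" where
  "diffn 0 g \<longleftrightarrow> True"
| "diffn (Suc n) g \<longleftrightarrow> (\<exists>g'. (\<forall>x. (g has_real_derivative g' x) (at x)) \<and> diffn n g')"

lemma diffn_SucD: "diffn (Suc n) g \<Longrightarrow> diffn n g"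
  by (induction n arbitrary: g) auto

lemma diffn_add: "diffn n f \<Longrightarrow> diffn n g \<Longrightarrow> diffn n (\<lambda>x. f x + g x)"
proof (induction n arbitrary: f g)
  case (Suc n)
  then obtain f' g' where "\<forall>x. (f has_real_derivative f' x) (at x)" "diffn n f'"
    "\<forall>x. (g has_real_derivative g' x) (at x)" "diffn n g'" by auto
  then show ?case using Suc.IH[of f' g'] by (auto intro!: exI[of _ "\<lambda>x. f' x + g' x"] DERIV_add)
qed simp

lemma diffn_mult: "diffn n f \<Longrightarrow> diffn n g \<Longrightarrow> diffn n (\<lambda>x. f x * g x)"
proof (induction n arbitrary: f g)
  case (Suc n)
  then obtain f' g' where *: "\<forall>x. (f has_real_derivative f' x) (at x)" "diffn n f'"
    "\<forall>x. (g has_real_derivative g' x) (at x)" "diffn n g'" by auto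
  have "diffn n (\<lambda>x. f' x * g x + g' x * f x)"
    by (intro diffn_add Suc.IH *(2,4) diffn_SucD[OF Suc.prems(1)] diffn_SucD[OF Suc.prems(2)])
  moreover have "((\<lambda>x. f x * g x) has_real_derivative f' x * g x + g' x * f x) (at x)" for x
    by (intro DERIV_mult) (use * in auto)
  ultimately show ?case unfolding diffn.simps by (intro exI conjI allI)
qed simp

lemma diffn_const: "diffn n (\<lambda>x. c)"
proof (induction n arbitrary: c)
  case (Suc n)
  then show ?case by (auto intro!: exI[of _ "\<lambda>x. 0"])
qed simp

lemma diffn_affine: "diffn n f \<Longrightarrow> diffn n (\<lambda>x. f (c * x + d))"
proof (induction n arbitrary: f)
  case (Suc n)
  then obtain f' where f': "\<And>x. (f has_real_derivative f' x) (at x)" "diffn n f'" by auto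
  have "((\<lambda>x. f (c * x + d)) has_real_derivative f' (c * x + d) * c) (at x)" for x
    by (rule DERIV_chain2[OF f'(1)]) (auto intro!: derivative_eq_intros)
  moreover have "diffn n (\<lambda>x. f' (c * x + d) * c)"
    by (intro diffn_mult diffn_const Suc.IH f')
  ultimately show ?case unfolding diffn.simps by (intro exI conjI allI)
qed simp

text \<open>The witnesses for different orders fit together because derivatives are unique:
  iterating \<open>deriv\<close> gives one sequence that serves all orders.\<close>

lemma diffn_all_sequence:
  assumes "\<And>n. diffn n g"
  obtains \<Phi> where "\<Phi> 0 = g" "\<And>k x. (\<Phi> k has_real_derivative \<Phi> (Suc k) x) (at x)"
proof -
  have step: "(h has_real_derivative deriv h x) (at x) \<and> diffn n (deriv h)" if "\<And>n. diffn n h" for h x n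
  proof -
    from that[of "Suc n"] obtain h' where h': "\<forall>x. (h has_real_derivative h' x) (at x)" "diffn n h'" by auto
    then have "deriv h = h'" by (auto intro: DERIV_imp_deriv)
    with h' show ?thesis by simp
  qed
  have all: "diffn n ((deriv ^^ k) g)" for n k
    by (induction k arbitrary: n) (use assms step in auto)
  show ?thesis
    by (rule that[of "\<lambda>k. (deriv ^^ k) g"]) (use step all in auto)
qed

text \<open>The functions P(1/x) e^(-1/x), extended by 0, form a family closed under
  differentiation: P is replaced by X^2 (P - P'). One induction thus yields derivatives of all
  orders, also at 0.\<close>

definition expinv :: "real poly \<Rightarrow> real \<Rightarrow> real" where
  "expinv P x = (if x > 0 then poly P (1 / x) * exp (- (1 / x)) else 0)"

lemma poly_exp_tendsto_0: "((\<lambda>y. poly P y * exp (- y)) \<longlongrightarrow> (0::real)) at_top"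
proof -
  have "((\<lambda>y. \<Sum>i\<le>degree P. coeff P i * (y ^ i / exp y)) \<longlongrightarrow> (\<Sum>i\<le>degree P. coeff P i * 0)) at_top"
    by (intro tendsto_intros tendsto_power_div_exp_0)
  then show ?thesis
    by (simp add: poly_altdef sum_distrib_right exp_minus field_simps sum_divide_distrib)
qed

lemma expinv_deriv:
  "(expinv P has_real_derivative expinv ([:0, 0, 1:] * (P - pderiv P)) x) (at x)"
proof -
  consider "x > 0" | "x < 0" | "x = 0" by linarith
  then show ?thesis
  proof cases
    case 1
    have "((\<lambda>x. poly P (1 / x) * exp (- (1 / x))) has_real_derivative
        (1 / x)\<^sup>2 * (poly P (1 / x) - poly (pderiv P) (1 / x)) * exp (- (1 / x))) (at x)"
      using 1 by (auto intro!: derivative_eq_intros poly_DERIV[THEN DERIV_chain2] simp: field_simps power2_eq_square)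
    then have "((\<lambda>x. poly P (1 / x) * exp (- (1 / x))) has_real_derivative
        expinv ([:0, 0, 1:] * (P - pderiv P)) x) (at x)"
      using 1 by (simp add: expinv_def power2_eq_square algebra_simps)
    then show ?thesis
      by (rule has_field_derivative_transform_within_open[of _ _ _ "{0<..}"]) (use 1 in \<open>auto simp: expinv_def\<close>)
  next
    case 2
    have "((\<lambda>x. 0) has_real_derivative expinv ([:0, 0, 1:] * (P - pderiv P)) x) (at x)"
      using 2 by (simp add: expinv_def)
    then show ?thesis
      by (rule has_field_derivative_transform_within_open[of _ _ _ "{..<0}"]) (use 2 in \<open>auto simp: expinv_def\<close>)
  next
    case 3
    have "((\<lambda>h. expinv P h / h) \<longlongrightarrow> 0) (at 0)"
    proof (rule filterlim_split_at)
      have "((\<lambda>h. 0) \<longlongrightarrow> (0::real)) (at_left 0)" by simp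
      then show "((\<lambda>h. expinv P h / h) \<longlongrightarrow> 0) (at_left 0)"
        by (rule Lim_transform_eventually)
          (auto simp: expinv_def eventually_at_left_field intro!: exI[of _ "-1"])
      \<comment> \<open>With y = 1 / h the division by h becomes a multiplication by y, that is, by
        the polynomial X, and exponential decay still wins.\<close>
      have "((\<lambda>h. poly (P * [:0, 1:]) (inverse h) * exp (- inverse h)) \<longlongrightarrow> (0::real)) (at_right 0)"
        by (rule filterlim_compose[OF poly_exp_tendsto_0 filterlim_inverse_at_top_right])
      then show "((\<lambda>h. expinv P h / h) \<longlongrightarrow> 0) (at_right 0)"
        by (rule Lim_transform_eventually)
          (auto simp: expinv_def eventually_at_right_field field_simps intro!: exI[of _ 1])
    qed
    then show ?thesis using 3 by (simp add: DERIV_def expinv_def)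
  qed
qed

lemma diffn_expinv: "diffn n (expinv P)"
  by (induction n arbitrary: P) (use expinv_deriv in auto)

definition ramp :: "real \<Rightarrow> real" where "ramp x = (if x > 0 then exp (- (1 / x)) else 0)"

lemma diffn_ramp: "diffn n ramp"
proof -
  have "ramp = expinv 1" by (auto simp: ramp_def expinv_def)
  then show ?thesis using diffn_expinv by metis
qed

lemma ramp_bounds: "0 \<le> ramp x" "ramp x \<le> 1"
  by (auto simp: ramp_def)

text \<open>A product of two steepened ramps, increasing to the right of a and decreasing to the
  left of b. The shifts by 1 keep the support at distance 1 / (n + 1) inside ]a, b[, so a = -1 and b
  = 1 are allowed. The arguments are written as affine maps to match
  \<open>diffn_affine\<close>.\<close>

definition bump :: "real \<Rightarrow> real \<Rightarrow> nat \<Rightarrow> real \<Rightarrow> real" where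
  "bump a b n x = ramp (real (Suc n) * x + (- real (Suc n) * a - 1)) * ramp (- real (Suc n) * x + (real (Suc n) * b - 1))"

lemma bump_bounds: "0 \<le> bump a b n x" "bump a b n x \<le> 1"
  using ramp_bounds by (auto simp: bump_def intro: mult_le_one)

lemma bump_zero: "x \<notin> {a + 1 / real (Suc n)..b - 1 / real (Suc n)} \<Longrightarrow> bump a b n x = 0"
proof -
  assume "x \<notin> {a + 1 / real (Suc n)..b - 1 / real (Suc n)}"
  then have "x < a + 1 / real (Suc n) \<or> x > b - 1 / real (Suc n)" by auto
  then have "real (Suc n) * x < real (Suc n) * (a + 1 / real (Suc n)) \<or> real (Suc n) * x > real (Suc n) * (b - 1 / real (Suc n))"
    by (metis mult_less_cancel_left_pos of_nat_0_less_iff zero_less_Suc)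
  then have "real (Suc n) * x + (- real (Suc n) * a - 1) \<le> 0 \<or> - real (Suc n) * x + (real (Suc n) * b - 1) \<le> 0"
    by (auto simp: algebra_simps)
  then show ?thesis by (auto simp: bump_def ramp_def simp del: of_nat_Suc)
qed

lemma ramp_lim: "(ramp \<longlongrightarrow> 1) at_top"
proof -
  have "((\<lambda>x::real. exp (- (1 / x))) \<longlongrightarrow> exp (- 0)) at_top"
    by (intro tendsto_intros tendsto_divide_0[OF tendsto_const] filterlim_at_top_imp_at_infinity filterlim_ident)
  then have "((\<lambda>x::real. exp (- (1 / x))) \<longlongrightarrow> 1) at_top" by simp
  then show ?thesis
    by (rule Lim_transform_eventually) (auto simp: ramp_def intro: eventually_mono[OF eventually_gt_at_top[of 0]])
qed

lemma bump_lim: "(\<lambda>n. bump a b n x) \<longlonglongrightarrow> indicator {a<..<b} x"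
proof (cases "x \<in> {a<..<b}")
  case True
  have l: "filterlim (\<lambda>n. real (Suc n) * c - 1) at_top sequentially" if "c > 0" for c
  proof -
    have "filterlim (\<lambda>n. c * real (Suc n)) at_top sequentially"
      using that filterlim_compose[OF filterlim_real_sequentially filterlim_Suc]
      by (intro filterlim_tendsto_pos_mult_at_top[OF tendsto_const]) auto
    then have "filterlim (\<lambda>n. (-1) + c * real (Suc n)) at_top sequentially"
      by (rule filterlim_tendsto_add_at_top[OF tendsto_const])
    then show ?thesis by (simp add: algebra_simps)
  qed
  have "(\<lambda>n. ramp (real (Suc n) * (x - a) - 1) * ramp (real (Suc n) * (b - x) - 1)) \<longlonglongrightarrow> 1 * 1"
    by (intro tendsto_mult filterlim_compose[OF ramp_lim l]) (use True in auto)
  then show ?thesis using True by (simp add: bump_def algebra_simps)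
next
  case False
  have "bump a b n x = 0" for n
  proof (rule bump_zero)
    define e where "e = 1 / real (Suc n)"
    have "e > 0" by (simp add: e_def)
    with False show "x \<notin> {a + 1 / real (Suc n)..b - 1 / real (Suc n)}"
      unfolding e_def[symmetric] by auto
  qed
  then show ?thesis using False by simp
qed

lemma diffn_bump: "diffn k (bump a b n)"
  unfolding bump_def[abs_def] by (intro diffn_mult diffn_affine diffn_ramp)

lemma test_fun_diffn:
  assumes "\<And>n. diffn n g" "-1 < a" "b < 1" "\<And>x. x \<notin> {a..b} \<Longrightarrow> g x = 0"
  obtains \<Phi> where "test_fun \<Phi>" "\<Phi> 0 = g"
proof -
  obtain \<Phi> where "\<Phi> 0 = g" "\<And>k x. (\<Phi> k has_real_derivative \<Phi> (Suc k) x) (at x)"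
    using diffn_all_sequence[OF assms(1)] by metis
  then show ?thesis using assms that[of \<Phi>] unfolding test_fun_def by auto
qed

lemma test_fun_bump:
  assumes "-1 \<le> a" "b \<le> 1"
  obtains \<Phi> where "test_fun \<Phi>" "\<Phi> 0 = bump a b n"
proof (rule test_fun_diffn[of "bump a b n" "a + 1 / real (Suc n)" "b - 1 / real (Suc n)"])
  have "1 / real (Suc n) > 0" by simp
  then show "-1 < a + 1 / real (Suc n)" "b - 1 / real (Suc n) < 1" using assms by linarith+
qed (use diffn_bump bump_zero that in auto)

lemma test_fun_continuous: "test_fun \<Phi> \<Longrightarrow> continuous_on S (\<Phi> k)"
  unfolding test_fun_def by (meson DERIV_isCont continuous_at_imp_continuous_on)

lemma test_fun_meas: "test_fun \<Phi> \<Longrightarrow> \<Phi> k \<in> borel_measurable borel"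
  by (rule borel_measurable_continuous_onI) (rule test_fun_continuous)

lemma test_fun_shift:
  assumes "test_fun \<Phi>" shows "test_fun (\<lambda>k. \<Phi> (Suc k))"
proof -
  from assms obtain a b where ab: "-1 < a" "b < 1" "\<And>x. x \<notin> {a..b} \<Longrightarrow> \<Phi> 0 x = 0"
    and d: "\<And>k x. (\<Phi> k has_real_derivative \<Phi> (Suc k) x) (at x)" unfolding test_fun_def by auto
  have "\<Phi> (Suc 0) x = 0" if "x \<notin> {a..b}" for x
  proof -
    have "((\<lambda>x. 0) has_real_derivative \<Phi> (Suc 0) x) (at x)"
      by (rule has_field_derivative_transform_within_open[OF d[of 0], of "- {a..b}"]) (use that ab in auto)
    then show ?thesis by (metis DERIV_const DERIV_unique)
  qed
  with ab d show ?thesis unfolding test_fun_def by auto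
qed

lemma test_fun_ends: "test_fun \<Phi> \<Longrightarrow> \<Phi> 0 1 = 0" "test_fun \<Phi> \<Longrightarrow> \<Phi> 0 (-1) = 0"
  unfolding test_fun_def by (metis atLeastAtMost_iff not_le)+

lemma test_fun_bounded:
  assumes "test_fun \<Phi>" obtains C where "\<And>x. x \<in> II \<Longrightarrow> \<bar>\<Phi> k x\<bar> \<le> C"
proof -
  have "continuous_on II (\<lambda>x. complex_of_real (\<Phi> k x))"
    by (intro continuous_intros test_fun_continuous[OF assms])
  from bounded_II[OF this] that show ?thesis by (metis norm_of_real)
qed

section \<open>The fundamental lemma and weak derivatives\<close>

text \<open>The Borel sets over which f integrates to zero include the closed intervals and are
  stable under countable disjoint unions; stability under complements is where the vanishing total
  integral enters.\<close>

lemma AE_zero_if_interval_integrals: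
  fixes f :: "real \<Rightarrow> complex"
  assumes f: "integrable lborel f" and i: "\<And>a b. a \<le> b \<Longrightarrow> (LBINT x:{a..b}. f x) = 0" and t: "integral\<^sup>L lborel f = 0"
  shows "AE x in lborel. f x = 0"
proof (rule sigma_finite_measure.density_zero[OF sigma_finite_lborel f])
  fix A :: "real set" assume "A \<in> sets lborel"
  then have "A \<in> sets borel" by simp
  have fi: "set_integrable lborel B f" if "B \<in> sets borel" for B
    unfolding set_integrable_def by (rule integrable_mult_indicator[OF _ f]) (use that in simp)
  from \<open>A \<in> sets borel\<close> show "(LBINT x:A. f x) = 0"
  proof (induction rule: borel_set_induct)
    case empty
    then show ?case by (simp add: set_lebesgue_integral_def)
  next
    case (interval a b)
    then show ?case by (rule i)
  next
    case (compl A)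
    have "(LBINT x:A \<union> -A. f x) = (LBINT x:A. f x) + (LBINT x:-A. f x)"
      by (rule set_integral_Un) (use compl fi in auto)
    then show ?case using compl t by (simp add: set_lebesgue_integral_def)
  next
    case (union A)
    have U: "(\<Union>i. A i) \<in> sets borel" using union by auto
    have "((LBINT x:\<Union> (range A). f x)) = (\<Sum>i. (LBINT x:(A i). f x))"
    proof (rule lebesgue_integral_countable_add)
      show "A i \<in> sets lborel" for i using union by simp
      show "A i \<inter> A j = {}" if "i \<noteq> j" for i j using union(1) that by (auto simp: disjoint_family_on_def)
      show "set_integrable lborel (\<Union> (range A)) f" by (rule fi[OF U])
    qed
    then show ?case using union by simp
  qed
qed

abbreviation pairing :: "(real \<Rightarrow> complex) \<Rightarrow> (real \<Rightarrow> real) \<Rightarrow> complex" where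
  "pairing v \<phi> \<equiv> (LBINT x:II. v x * of_real (\<phi> x))"

abbreviation lpairing :: "(real \<Rightarrow> complex) \<Rightarrow> (real \<Rightarrow> real) \<Rightarrow> complex" where
  "lpairing v \<phi> \<equiv> integral\<^sup>L (lebesgue_on II) (\<lambda>x. v x * of_real (\<phi> x))"

text \<open>Bumps stay between 0 and 1 and converge to the indicator of an open interval, so
  dominated convergence gives zero integrals over open subintervals of \<open>II\<close>.\<close>

lemma fundamental_lemma:
  assumes f: "sq_int f" and z: "\<And>\<Phi>. test_fun \<Phi> \<Longrightarrow> pairing f (\<Phi> 0) = 0"
  shows "AE x in lborel. x \<in> II \<longrightarrow> f x = 0"
proof -
  define g where "g = (\<lambda>x. indicator II x *\<^sub>R f x)"
  note [measurable] = sq_int_meas[OF f]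
  have gi: "integrable lborel g"
    using sq_int_integrable[OF f] by (simp add: set_integrable_def g_def)
  have gm[measurable]: "g \<in> borel_measurable borel" unfolding g_def by measurable
  have op: "(LBINT x:{a<..<b}. g x) = 0" if ab: "-1 \<le> a" "b \<le> 1" for a b
  proof -
    have z': "(\<integral>x. of_real (bump a b n x) * g x \<partial>lborel) = 0" for n
    proof -
      obtain \<Phi> where "test_fun \<Phi>" "\<Phi> 0 = bump a b n" using test_fun_bump[OF ab] by metis
      with z[of \<Phi>] show ?thesis by (simp add: set_lebesgue_integral_def g_def mult.commute)
    qed
    have "(\<lambda>n. \<integral>x. of_real (bump a b n x) * g x \<partial>lborel) \<longlonglongrightarrow> (\<integral>x. of_real (indicator {a<..<b} x) * g x \<partial>lborel)"
    proof (rule integral_dominated_convergence[where w = "\<lambda>x. norm (g x)"])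
      show "(\<lambda>x. of_real (bump a b n x) * g x) \<in> borel_measurable lborel" for n
      proof -
        obtain \<Phi> where "test_fun \<Phi>" "\<Phi> 0 = bump a b n" using test_fun_bump[OF ab] by metis
        with test_fun_meas[of \<Phi> 0] have [measurable]: "bump a b n \<in> borel_measurable borel" by simp
        show ?thesis by measurable
      qed
      show "AE x in lborel. norm (of_real (bump a b n x) * g x) \<le> norm (g x)" for n
        using bump_bounds[of a b n] by (intro AE_I2) (simp add: norm_mult mult_left_le_one_le)
      show "AE x in lborel. (\<lambda>n. of_real (bump a b n x) * g x) \<longlonglongrightarrow> of_real (indicator {a<..<b} x) * g x"
        by (intro AE_I2 tendsto_intros bump_lim)
    qed (use gi in auto)
    then have "(\<integral>x. of_real (indicator {a<..<b} x) * g x \<partial>lborel) = 0"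
      using LIMSEQ_unique[OF _ tendsto_const[of "0::complex"]] by (simp add: z')
    then show ?thesis by (simp add: set_lebesgue_integral_def scaleR_conv_of_real)
  qed
  \<comment> \<open>The extension by zero reduces an arbitrary closed interval to an open one inside
    \<open>II\<close>, up to at most four end points.\<close>
  have cl0: "(LBINT x:{a..b}. g x) = 0" if "a \<le> b" for a b
  proof -
    have "(LBINT x:{a..b}. g x) = (LBINT x:{max a (-1)<..<min b 1}. g x)"
      unfolding set_lebesgue_integral_def
    proof (rule integral_cong_AE)
      have "AE x in lborel. x \<notin> {a, b, -1, 1::real}"
        by (rule AE_not_in) (simp add: finite_imp_null_set_lborel)
      then show "AE x in lborel. indicat_real {a..b} x *\<^sub>R g x = indicat_real {max a (-1)<..<min b 1} x *\<^sub>R g x"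
        by eventually_elim (auto simp: g_def II_def indicator_def)
    qed measurable
    also have "\<dots> = 0" by (rule op) auto
    finally show ?thesis .
  qed
  have "integral\<^sup>L lborel g = (LBINT x:{-1..1}. g x)"
    unfolding set_lebesgue_integral_def by (rule Bochner_Integration.integral_cong) (auto simp: g_def II_def indicator_def)
  then have "AE x in lborel. g x = 0"
    by (intro AE_zero_if_interval_integrals[OF gi cl0]) (use cl0 in auto)
  then show ?thesis by eventually_elim (auto simp: g_def)
qed

lemma test_mult_integrable:
  assumes "sq_int v" "test_fun \<Phi>"
  shows "set_integrable lborel II (\<lambda>x. v x * of_real (\<Phi> k x))"
proof -
  obtain C where C: "\<And>x. x \<in> II \<Longrightarrow> \<bar>\<Phi> k x\<bar> \<le> C" using test_fun_bounded[OF assms(2)] by metis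
  note [measurable] = test_fun_meas[OF assms(2)] sq_int_meas[OF assms(1)]
  have m: "(\<lambda>x. v x * of_real (\<Phi> k x)) \<in> borel_measurable borel" by measurable
  have "sq_int (\<lambda>x. v x * of_real (\<Phi> k x))"
    by (rule sq_int_mult_bound(1)[OF m assms(1), of C])
      (use C in \<open>simp add: norm_mult mult.commute[of C] mult_left_mono\<close>)
  then show ?thesis by (rule sq_int_integrable)
qed

lemma der_test_parts:
  assumes d: "der u v" and u: "sq_int u" and v: "sq_int v" and t: "test_fun \<Phi>"
  shows "pairing u (\<Phi> (Suc 0)) = - pairing v (\<Phi> 0)"
proof -
  have dt: "((\<lambda>x. of_real (\<Phi> 0 x)) has_vector_derivative of_real (\<Phi> (Suc 0) x)) (at x within II)" for x
    using t unfolding test_fun_def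
    by (intro has_vector_derivative_of_real has_vector_derivative_at_within)
      (auto simp: has_real_derivative_iff_has_vector_derivative)
  have "der (\<lambda>x. of_real (\<Phi> 0 x) * u x) (\<lambda>x. of_real (\<Phi> (Suc 0) x) * u x + of_real (\<Phi> 0 x) * v x)"
    by (rule der_mult[OF d v dt]) (intro continuous_intros test_fun_continuous[OF t])
  from derD[OF this, of "-1" 1] have "((\<lambda>x. of_real (\<Phi> (Suc 0) x) * u x + of_real (\<Phi> 0 x) * v x) has_integral 0) {-1..1}"
    by (simp add: test_fun_ends[OF t])
  then have "integral II (\<lambda>x. u x * of_real (\<Phi> (Suc 0) x) + v x * of_real (\<Phi> 0 x)) = 0"
    by (simp add: II_def integral_unique mult.commute)
  moreover have "set_integrable lborel II (\<lambda>x. u x * of_real (\<Phi> (Suc 0) x) + v x * of_real (\<Phi> 0 x))"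
    using test_mult_integrable[OF u t] test_mult_integrable[OF v t] by auto
  ultimately have "(LBINT x:II. u x * of_real (\<Phi> (Suc 0) x) + v x * of_real (\<Phi> 0 x)) = 0"
    using set_borel_integral_eq_integral(2) by metis
  then show ?thesis
    using test_mult_integrable[OF u t] test_mult_integrable[OF v t] by (simp add: add_eq_0_iff)
qed

text \<open>Mean zero makes the primitive vanish again to the right of the support, so it has
  compact support in the same interval.\<close>

lemma test_fun_antiderivative:
  assumes t: "test_fun \<Theta>" and z: "(LBINT x:II. \<Theta> 0 x) = 0"
  obtains \<Phi> where "test_fun \<Phi>" "\<Phi> (Suc 0) = \<Theta> 0"
proof -
  from t obtain a b where ab: "-1 < a" "b < 1" "\<And>x. x \<notin> {a..b} \<Longrightarrow> \<Theta> 0 x = 0"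
    and d: "\<And>k x. (\<Theta> k has_real_derivative \<Theta> (Suc k) x) (at x)" unfolding test_fun_def by auto
  have ci: "\<Theta> 0 integrable_on {x..y}" for x y
    by (rule integrable_continuous_real) (rule test_fun_continuous[OF t])
  have tot: "integral {-1..1} (\<Theta> 0) = 0"
  proof -
    have "set_integrable lborel {-1..1} (\<Theta> 0)"
      by (rule borel_integrable_atLeastAtMost') (rule test_fun_continuous[OF t])
    then show ?thesis using z set_borel_integral_eq_integral(2)[of "{-1..1}" "\<Theta> 0"] by (simp add: II_def)
  qed
  \<comment> \<open>Setting \<open>X\<close> to 0 outside ]-1, 1[ agrees with the primitive near
    both ends, since \<open>\<Theta> 0\<close> vanishes there; differentiability is therefore not
    disturbed.\<close>
  define X where "X = (\<lambda>x. if -1 < x \<and> x < 1 then integral {-1..x} (\<Theta> 0) else 0)"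
  have X0: "X x = 0" if "x \<notin> {a..b}" for x
  proof (cases "-1 < x \<and> x < 1")
    case True
    from that have "x < a \<or> x > b" by auto
    then consider "x < a" | "x > b" by blast
    then show ?thesis
    proof cases
      case 1
      have "integral {-1..x} (\<Theta> 0) = integral {-1..x} (\<lambda>x. 0)"
        by (rule Henstock_Kurzweil_Integration.integral_cong) (use 1 ab in auto)
      then show ?thesis by (simp add: X_def)
    next
      case 2
      have "integral {x..1} (\<Theta> 0) = integral {x..1} (\<lambda>x. 0)"
        by (rule Henstock_Kurzweil_Integration.integral_cong) (use 2 ab in auto)
      moreover have "integral {-1..x} (\<Theta> 0) + integral {x..1} (\<Theta> 0) = integral {-1..1} (\<Theta> 0)"
        by (rule Henstock_Kurzweil_Integration.integral_combine) (use True ci in auto)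
      ultimately show ?thesis using tot by (simp add: X_def)
    qed
  qed (auto simp: X_def)
  have dX: "(X has_real_derivative \<Theta> 0 x) (at x)" for x
  proof (cases "-1 < x \<and> x < 1")
    case True
    have "((\<lambda>u. integral {-1..u} (\<Theta> 0)) has_real_derivative \<Theta> 0 x) (at x within {-1..1})"
      using integral_has_vector_derivative[OF test_fun_continuous[OF t], of x "-1" 1] True
      by (simp add: has_real_derivative_iff_has_vector_derivative)
    then have "((\<lambda>u. integral {-1..u} (\<Theta> 0)) has_real_derivative \<Theta> 0 x) (at x)"
      using True by (simp add: at_within_Icc_at)
    then show ?thesis
      by (rule has_field_derivative_transform_within_open[of _ _ _ "{-1<..<1}"]) (use True in \<open>auto simp: X_def\<close>)
  next
    case False
    then have x: "x \<notin> {a..b}" using ab by auto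
    have "((\<lambda>x. 0) has_real_derivative \<Theta> 0 x) (at x)" using ab(3)[OF x] by simp
    then show ?thesis
      by (rule has_field_derivative_transform_within_open[of _ _ _ "- {a..b}"]) (use x X0 in auto)
  qed
  have "test_fun (\<lambda>k. case k of 0 \<Rightarrow> X | Suc j \<Rightarrow> \<Theta> j)"
    unfolding test_fun_def using ab X0 dX d by (auto split: nat.split)
  then show ?thesis by (rule that) simp
qed

text \<open>Every test function is a multiple of a fixed \<open>\<psi>\<close> plus one of mean
  zero, and the latter is a derivative of a test function. Hence w acts as the constant c that is
  read off from \<open>\<psi>\<close>.\<close>

lemma du_Bois_Reymond:
  assumes w: "sq_int w" and z: "\<And>\<Phi>. test_fun \<Phi> \<Longrightarrow> pairing w (\<Phi> (Suc 0)) = 0"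
  shows "\<exists>c. AE x in lborel. x \<in> II \<longrightarrow> w x = c"
proof -
  \<comment> \<open>Index 1 is the first usable one: at 0 it gives
    \<open>ramp 1 * ramp 1 > 0\<close>, while for index 0 the two ramps have disjoint supports and
    the bump is identically zero.\<close>
  obtain \<psi> where psi: "test_fun \<psi>" "\<psi> 0 = bump (-1) 1 1" using test_fun_bump[of "-1" 1 1] by auto
  have rt: "set_integrable lborel II (\<Phi> 0)" if "test_fun \<Phi>" for \<Phi> :: "nat \<Rightarrow> real \<Rightarrow> real"
    unfolding II_def by (rule borel_integrable_atLeastAtMost') (rule test_fun_continuous[OF that])
  define J where "J = (LBINT x:II. \<psi> 0 x)"
  have "J \<noteq> 0"
  proof
    assume "J = 0"
    have "integral {-1..1} (\<psi> 0) = 0"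
      using \<open>J = 0\<close> set_borel_integral_eq_integral(2)[OF rt[OF psi(1)]] by (simp add: J_def II_def)
    then have "(\<psi> 0 has_integral 0) (cbox (-1) 1)"
      using integrable_integral[OF integrable_continuous_real[OF test_fun_continuous[OF psi(1), of "{-1..1}" 0]]] by simp
    then have "\<psi> 0 0 = 0"
      using has_integral_0_cbox_imp_0[of "-1" 1 "\<psi> 0" 0] test_fun_continuous[OF psi(1), of _ 0] bump_bounds[of "-1" 1 1]
      by (auto simp: psi(2))
    then show False by (simp add: psi(2) bump_def ramp_def)
  qed
  define c where "c = pairing w (\<psi> 0) / of_real J"
  have "AE x in lborel. x \<in> II \<longrightarrow> w x + (- c) = 0"
  proof (rule fundamental_lemma)
    have cs: "sq_int (\<lambda>x. - c)" by (rule sq_int_bounded(1)[of _ "cmod c"]) auto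
    show "sq_int (\<lambda>x. w x + (- c))" by (rule sq_int_add(1)[OF w cs])
    fix \<Phi> assume t: "test_fun \<Phi>"
    define I where "I = (LBINT x:II. \<Phi> 0 x)"
    \<comment> \<open>The multiple I / J removes the mean of \<open>\<Phi> 0\<close>.\<close>
    define \<Theta> where "\<Theta> = (\<lambda>k x. \<Phi> k x - (I / J) * \<psi> k x)"
    have tT: "test_fun \<Theta>"
    proof -
      obtain a b a' b' where "-1 < a" "b < 1" "\<And>x. x \<notin> {a..b} \<Longrightarrow> \<Phi> 0 x = 0"
        "-1 < a'" "b' < 1" "\<And>x. x \<notin> {a'..b'} \<Longrightarrow> \<psi> 0 x = 0"
        using t psi(1) unfolding test_fun_def by blast
      then have "-1 < min a a'" "max b b' < 1" "\<And>x. x \<notin> {min a a'..max b b'} \<Longrightarrow> \<Theta> 0 x = 0"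
        by (auto simp: \<Theta>_def not_le min_le_iff_disj)
      moreover have "(\<Theta> k has_real_derivative \<Theta> (Suc k) x) (at x)" for k x
        using t psi(1) unfolding test_fun_def \<Theta>_def
        by (intro DERIV_diff DERIV_cmult) auto
      ultimately show ?thesis unfolding test_fun_def by blast
    qed
    have "(LBINT x:II. \<Theta> 0 x) = I - (I / J) * J"
      unfolding \<Theta>_def using rt[OF t] rt[OF psi(1)] by (simp add: I_def J_def)
    then have "(LBINT x:II. \<Theta> 0 x) = 0" using \<open>J \<noteq> 0\<close> by simp
    then obtain X where "test_fun X" "X (Suc 0) = \<Theta> 0" using test_fun_antiderivative[OF tT] by metis
    then have "pairing w (\<Theta> 0) = 0" using z[of X] by simp
    moreover have "pairing w (\<Theta> 0) =
      (LBINT x:II. w x * of_real (\<Phi> 0 x) - of_real (I / J) * (w x * of_real (\<psi> 0 x)))"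
      by (rule set_lebesgue_integral_cong) (auto simp: \<Theta>_def algebra_simps)
    moreover have "(LBINT x:II. w x * of_real (\<Phi> 0 x) - d * (w x * of_real (\<psi> 0 x)))
      = pairing w (\<Phi> 0) - d * pairing w (\<psi> 0)" for d
      using set_integral_diff(2)[OF test_mult_integrable[OF w t] set_integrable_mult_right[OF test_mult_integrable[OF w psi(1)]]] by simp
    ultimately have "0 = pairing w (\<Phi> 0) - of_real (I / J) * pairing w (\<psi> 0)"
      by metis
    then have e1: "pairing w (\<Phi> 0) = of_real I * c"
      by (simp add: c_def)
    have e2: "(LBINT x:II. (- c) * of_real (\<Phi> 0 x)) = - c * of_real I"
    proof -
      have "(LBINT x:II. complex_of_real (\<Phi> 0 x)) = complex_of_real I"
        unfolding I_def set_lebesgue_integral_def by (simp add: scaleR_conv_of_real flip: of_real_mult integral_of_real)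
      then show ?thesis by (simp only: set_integral_mult_right)
    qed
    have "(LBINT x:II. (w x + (- c)) * of_real (\<Phi> 0 x)) =
      pairing w (\<Phi> 0) + (LBINT x:II. (- c) * of_real (\<Phi> 0 x))"
      unfolding distrib_right by (rule set_integral_add(2)[OF test_mult_integrable[OF w t] test_mult_integrable[OF cs t]])
    then show "(LBINT x:II. (w x + (- c)) * of_real (\<Phi> 0 x)) = 0"
      using e1 e2 by simp
  qed
  then show ?thesis by (intro exI[of _ c]) (auto elim: eventually_mono)
qed

section \<open>Lebesgue functions and their Borel representatives\<close>

lemma AE_lebesgue_on_II: "(AE x in lebesgue_on II. P x) \<longleftrightarrow> (AE x in lborel. x \<in> II \<longrightarrow> P x)"
  by (subst AE_restrict_space_iff) (simp_all add: AE_completion_iff)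

lemma II_lebesgue [simp]: "II \<in> sets lebesgue" by (simp add: II_def)

text \<open>After extension by zero, the real and imaginary parts have Borel versions by the
  description of functions measurable for a completed measure.\<close>

lemma lebesgue_on_borel_representative:
  fixes v :: "real \<Rightarrow> complex"
  assumes "v \<in> borel_measurable (lebesgue_on II)"
  obtains g where "g \<in> borel_measurable borel" "AE x in lebesgue_on II. v x = g x"
proof -
  define w where "w = (\<lambda>x. if x \<in> II then v x else 0)"
  have w: "w \<in> borel_measurable lebesgue"
    unfolding w_def by (rule borel_measurable_if_I[OF assms]) simp
  then have "(\<lambda>x. Re (w x)) \<in> borel_measurable lebesgue" "(\<lambda>x. Im (w x)) \<in> borel_measurable lebesgue"
    by measurable
  then obtain r i where r: "r \<in> borel_measurable lborel" "AE x in lborel. Re (w x) = r x"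
    and i: "i \<in> borel_measurable lborel" "AE x in lborel. Im (w x) = i x"
    using completion_ex_borel_measurable_real by metis
  note [measurable] = r(1) i(1)
  show ?thesis
  proof (rule that[of "\<lambda>x. Complex (r x) (i x)"])
    have "(\<lambda>x. of_real (r x) + \<i> * of_real (i x)) \<in> borel_measurable borel" by measurable
    then show "(\<lambda>x. Complex (r x) (i x)) \<in> borel_measurable borel" by (simp add: Complex_eq)
    show "AE x in lebesgue_on II. v x = Complex (r x) (i x)"
      unfolding AE_lebesgue_on_II using r(2) i(2)
      by eventually_elim (auto simp: w_def complex_eq_iff)
  qed
qed

lemma borel_lebesgue_on: "g \<in> borel_measurable borel \<Longrightarrow> g \<in> borel_measurable (lebesgue_on II)"
  by (rule measurable_restrict_space1, rule measurable_completion) simp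

lemma sq_int_L2: assumes "sq_int g" shows "L2 g"
proof -
  note [measurable] = sq_int_meas[OF assms]
  have "(\<lambda>x. (cmod (g x))\<^sup>2) \<in> borel_measurable borel" by measurable
  from lebesgue_on_II_integral(2)[OF this] assms
  have "integrable (lebesgue_on II) (\<lambda>x. (cmod (g x))\<^sup>2)" by (simp add: sq_int_def)
  with borel_lebesgue_on[OF sq_int_meas[OF assms]] show ?thesis unfolding L2_def by (rule conjI)
qed

lemma L2_representative:
  assumes "L2 v" obtains g where "sq_int g" "AE x in lebesgue_on II. v x = g x"
proof -
  from assms have v: "v \<in> borel_measurable (lebesgue_on II)" "integrable (lebesgue_on II) (\<lambda>x. (cmod (v x))\<^sup>2)"
    by (auto simp: L2_def)
  obtain g where g: "g \<in> borel_measurable borel" "AE x in lebesgue_on II. v x = g x"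
    using lebesgue_on_borel_representative[OF v(1)] .
  note [measurable] = g(1) v(1) borel_lebesgue_on[OF g(1)]
  have m: "(\<lambda>x. (cmod (g x))\<^sup>2) \<in> borel_measurable borel" by measurable
  have "integrable (lebesgue_on II) (\<lambda>x. (cmod (g x))\<^sup>2)"
  proof (rule integrable_cong_AE_imp[OF v(2)])
    show "(\<lambda>x. (cmod (g x))\<^sup>2) \<in> borel_measurable (lebesgue_on II)" by measurable
    show "AE x in lebesgue_on II. (cmod (v x))\<^sup>2 = (cmod (g x))\<^sup>2" using g(2) by eventually_elim simp
  qed
  then have "sq_int g" using g(1) by (simp add: sq_int_def lebesgue_on_II_integral(2)[OF m])
  then show ?thesis using g(2) that by blast
qed

lemma L2norm_representative:
  assumes "v \<in> borel_measurable (lebesgue_on II)" "sq_int g" "AE x in lebesgue_on II. v x = g x"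
  shows "L2norm v = sqrt (sqn g)"
proof -
  note [measurable] = assms(1) sq_int_meas[OF assms(2)] borel_lebesgue_on[OF sq_int_meas[OF assms(2)]]
  have m: "(\<lambda>x. (cmod (g x))\<^sup>2) \<in> borel_measurable borel" by measurable
  have "integral\<^sup>L (lebesgue_on II) (\<lambda>x. (cmod (v x))\<^sup>2) = integral\<^sup>L (lebesgue_on II) (\<lambda>x. (cmod (g x))\<^sup>2)"
  proof (rule integral_cong_AE)
    show "AE x in lebesgue_on II. (cmod (v x))\<^sup>2 = (cmod (g x))\<^sup>2" using assms(3) by eventually_elim simp
  qed measurable
  then show ?thesis by (simp add: L2norm_def sqn_def lebesgue_on_II_integral(1)[OF m])
qed

lemma test_integral_representative:
  assumes "v \<in> borel_measurable (lebesgue_on II)" "sq_int g" "AE x in lebesgue_on II. v x = g x" "test_fun \<Phi>"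
  shows "lpairing v (\<Phi> k) = pairing g (\<Phi> k)"
proof -
  note [measurable] = assms(1) sq_int_meas[OF assms(2)] borel_lebesgue_on[OF sq_int_meas[OF assms(2)]]
    test_fun_meas[OF assms(4)]
  have t[measurable]: "(\<lambda>x. complex_of_real (\<Phi> k x)) \<in> borel_measurable (lebesgue_on II)"
    by (rule borel_lebesgue_on) measurable
  have m: "(\<lambda>x. g x * of_real (\<Phi> k x)) \<in> borel_measurable borel" by measurable
  have "lpairing v (\<Phi> k) = lpairing g (\<Phi> k)"
  proof (rule integral_cong_AE)
    show "AE x in lebesgue_on II. v x * of_real (\<Phi> k x) = g x * of_real (\<Phi> k x)"
      using assms(3) by eventually_elim simp
  qed measurable
  then show ?thesis by (simp add: lebesgue_on_II_integral(1)[OF m])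
qed

text \<open>Equal pairings force equality almost everywhere by the fundamental lemma. Only the norms
  are concluded, since \<open>Hnorm\<close> is built from them.\<close>

lemma L2_unique:
  assumes v: "L2 v" "L2 v'"
    and eq: "\<And>\<Phi>. test_fun \<Phi> \<Longrightarrow> lpairing v (\<Phi> 0) =
        lpairing v' (\<Phi> 0)"
  shows "L2norm v = L2norm v'"
proof -
  obtain g where g: "sq_int g" "AE x in lebesgue_on II. v x = g x" using L2_representative[OF v(1)] .
  obtain g' where g': "sq_int g'" "AE x in lebesgue_on II. v' x = g' x" using L2_representative[OF v(2)] .
  have vm: "v \<in> borel_measurable (lebesgue_on II)" "v' \<in> borel_measurable (lebesgue_on II)"
    using v by (auto simp: L2_def)
  have "AE x in lborel. x \<in> II \<longrightarrow> g x + (-1) * g' x = 0"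
  proof (rule fundamental_lemma)
    show "sq_int (\<lambda>x. g x + (-1) * g' x)" by (rule sq_int_add(1)[OF g(1) sq_int_cmult[OF g'(1)]])
    fix \<Phi> assume t: "test_fun \<Phi>"
    have "pairing g (\<Phi> 0) = pairing g' (\<Phi> 0)"
      using eq[OF t] test_integral_representative[OF vm(1) g t, of 0] test_integral_representative[OF vm(2) g' t, of 0] by simp
    moreover have "(LBINT x:II. g x * of_real (\<Phi> 0 x) - g' x * of_real (\<Phi> 0 x))
      = pairing g (\<Phi> 0) - pairing g' (\<Phi> 0)"
      by (rule set_integral_diff(2)[OF test_mult_integrable[OF g(1) t] test_mult_integrable[OF g'(1) t]])
    ultimately show "(LBINT x:II. (g x + (-1) * g' x) * of_real (\<Phi> 0 x)) = 0"
      by (simp add: left_diff_distrib)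
  qed
  then have "AE x in lebesgue_on II. v' x = g x"
    using g'(2) unfolding AE_lebesgue_on_II by eventually_elim auto
  then show ?thesis
    using L2norm_representative[OF vm(1) g] L2norm_representative[OF vm(2) g(1)] by simp
qed

lemma weak_derivsD:
  assumes "weak_derivs m u v" "j \<le> m"
  shows "L2 (v j)"
    and "test_fun \<Phi> \<Longrightarrow> lpairing u (\<Phi> j) =
        (-1) ^ j * lpairing (v j) (\<Phi> 0)"
proof -
  note W = assms(1)[unfolded weak_derivs_def]
  show "L2 (v j)" by (rule W[THEN conjunct1, rule_format, OF assms(2)])
  show "test_fun \<Phi> \<Longrightarrow> lpairing u (\<Phi> j) =
        (-1) ^ j * lpairing (v j) (\<Phi> 0)"
    by (rule W[THEN conjunct2, THEN conjunct2, rule_format, OF assms(2)])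
qed

lemma weak_derivs_unique:
  assumes "weak_derivs p u v" "weak_derivs q u v'" "j \<le> p" "j \<le> q"
  shows "L2norm (v j) = L2norm (v' j)"
proof (rule L2_unique)
  show "L2 (v j)" "L2 (v' j)" using assms by (auto intro: weak_derivsD(1))
  fix \<Phi> assume t: "test_fun \<Phi>"
  have "(-1) ^ j * lpairing (v j) (\<Phi> 0) =
    (-1) ^ j * lpairing (v' j) (\<Phi> 0)"
    using weak_derivsD(2)[OF assms(1,3) t] weak_derivsD(2)[OF assms(2,4) t] by (rule trans[OF sym])
  then show "lpairing (v j) (\<Phi> 0) =
        lpairing (v' j) (\<Phi> 0)"
    by simp
qed

text \<open>Eliminates the choice operator: any two families of weak derivatives have the same
  norms, so an explicit family may be inserted.\<close>

lemma Hnorm_eq: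
  assumes "weak_derivs p u v" shows "Hnorm p u = sqrt (\<Sum>j\<le>p. (L2norm (v j))\<^sup>2)"
proof -
  define v' where "v' = (SOME v. weak_derivs p u v)"
  have "weak_derivs p u v'" unfolding v'_def by (rule someI[of "weak_derivs p u", OF assms])
  then have "L2norm (v' j) = L2norm (v j)" if "j \<le> p" for j
    using weak_derivs_unique[OF _ assms that that] by blast
  then show ?thesis by (simp add: Hnorm_def Let_def v'_def[symmetric])
qed

lemma weak_derivs_le:
  assumes "weak_derivs m u v" "p \<le> m" shows "weak_derivs p u v"
  unfolding weak_derivs_def
proof (intro conjI allI impI)
  show "AE x in lebesgue_on II. v 0 x = u x" using assms(1) by (simp add: weak_derivs_def)
qed (rule weak_derivsD[OF assms(1)]; use assms(2) in simp)+

lemma der_AE_cong: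
  assumes "der u v" "AE x in lborel. x \<in> II \<longrightarrow> v x = v' x"
  shows "der u v'"
proof (rule derI)
  fix x y :: real assume xy: "-1 \<le> x" "x \<le> y" "y \<le> 1"
  from assms(2) obtain N where N: "N \<in> null_sets lborel" "{x \<in> space lborel. \<not> (x \<in> II \<longrightarrow> v x = v' x)} \<subseteq> N"
    by (auto simp: eventually_ae_filter)
  have "negligible N" using N(1) by (simp add: negligible_iff_null_sets null_sets_completionI)
  then show "(v' has_integral u y - u x) {x..y}"
  proof (rule has_integral_spike[OF _ _ derD[OF assms(1) xy]])
    show "v' z = v z" if "z \<in> {x..y} - N" for z
    proof -
      have "z \<in> II" using that xy by (auto simp: II_def)
      with subsetD[OF N(2), of z] that show ?thesis by (cases "v z = v' z") auto
    qed
  qed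
qed

lemma sq_int_const: "sq_int (\<lambda>x. c)"
  by (rule sq_int_bounded(1)[of _ "cmod c"]) auto

text \<open>The difference of u and a primitive of v has weak derivative zero, hence is almost
  everywhere a constant; adding that constant to the primitive gives the absolutely continuous
  version of u.\<close>

lemma weak_step:
  assumes u: "sq_int u" and v: "sq_int v"
    and w: "\<And>\<Phi>. test_fun \<Phi> \<Longrightarrow> pairing u (\<Phi> (Suc 0)) = - pairing v (\<Phi> 0)"
  shows "\<exists>h. sq_int h \<and> der h v \<and> (AE x in lborel. x \<in> II \<longrightarrow> h x = u x)"
proof -
  define P where "P = low (\<lambda>s t. 1) v"
  have P: "sq_int P" "der P v" using sq_int_prim[OF v] der_primitive[OF v] by (auto simp: P_def)
  have "\<exists>c. AE x in lborel. x \<in> II \<longrightarrow> u x + (-1) * P x = c"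
  proof (rule du_Bois_Reymond)
    show "sq_int (\<lambda>x. u x + (-1) * P x)" by (rule sq_int_add(1)[OF u sq_int_cmult[OF P(1)]])
    fix \<Phi> assume t: "test_fun \<Phi>"
    have "(LBINT x:II. u x * of_real (\<Phi> (Suc 0) x) - P x * of_real (\<Phi> (Suc 0) x)) =
      (pairing u (\<Phi> (Suc 0))) - pairing P (\<Phi> (Suc 0))"
      by (rule set_integral_diff(2)[OF test_mult_integrable[OF u t] test_mult_integrable[OF P(1) t]])
    then show "(LBINT x:II. (u x + (-1) * P x) * of_real (\<Phi> (Suc 0) x)) = 0"
      using w[OF t] der_test_parts[OF P(2,1) v t] by (simp add: left_diff_distrib)
  qed
  then obtain c where c: "AE x in lborel. x \<in> II \<longrightarrow> u x + (-1) * P x = c" by blast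
  have dc: "der (\<lambda>x. c) (\<lambda>x. 0)" by (rule derI) simp
  have "sq_int (\<lambda>x. P x + c)" by (rule sq_int_add(1)[OF P(1) sq_int_const])
  moreover have "der (\<lambda>x. P x + c) v" using der_add[OF P(2) dc] by simp
  moreover have "AE x in lborel. x \<in> II \<longrightarrow> P x + c = u x" using c by eventually_elim auto
  ultimately show ?thesis by blast
qed

text \<open>Each weak derivative below the top order is replaced by its absolutely continuous
  version. Consecutive members are linked by comparing the defining identities of orders j and j +
  1.\<close>

lemma weak_derivs_chain:
  assumes W: "weak_derivs m u v"
  obtains h where "\<And>j. j \<le> m \<Longrightarrow> sq_int (h j)" "\<And>j. j \<le> m \<Longrightarrow> AE x in lebesgue_on II. v j x = h j x"
    "\<And>j. j < m \<Longrightarrow> der (h j) (h (Suc j))"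
proof -
  have L: "L2 (v j)" if "j \<le> m" for j by (rule weak_derivsD(1)[OF W that])
  have "\<exists>g. sq_int g \<and> (AE x in lebesgue_on II. v j x = g x)" if "j \<le> m" for j
    using L2_representative[OF L[OF that]] by metis
  then obtain g where g: "\<And>j. j \<le> m \<Longrightarrow> sq_int (g j)" "\<And>j. j \<le> m \<Longrightarrow> AE x in lebesgue_on II. v j x = g j x" by metis
  have "\<exists>h. sq_int h \<and> der h (g (Suc j)) \<and> (AE x in lborel. x \<in> II \<longrightarrow> h x = g j x)" if j: "j < m" for j
  proof (rule weak_step)
    show "sq_int (g j)" "sq_int (g (Suc j))" using g(1) j by auto
    fix \<Phi> assume t: "test_fun \<Phi>"
    have Lm: "v j \<in> borel_measurable (lebesgue_on II)" "v (Suc j) \<in> borel_measurable (lebesgue_on II)"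
      using L j by (auto simp: L2_def)
    \<comment> \<open>Testing at order j with the derivative of \<open>\<Phi>\<close> involves the
      same integral of u as testing at order j + 1 with \<open>\<Phi>\<close> itself.\<close>
    have t': "test_fun (\<lambda>k. \<Phi> (Suc k))" by (rule test_fun_shift[OF t])
    have "(-1) ^ j * lpairing (v j) (\<Phi> (Suc 0)) =
      lpairing u (\<Phi> (Suc j))"
      using weak_derivsD(2)[OF W less_imp_le[OF j] t'] by (rule sym)
    also have "\<dots> = (-1) ^ Suc j * lpairing (v (Suc j)) (\<Phi> 0)"
      by (rule weak_derivsD(2)[OF W Suc_leI[OF j] t])
    finally have "(-1) ^ j * lpairing (v j) (\<Phi> (Suc 0)) =
      (-1) ^ j * (- lpairing (v (Suc j)) (\<Phi> 0))" by simp
    then have "lpairing (v j) (\<Phi> (Suc 0)) =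
      - lpairing (v (Suc j)) (\<Phi> 0)"
      by (subst (asm) mult_left_cancel) auto
    then show "(pairing (g j) (\<Phi> (Suc 0))) = - (pairing (g (Suc j)) (\<Phi> 0))"
      using test_integral_representative[OF Lm(1) g(1) g(2) t, of "Suc 0"]
        test_integral_representative[OF Lm(2) g(1) g(2) t, of 0] j by simp
  qed
  then obtain h where h: "\<And>j. j < m \<Longrightarrow> sq_int (h j)" "\<And>j. j < m \<Longrightarrow> der (h j) (g (Suc j))"
    "\<And>j. j < m \<Longrightarrow> AE x in lborel. x \<in> II \<longrightarrow> h j x = g j x" by metis
  \<comment> \<open>The step gives \<open>der (h j) (g (Suc j))\<close>; passing to
    \<open>h (Suc j)\<close> changes the integrand only on a null set. The top order has no such
    version and keeps \<open>g m\<close>.\<close>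
  define H where "H = (\<lambda>j. if j < m then h j else g j)"
  have HA: "AE x in lborel. x \<in> II \<longrightarrow> g j x = H j x" if "j \<le> m" for j
    using h(3)[of j] that by (auto simp: H_def elim: eventually_mono)
  show ?thesis
  proof (rule that[of H])
    show "sq_int (H j)" if "j \<le> m" for j using that h(1) g(1) by (auto simp: H_def)
    show "AE x in lebesgue_on II. v j x = H j x" if "j \<le> m" for j
      using HA[OF that] g(2)[OF that] unfolding AE_lebesgue_on_II by eventually_elim auto
    show "der (H j) (H (Suc j))" if "j < m" for j
      using der_AE_cong[OF h(2)[OF that] HA[of "Suc j"]] that by (simp add: H_def)
  qed
qed

lemma chain_weak_derivs:
  assumes s: "\<And>j. j \<le> m \<Longrightarrow> sq_int (h j)" and d: "\<And>j. j < m \<Longrightarrow> der (h j) (h (Suc j))"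
  shows "weak_derivs m (h 0) h"
proof -
  have main: "(pairing (h 0) (\<Phi> j)) = (-1) ^ j * (pairing (h j) (\<Phi> 0))"
    if "j \<le> m" "test_fun \<Phi>" for j \<Phi>
    using that
  proof (induction j arbitrary: \<Phi>)
    case (Suc j)
    have "(pairing (h 0) (\<Phi> (Suc j))) = (-1) ^ j * (pairing (h j) (\<Phi> (Suc 0)))"
      using Suc.IH[OF _ test_fun_shift[OF Suc.prems(2)]] Suc.prems by simp
    also have "(pairing (h j) (\<Phi> (Suc 0))) = - (pairing (h (Suc j)) (\<Phi> 0))"
      by (rule der_test_parts) (use d s Suc.prems in auto)
    finally show ?case by simp
  qed simp
  have conv: "lpairing (h j) (\<Phi> k) = (pairing (h j) (\<Phi> k))"
    if "j \<le> m" "test_fun \<Phi>" for j k \<Phi>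
    by (rule test_integral_representative[OF borel_lebesgue_on[OF sq_int_meas[OF s[OF that(1)]]] s[OF that(1)] _ that(2)]) simp
  show ?thesis
    unfolding weak_derivs_def
  proof (intro conjI allI impI)
    show "L2 (h j)" if "j \<le> m" for j by (rule sq_int_L2[OF s[OF that]])
    show "lpairing (h 0) (\<Phi> j) =
        (-1) ^ j * lpairing (h j) (\<Phi> 0)"
      if "j \<le> m" "test_fun \<Phi>" for j \<Phi>
      unfolding conv[OF le0 that(2)] conv[OF that] by (rule main[OF that])
  qed simp
qed

section \<open>Passage between the parameterized classes and Sobolev norms\<close>

lemma Sob_ord_chain:
  "Sob_ord e N f \<Longrightarrow> \<exists>w. w 0 = f \<and> (\<forall>j\<le>N. L2_ord (e j) (w j)) \<and> (\<forall>j<N. \<forall>\<kappa>>1. der (w j \<kappa>) (w (Suc j) \<kappa>))"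
proof (induction N arbitrary: e f)
  case 0
  then show ?case by (intro exI[of _ "\<lambda>_. f"]) simp
next
  case (Suc N)
  then obtain g where g: "L2_ord (e 0) f" "\<forall>\<kappa>>1. der (f \<kappa>) (g \<kappa>)" "Sob_ord (\<lambda>p. e (Suc p)) N g" by auto
  from Suc.IH[OF g(3)] obtain w where w: "w 0 = g" "\<forall>j\<le>N. L2_ord (e (Suc j)) (w j)"
    "\<forall>j<N. \<forall>\<kappa>>1. der (w j \<kappa>) (w (Suc j) \<kappa>)" by auto
  show ?case
    by (rule exI[of _ "\<lambda>j. case j of 0 \<Rightarrow> f | Suc i \<Rightarrow> w i"])
      (use g w in \<open>auto split: nat.split\<close>)
qed

lemma chain_Sob_ord:
  "(\<And>j. j \<le> N \<Longrightarrow> L2_ord (e j) (w j)) \<Longrightarrow> (\<And>j \<kappa>. j < N \<Longrightarrow> \<kappa> > 1 \<Longrightarrow> der (w j \<kappa>) (w (Suc j) \<kappa>)) \<Longrightarrow> Sob_ord e N (w 0)"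
proof (induction N arbitrary: e w)
  case (Suc N)
  show ?case
  proof (rule Sob_ord_SucI)
    show "Sob_ord (\<lambda>p. e (Suc p)) N (w (Suc 0))"
      using Suc.IH[of "\<lambda>p. e (Suc p)" "\<lambda>j. w (Suc j)"] Suc.prems by simp
  qed (use Suc.prems in auto)
qed simp

text \<open>For \<kappa> > 1 each power \<kappa>^(j - n) with j \<le> m is at most \<kappa>^(m - n),
  so the top derivative dictates the bound for the whole sum.\<close>

lemma amplitude_Hkk:
  assumes f: "amplitude n m f" and n: "n \<le> m"
  shows "Hkk m (real (m - n)) f"
proof -
  obtain w where w0: "w 0 = f" and wB: "\<And>j. j \<le> m \<Longrightarrow> L2_ord (int (j - n)) (w j)"
    and wd: "\<And>j \<kappa>. j < m \<Longrightarrow> \<kappa> > 1 \<Longrightarrow> der (w j \<kappa>) (w (Suc j) \<kappa>)"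
    using Sob_ord_chain[OF f[unfolded amplitude_def]] by auto
  have W: "weak_derivs m (f \<kappa>) (\<lambda>j. w j \<kappa>)" if "\<kappa> > 1" for \<kappa>
    using chain_weak_derivs[of m "\<lambda>j. w j \<kappa>"] that wB L2_ord_sq wd by (auto simp: w0)
  have norm: "Hnorm m (f \<kappa>) = sqrt (\<Sum>j\<le>m. sqn (w j \<kappa>))" if "\<kappa> > 1" for \<kappa>
  proof -
    have "(L2norm (w j \<kappa>))\<^sup>2 = sqn (w j \<kappa>)" if "j \<le> m" for j
    proof -
      have s: "sq_int (w j \<kappa>)" by (rule L2_ord_sq[OF wB[OF that] \<open>\<kappa> > 1\<close>])
      have "L2norm (w j \<kappa>) = sqrt (sqn (w j \<kappa>))"
        by (rule L2norm_representative[OF borel_lebesgue_on[OF sq_int_meas[OF s]] s]) simp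
      then show ?thesis using sqn_nonneg by simp
    qed
    then show ?thesis by (simp add: Hnorm_eq[OF W[OF that]])
  qed
  have "\<exists>C. \<forall>\<^sub>F \<kappa> in at_top. sqn (w j \<kappa>) \<le> C * \<kappa> powi (2 * int (j - n))" if "j \<le> m" for j
    using wB[OF that] by (simp add: L2_ord_def)
  then obtain C where C: "\<And>j. j \<le> m \<Longrightarrow> \<forall>\<^sub>F \<kappa> in at_top. sqn (w j \<kappa>) \<le> C j * \<kappa> powi (2 * int (j - n))" by metis
  define S where "S = (\<Sum>j\<le>m. \<bar>C j\<bar>)"
  have S0: "S \<ge> 0" unfolding S_def by (rule sum_nonneg) simp
  have "\<forall>\<^sub>F \<kappa> in at_top. \<forall>j\<in>{..m}. sqn (w j \<kappa>) \<le> C j * \<kappa> powi (2 * int (j - n))"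
    by (rule eventually_ball_finite) (use C in auto)
  \<comment> \<open>The summand 1 keeps the constant positive when S = 0, as \<open>Hkk\<close> asks
    for c > 0.\<close>
  then have "\<forall>\<^sub>F \<kappa> in at_top. Hnorm m (f \<kappa>) \<le> (sqrt S + 1) * \<kappa> powr real (m - n)"
    using eventually_gt1
  proof eventually_elim
    case (elim \<kappa>)
    have "(\<Sum>j\<le>m. sqn (w j \<kappa>)) \<le> (\<Sum>j\<le>m. \<bar>C j\<bar> * \<kappa> powi (2 * int (m - n)))"
    proof (rule sum_mono)
      fix j assume j: "j \<in> {..m}"
      have "sqn (w j \<kappa>) \<le> C j * \<kappa> powi (2 * int (j - n))" using elim(1) j by blast
      also have "\<dots> \<le> \<bar>C j\<bar> * \<kappa> powi (2 * int (j - n))" using elim(2) by (intro mult_right_mono) auto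
      also have "\<dots> \<le> \<bar>C j\<bar> * \<kappa> powi (2 * int (m - n))"
        using elim(2) j by (intro mult_left_mono power_int_increasing) auto
      finally show "sqn (w j \<kappa>) \<le> \<bar>C j\<bar> * \<kappa> powi (2 * int (m - n))" .
    qed
    also have "\<dots> = S * \<kappa> powi (2 * int (m - n))" by (simp add: S_def sum_distrib_right)
    also have "\<kappa> powi (2 * int (m - n)) = (\<kappa> ^ (m - n))\<^sup>2"
    proof -
      have "2 * int (m - n) = int (2 * (m - n))" by simp
      then show ?thesis by (simp only: power_int_of_nat) (simp add: power_mult[symmetric] mult.commute)
    qed
    finally have "sqrt (\<Sum>j\<le>m. sqn (w j \<kappa>)) \<le> sqrt (S * (\<kappa> ^ (m - n))\<^sup>2)" by (rule real_sqrt_le_mono)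
    also have "\<dots> = sqrt S * \<kappa> ^ (m - n)" using elim(2) by (simp add: real_sqrt_mult)
    also have "\<dots> \<le> (sqrt S + 1) * \<kappa> ^ (m - n)" using elim(2) by (intro mult_right_mono) auto
    also have "\<kappa> ^ (m - n) = \<kappa> powr real (m - n)" using elim(2) by (simp add: powr_realpow)
    finally show ?case by (simp add: norm[OF elim(2)])
  qed
  then obtain X where X: "\<And>\<kappa>. \<kappa> \<ge> X \<Longrightarrow> Hnorm m (f \<kappa>) \<le> (sqrt S + 1) * \<kappa> powr real (m - n)"
    by (auto simp: eventually_at_top_linorder)
  have "sqrt S + 1 > 0" using S0 real_sqrt_ge_zero[of S] by linarith
  moreover have "max X 1 > 0" by simp
  ultimately show ?thesis
    unfolding Hkk_def Hm_def using W X by (meson max.boundedE)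
qed

text \<open>The norm of order p dominates the p-th derivative alone, so the bounds for all p \<le> m
  say that the p-th derivative has order \<kappa>^p, which is the class with n = 0.\<close>

lemma Hk_representative:
  assumes u: "Hk m u"
  obtains h where "amplitude 0 m h" "\<And>\<kappa>. \<kappa> > 1 \<Longrightarrow> AE x in lebesgue_on II. u \<kappa> x = h \<kappa> x"
proof -
  from u have "\<forall>\<kappa>>1. \<exists>v. weak_derivs m (u \<kappa>) v" by (simp add: Hk_def Hm_def)
  then obtain V where V: "\<And>\<kappa>. \<kappa> > 1 \<Longrightarrow> weak_derivs m (u \<kappa>) (V \<kappa>)" by metis
  from u obtain c X where cX: "\<And>p \<kappa>. p \<le> m \<Longrightarrow> \<kappa> > 1 \<Longrightarrow> \<kappa> \<ge> X \<Longrightarrow> Hnorm p (u \<kappa>) \<le> c * \<kappa> ^ p"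
    unfolding Hk_def by blast
  have "\<exists>h. (\<forall>j\<le>m. sq_int (h j)) \<and> (\<forall>j\<le>m. AE x in lebesgue_on II. V \<kappa> j x = h j x) \<and> (\<forall>j<m. der (h j) (h (Suc j)))"
    if "\<kappa> > 1" for \<kappa>
    using weak_derivs_chain[OF V[OF that]] by metis
  then obtain H where H: "\<And>\<kappa> j. \<kappa> > 1 \<Longrightarrow> j \<le> m \<Longrightarrow> sq_int (H \<kappa> j)"
    "\<And>\<kappa> j. \<kappa> > 1 \<Longrightarrow> j \<le> m \<Longrightarrow> AE x in lebesgue_on II. V \<kappa> j x = H \<kappa> j x"
    "\<And>\<kappa> j. \<kappa> > 1 \<Longrightarrow> j < m \<Longrightarrow> der (H \<kappa> j) (H \<kappa> (Suc j))" by metis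
  have B: "L2_ord (int j) (\<lambda>\<kappa>. H \<kappa> j)" if j: "j \<le> m" for j
  proof -
    have "\<forall>\<^sub>F \<kappa> in at_top. sqn (H \<kappa> j) \<le> c\<^sup>2 * \<kappa> powi (2 * int j)"
      using eventually_gt1 eventually_ge_at_top[of X]
    proof eventually_elim
      case (elim \<kappa>)
      have Vm: "V \<kappa> j \<in> borel_measurable (lebesgue_on II)"
        using weak_derivsD(1)[OF V[OF elim(1)] j] by (simp add: L2_def)
      have "sqn (H \<kappa> j) = (L2norm (V \<kappa> j))\<^sup>2"
        using L2norm_representative[OF Vm H(1,2)] elim(1) j sqn_nonneg by simp
      also have "\<dots> \<le> (\<Sum>i\<le>j. (L2norm (V \<kappa> i))\<^sup>2)"
        by (rule member_le_sum) auto
      also have "\<dots> = (Hnorm j (u \<kappa>))\<^sup>2"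
        by (simp add: Hnorm_eq[OF weak_derivs_le[OF V[OF elim(1)] j]] sum_nonneg)
      also have "\<dots> \<le> (c * \<kappa> ^ j)\<^sup>2"
        by (rule power_mono[OF cX[OF j elim]])
          (simp add: Hnorm_eq[OF weak_derivs_le[OF V[OF elim(1)] j]] sum_nonneg)
      also have "\<dots> = c\<^sup>2 * \<kappa> powi (2 * int j)"
      proof -
        have "2 * int j = int (2 * j)" by simp
        then have "\<kappa> powi (2 * int j) = \<kappa> ^ (2 * j)" by (simp only: power_int_of_nat)
        then show ?thesis by (simp add: power_mult_distrib power_mult[symmetric] mult.commute)
      qed
      finally show ?case .
    qed
    then show ?thesis using H(1) j by (auto simp: L2_ord_def)
  qed
  show ?thesis
  proof (rule that[of "\<lambda>\<kappa>. H \<kappa> 0"])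
    show "amplitude 0 m (\<lambda>\<kappa>. H \<kappa> 0)"
      unfolding amplitude_def by (rule chain_Sob_ord[of m "\<lambda>p. int (p - 0)" "\<lambda>j \<kappa>. H \<kappa> j"]) (use B H(3) in auto)
    show "AE x in lebesgue_on II. u \<kappa> x = H \<kappa> 0 x" if "\<kappa> > 1" for \<kappa>
    proof -
      have "AE x in lebesgue_on II. V \<kappa> 0 x = u \<kappa> x" using V[OF that] by (simp add: weak_derivs_def)
      then show ?thesis using H(2)[OF that le0] by eventually_elim simp
    qed
  qed
qed

text \<open>Completeness of Lebesgue measure carries measurability over an equality almost
  everywhere. \<open>Hm\<close> asserts measurability for the weak derivatives and links
  \<open>u\<close> to \<open>v 0\<close> only almost everywhere.\<close>

lemma lebesgue_on_II_measurable_AE: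
  fixes u h :: "real \<Rightarrow> complex"
  assumes h: "h \<in> borel_measurable borel" and eq: "AE x in lebesgue_on II. u x = h x"
  shows "u \<in> borel_measurable (lebesgue_on II)"
proof -
  define U where "U = (\<lambda>x. if x \<in> II then u x else 0)"
  define G where "G = (\<lambda>x. if x \<in> II then h x else 0)"
  have G: "G \<in> borel_measurable lebesgue"
    unfolding G_def by (rule borel_measurable_if_I[OF borel_lebesgue_on[OF h]]) simp
  have ae: "AE x in lebesgue. G x = U x"
    using eq unfolding AE_lebesgue_on_II AE_completion_iff by eventually_elim (auto simp: U_def G_def)
  have "U \<in> borel_measurable lebesgue"
  proof (rule measurableI)
    fix A :: "complex set" assume "A \<in> sets borel"
    have "U -` A \<in> sets lebesgue"
    proof (rule completion.in_sets_AE)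
      show "AE x in lebesgue. (x \<in> G -` A) = (x \<in> U -` A)" using ae by eventually_elim simp
      show "G -` A \<in> sets lebesgue" using measurable_sets[OF G \<open>A \<in> sets borel\<close>] by simp
    qed simp
    then show "U -` A \<inter> space lebesgue \<in> sets lebesgue" by simp
  qed simp
  then have "U \<in> borel_measurable (lebesgue_on II)" by (rule measurable_restrict_space1)
  then show ?thesis
    by (subst measurable_cong[where g = U]) (auto simp: U_def)
qed

text \<open>The integral turns equality of the arguments almost everywhere into equality of the
  values at each s, which \<open>oscillatory\<close> demands.\<close>

lemma Kop_AE_cong:
  assumes Kc: "continuous_on II (\<lambda>t. K s t)" and h: "h \<in> borel_measurable borel"
    and eq: "AE x in lebesgue_on II. u x = h x"
  shows "Kop K \<kappa> u s = Kop K \<kappa> h s"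
  unfolding Kop_def
proof (rule integral_cong_AE)
  have "(\<lambda>t. K s (cl t)) \<in> borel_measurable borel"
    by (rule borel_measurable_continuous_onI[OF continuous_cl_comp[OF Kc]])
  then have "(\<lambda>t. K s (cl t)) \<in> borel_measurable (lebesgue_on II)" by (rule borel_lebesgue_on)
  then have [measurable]: "(\<lambda>t. K s t) \<in> borel_measurable (lebesgue_on II)"
    by (subst measurable_cong[where g = "\<lambda>t. K s (cl t)"]) auto
  have [measurable]: "(\<lambda>t. exp (\<i> * of_real (\<kappa> * \<bar>s - t\<bar>))) \<in> borel_measurable (lebesgue_on II)"
    by (intro borel_lebesgue_on borel_measurable_continuous_onI continuous_intros)
  have [measurable]: "h \<in> borel_measurable (lebesgue_on II)" by (rule borel_lebesgue_on[OF h])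
  have [measurable]: "u \<in> borel_measurable (lebesgue_on II)" by (rule lebesgue_on_II_measurable_AE[OF h eq])
  show "(\<lambda>t. K s t * exp (\<i> * of_real (\<kappa> * \<bar>s - t\<bar>)) * u t) \<in> borel_measurable (lebesgue_on II)"
    "(\<lambda>t. K s t * exp (\<i> * of_real (\<kappa> * \<bar>s - t\<bar>)) * h t) \<in> borel_measurable (lebesgue_on II)"
    by measurable
  show "AE t in lebesgue_on II. K s t * exp (\<i> * of_real (\<kappa> * \<bar>s - t\<bar>)) * u t =
      K s t * exp (\<i> * of_real (\<kappa> * \<bar>s - t\<bar>)) * h t"
    using eq by eventually_elim simp
qed

lemma oscillatory_Hkk_tilde:
  assumes "oscillatory n m w" "n \<le> m" shows "Hkk_tilde m (real (m - n)) w"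
proof -
  obtain u0 u1 u2 where u: "amplitude n m u0" "amplitude n m u1" "amplitude n m u2"
     "\<And>\<kappa> t. \<kappa> > 1 \<Longrightarrow> t \<in> II \<Longrightarrow> w \<kappa> t = u0 \<kappa> t + osc 1 \<kappa> t * u1 \<kappa> t + osc (-1) \<kappa> t * u2 \<kappa> t"
    using assms(1) unfolding oscillatory_def by blast
  have "osc 1 \<kappa> t = exp (\<i> * of_real (\<kappa> * t))" "osc (-1) \<kappa> t = exp (- \<i> * of_real (\<kappa> * t))" for \<kappa> t
    by (simp_all add: osc_def cis_conv_exp)
  then have "\<forall>\<kappa>>1. \<forall>t\<in>II. w \<kappa> t = u0 \<kappa> t + u1 \<kappa> t * exp (\<i> * of_real (\<kappa> * t))
      + u2 \<kappa> t * exp (- \<i> * of_real (\<kappa> * t))"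
    using u(4) by (simp add: mult.commute)
  then show ?thesis
    unfolding Hkk_tilde_def using amplitude_Hkk[OF _ assms(2)] u(1-3) by blast
qed

theorem theorem5p7:
  fixes m n :: nat and K :: "real \<Rightarrow> real \<Rightarrow> complex" and u :: "real \<Rightarrow> real \<Rightarrow> complex"
  assumes "m > 0" and "Cm m K" and "1 \<le> n" and "n \<le> m" and "Hk m u"
  shows "Hkk_tilde m (real (m - n)) (\<lambda>\<kappa>. (Kop K \<kappa> ^^ n) (u \<kappa>))"
proof -
  from \<open>Cm m K\<close>[unfolded Cm_def] obtain D :: "nat \<Rightarrow> nat \<Rightarrow> real \<Rightarrow> real \<Rightarrow> complex" where
    DK: "\<forall>s\<in>II. \<forall>t\<in>II. D 0 0 s t = K s t" and
    Dt: "\<forall>b<m. \<forall>s\<in>II. \<forall>t\<in>II. ((\<lambda>t'. D 0 b s t') has_vector_derivative D 0 (Suc b) s t) (at t within II)" and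
    Ds: "\<forall>a<m. \<forall>b\<le>m. \<forall>s\<in>II. \<forall>t\<in>II. ((\<lambda>s'. D a b s' t) has_vector_derivative D (Suc a) b s t) (at s within II)" and
    Dc: "\<forall>a\<le>m. \<forall>b\<le>m. continuous_on (II \<times> II) (\<lambda>(s,t). D a b s t)"
    by (elim exE conjE)
  have D0: "\<forall>s\<in>II. \<forall>t\<in>II. K s t = D 0 0 s t" using DK by simp
  have D: "smooth_kernel m D"
  proof (rule smooth_kernel.intro)
    show "continuous_on (II \<times> II) (\<lambda>(s,t). D a b s t)" if "a \<le> m" "b \<le> m" for a b
      by (rule Dc[THEN spec, THEN mp, THEN spec, THEN mp, OF that])
  qed (use Dt Ds in auto)
  interpret smooth_kernel m D by (rule D)
  obtain h where h: "amplitude 0 m h" "\<And>\<kappa>. \<kappa> > 1 \<Longrightarrow> AE x in lebesgue_on II. u \<kappa> x = h \<kappa> x"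
    using Hk_representative[OF \<open>Hk m u\<close>] by blast
  have Kc: "continuous_on II (\<lambda>t. K s t)" if s: "s \<in> II" for s
  proof -
    have p: "continuous_on II (\<lambda>t. (s, t))" by (intro continuous_on_Pair continuous_on_const continuous_on_id)
    have "continuous_on II (\<lambda>t. D 0 0 s t)"
      using continuous_on_compose2[OF cont[of 0 0] p] s by auto
    then show ?thesis by (rule continuous_on_cong[THEN iffD1, rotated 2]) (use D0 s in auto)
  qed
  \<comment> \<open>The induction starts after one application of the operator: \<open>u\<close>
    agrees with its representative only almost everywhere, whereas membership in
    \<open>oscillatory\<close> is an equality at every point of \<open>II\<close>.\<close>
  have "oscillatory (Suc j) m (\<lambda>\<kappa>. (Kop K \<kappa> ^^ Suc j) (u \<kappa>))" for j
  proof (induction j)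
    case 0
    have "oscillatory 0 m h" using oscillatory_osc[OF h(1), of 0] by simp
    from Kop_oscillatory[OF D0 this] show ?case
    proof (rule oscillatory_cong)
      fix \<kappa> s :: real assume k: "\<kappa> > 1" and s: "s \<in> II"
      have "h \<kappa> \<in> borel_measurable borel"
        using L2_ord_meas[OF Sob_ord_L2_ord[OF h(1)[unfolded amplitude_def]] k] .
      then show "(Kop K \<kappa> ^^ Suc 0) (u \<kappa>) s = Kop K \<kappa> (h \<kappa>) s"
        using Kop_AE_cong[of K s "h \<kappa>" "u \<kappa>" \<kappa>, OF Kc[OF s] _ h(2)[OF k]] by simp
    qed
  next
    case (Suc j)
    from Kop_oscillatory[OF D0 Suc.IH] show ?case by simp
  qed
  from this[of "n - 1"] \<open>1 \<le> n\<close> have "oscillatory n m (\<lambda>\<kappa>. (Kop K \<kappa> ^^ n) (u \<kappa>))" by simp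
  then show ?thesis using \<open>n \<le> m\<close> by (rule oscillatory_Hkk_tilde)
qed

end
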